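(* For every $n\ge1$, the integration functional $$\mu_n=c_{n,q}\,\mathcal I_n:\mathcal L(G)\to\mathbb C((X))$$ is left and right translation invariant on Morrow's integrable class $\mathcal L(G)$, $G=\mathrm{GL}_n(F)$, and is normalized by $\mu_n(K_0)=\mu_n(\mathbf 1_{K_0})=1$. The characteristic functions of $K_0$, $K_{i,j}$, $P_{i,j}$ ($i,j\ge1$), and all their left or right translates belong to that class. Moreover, for all $i,j\ge1$, $$\mu_n(K_{i,j})=c_{n,q}\,q^{-n^2i}X^{n^2j},\qquad \mu_n(P_{i,j})=c_{n,q}(1-q^{-1})^n\,q^{-m_ni}X^{m_nj}.$$ In particular, these values lie in the positive cone of $\mathbb R((X))$.
   Context: **Field and groups.** $k=\mathbb F_q$, $E=k((u))$, $F=E((t))$, $\mathcal O_1=E[[t]]$, $\mathcal O_2=k[[u]]+tE[[t]]\subset F$; $v_t,v_u$ are the normalized valuations of $F,E$ and a bar denotes reduction modulo $t$. $G=\mathrm{GL}_n(F)$, $K_0=\mathrm{GL}_n(\mathcal O_2)$, $B\subset G$ the upper triangular Borel subgroup, $Q_G=B\cap K_0$. For $i,j\ge1$: $J_{i,j}=u^it^j\mathcal O_2$, $K_{i,j}=I_n+M_n(J_{i,j})$, $P_{i,j}=Q_GK_{i,j}$. Constants: $d_{n,q}=\prod_{r=1}^n(1-q^{-r})$, $c_{n,q}=d_{n,q}^{-1}$, $m_n=n(n-1)/2$. For $a\in F^\times$, $|a|_F=q^{-v_u(\overline{at^{-v_t(a)}})}X^{v_t(a)}$. $\mu_n(A)$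 means $\mu_n(\mathbf 1_A)$. $\mathbb R((X))$ is ordered by declaring a nonzero Laurent series positive when the coefficient of its lowest nonzero power of $X$ is positive. **Fesenko–Morrow integral.** Additive Haar measure on $E$ is normalized by $\operatorname{vol}(k[[u]])=1$. For a function $f$ on $E$, $a\in F$, $\gamma\in\mathbb Z$, the lift $f^{a,\gamma}:F\to\mathbb C$ is $f^{a,\gamma}(x)=f(\overline{(x-a)t^{-\gamma}})$ for $x\in a+t^\gamma\mathcal O_1$ and $0$ otherwise. On the $\mathbb C(X)$-span of the lifts of complex-valued Haar integrable functions there is a unique $\mathbb C(X)$-linear functional with $\int_Ff^{a,\gamma}(x)\,dx=X^\gamma\int_Ef$. A $\mathbb C(X)$-valued function on $F^N$ (or a complex function on $E^N$) is called Fubini if its repeated integrals exist in every order of the variables and all agree; the common value is its (repeated) integral. For $f:E^N\to\mathbb C$, $a\in F^N$, $\gamma\in\mathbb Z^N$, the lift $f^{a,\gamma}$ is supported on $\prod_i(a_i+t^{\gamma_i}\mathcal O_1)$, where it equals $f$ of the coordinatewise reductions $\overline{(x_i-a_i)t^{-\gamma_i}}$. $f$ is GL-Fubini if $f\circ\sigma$ is Fubini for all $\sigma\in\mathrm{GL}_N(E)$ (e.g. Schwartz–Bruhat functions). Identify $M_n(F)$ with $F^{N}$, $N=n^2$, by matrix coordinates. Morrow's Fubini class on $M_n(F)$ is the $\mathbb C(X)$-span of the functions $f^{a,\gamma}\circ\tau$ with $f$ GL-Fubini on $E^{N}$, $a\in F^{N}$, $\gamma\in\mathbb Z^{N}$,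 $\tau\in\mathrm{GL}_{N}(F)$; such functions are Fubini. Morrow's space $\mathcal L(G)$ consists of the functions $\phi$ on $G$ for which $\tau\mapsto\phi(\tau)|\det\tau|_F^{-n}$ is the restriction to $G$ of a function $f_\phi$ in this Fubini class on $M_n(F)$, and $$\mathcal I_n(\phi)=\int_{M_n(F)}f_\phi(x)\,dx .$$ This is independent of the choice of extension $f_\phi$ (Morrow, "Integration on product spaces and $\mathrm{GL}_n$ of a valuation field over a local field"). Values are regarded in $\mathbb C((X))$ via $\mathbb C(X)\subset\mathbb C((X))$. *)

theory Defs
  imports
    "HOL-Analysis.Analysis"
    "HOL-Computational_Algebra.Formal_Laurent_Series"
    "HOL-Computational_Algebra.Polynomial_FPS"
begin

text \<open>
  The finite field \<open>k = F_q\<close> is a type \<^typ>\<open>'k\<close> of class field and finite, so that \<open>q = CARD('k)\<close>.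
  The library topology on \<^typ>\<open>'k fls\<close> is the \<open>u\<close>-adic one.
\<close>

type_synonym 'k E = "'k fls"
type_synonym 'k F = "'k fls fls"
type_synonym ('k, 'n) matF = "(('k F, 'n) vec, 'n) vec"

definition ring_E :: "'k::{field,finite} E set" where
  "ring_E = range fps_to_fls"

definition ring_O1 :: "'k::{field,finite} F set" where
  "ring_O1 = range fps_to_fls"

definition par_t :: "'k::{field,finite} F" where
  "par_t = fls_X"

definition par_u :: "'k::{field,finite} F" where
  "par_u = fls_const fls_X"

definition ring_O2 :: "'k::{field,finite} F set" where
  "ring_O2 = {fls_const b + par_t * y | b y. b \<in> ring_E \<and> y \<in> ring_O1}"

text \<open>Reduction modulo \<open>t\<close>; only meaningful on \<^const>\<open>ring_O1\<close>.\<close>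

definition red_t :: "'k::{field,finite} F \<Rightarrow> 'k E" where
  "red_t x = fls_nth x 0"

text \<open>
  The value field is \<open>C((X))\<close>, i.e. \<^typ>\<open>complex fls\<close>; \<open>C(X)\<close> is identified with its image
  there, and the variable \<open>X\<close> is \<^term>\<open>fls_X :: complex fls\<close>.
\<close>

definition ratfun :: "complex fls set" where
  "ratfun = {fps_to_fls (fps_of_poly p) / fps_to_fls (fps_of_poly r) | p r. r \<noteq> 0}"

definition abs_F :: "'k::{field,finite} F \<Rightarrow> complex fls" where
  "abs_F a =
     fls_const (of_nat CARD('k) powi (- fls_subdegree (red_t (a * par_t powi (- fls_subdegree a)))))
       * fls_X powi fls_subdegree a"

text \<open>
  Additive Haar measure, as a Borel measure. The normalization forces finite values on
  all balls, so no regularity or finiteness clause is needed for uniqueness.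
\<close>

definition haar_E :: "'k::{field,finite} E measure" where
  "haar_E = (THE M. sets M = sets borel
      \<and> (\<forall>a. \<forall>A\<in>sets borel. emeasure M ((\<lambda>x. a + x) ` A) = emeasure M A)
      \<and> emeasure M ring_E = 1)"

definition lift1 :: "('k::{field,finite} E \<Rightarrow> complex) \<Rightarrow> 'k F \<Rightarrow> int \<Rightarrow> 'k F \<Rightarrow> complex fls" where
  "lift1 f a \<gamma> x =
     (if (x - a) * par_t powi (- \<gamma>) \<in> ring_O1
      then fls_const (f (red_t ((x - a) * par_t powi (- \<gamma>)))) else 0)"

text \<open>
  The graph of the Fesenko--Morrow functional: the \<open>C(X)\<close>-span of all pairs
  \<open>(f\<^sup>a\<^sup>,\<^sup>\<gamma>, X\<^sup>\<gamma> \<integral>\<^sub>E f)\<close>. Thus \<open>g\<close> belongs to the \<open>C(X)\<close>-span of the lifts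
  iff it has an integral in this sense.
\<close>

inductive has_F_integral :: "('k::{field,finite} F \<Rightarrow> complex fls) \<Rightarrow> complex fls \<Rightarrow> bool" where
  zero: "has_F_integral (\<lambda>x. 0) 0"
| step: "c \<in> ratfun \<Longrightarrow> integrable haar_E f \<Longrightarrow> has_F_integral g I
    \<Longrightarrow> has_F_integral (\<lambda>x. c * lift1 f a \<gamma> x + g x)
          (c * (fls_X powi \<gamma> * fls_const (integral\<^sup>L haar_E f)) + I)"

definition vec_upd :: "'a ^ 'i \<Rightarrow> 'i::finite \<Rightarrow> 'a \<Rightarrow> 'a ^ 'i" where
  "vec_upd x i y = (\<chi> j. if j = i then y else vec_nth x j)"

text \<open>
  \<open>H f c\<close> reads "the one-variable function \<open>f\<close> is integrable with integral \<open>c\<close>". The variables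
  are integrated out in the order of the list, head first (innermost); each one-variable
  integral has to exist for all values, not just almost all, of the remaining variables.
  A variable that has been integrated out is kept as a dummy argument, so that the final
  result is a constant function.
\<close>

fun has_iterated_integral ::
    "(('a \<Rightarrow> 'b) \<Rightarrow> 'b \<Rightarrow> bool) \<Rightarrow> 'i::finite list \<Rightarrow> ('a ^ 'i \<Rightarrow> 'b) \<Rightarrow> 'b \<Rightarrow> bool" where
  "has_iterated_integral H [] f c \<longleftrightarrow> (\<forall>x. f x = c)"
| "has_iterated_integral H (i # is) f c \<longleftrightarrow>
     (\<exists>h. (\<forall>x. H (\<lambda>y. f (vec_upd x i y)) (h x)) \<and> has_iterated_integral H is h c)"

definition has_fubini_integral ::
    "(('a \<Rightarrow> 'b) \<Rightarrow> 'b \<Rightarrow> bool) \<Rightarrow> ('a ^ 'i::finite \<Rightarrow> 'b) \<Rightarrow> 'b \<Rightarrow> bool" where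
  "has_fubini_integral H f c \<longleftrightarrow>
     (\<forall>is. distinct is \<and> set is = UNIV \<longrightarrow> has_iterated_integral H is f c)"

definition fubini :: "(('a \<Rightarrow> 'b) \<Rightarrow> 'b \<Rightarrow> bool) \<Rightarrow> ('a ^ 'i::finite \<Rightarrow> 'b) \<Rightarrow> bool" where
  "fubini H f \<longleftrightarrow> (\<exists>c. has_fubini_integral H f c)"

definition GL_fubini :: "('k::{field,finite} E ^ 'i::finite \<Rightarrow> complex) \<Rightarrow> bool" where
  "GL_fubini f \<longleftrightarrow>
     (\<forall>\<sigma> :: 'k E ^ 'i ^ 'i. invertible \<sigma> \<longrightarrow>
        fubini (has_bochner_integral haar_E) (\<lambda>x. f (\<sigma> *v x)))"

definition lift :: "('k::{field,finite} E ^ 'i::finite \<Rightarrow> complex) \<Rightarrow> 'k F ^ 'i \<Rightarrow> int ^ 'i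
    \<Rightarrow> 'k F ^ 'i \<Rightarrow> complex fls" where
  "lift f a \<gamma> x =
     (if \<forall>i. (vec_nth x i - vec_nth a i) * par_t powi (- vec_nth \<gamma> i) \<in> ring_O1
      then fls_const (f (\<chi> i. red_t ((vec_nth x i - vec_nth a i) * par_t powi (- vec_nth \<gamma> i))))
      else 0)"

inductive_set morrow_class :: "('k::{field,finite} F ^ 'i::finite \<Rightarrow> complex fls) set" where
  zero: "(\<lambda>x. 0) \<in> morrow_class"
| step: "c \<in> ratfun \<Longrightarrow> GL_fubini f \<Longrightarrow> invertible (\<tau> :: 'k F ^ 'i ^ 'i) \<Longrightarrow> g \<in> morrow_class
    \<Longrightarrow> (\<lambda>x. c * lift f a \<gamma> (\<tau> *v x) + g x) \<in> morrow_class"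

definition GLn :: "('k::{field,finite}, 'n::finite) matF set" where
  "GLn = {g. invertible g}"

text \<open>The identification of \<open>M\<^sub>n(F)\<close> with \<open>F\<^sup>N\<close>, \<open>N = n\<^sup>2\<close>, by matrix coordinates.\<close>

definition coords :: "'a ^ 'n::finite ^ 'n \<Rightarrow> 'a ^ ('n \<times> 'n)" where
  "coords x = (\<chi> p. vec_nth (vec_nth x (fst p)) (snd p))"

text \<open>
  Functions on \<open>G\<close> are represented by functions on all matrices whose values off \<open>G\<close> are
  never looked at.
\<close>

definition morrow_extension ::
    "(('k::{field,finite}, 'n::finite) matF \<Rightarrow> complex fls)
      \<Rightarrow> ('k F ^ ('n \<times> 'n) \<Rightarrow> complex fls) \<Rightarrow> bool" where
  "morrow_extension \<phi> f \<longleftrightarrow> f \<in> morrow_class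
     \<and> (\<forall>\<tau>\<in>GLn. f (coords \<tau>) = \<phi> \<tau> * abs_F (det \<tau>) powi (- int CARD('n)))"

definition LG :: "(('k::{field,finite}, 'n::finite) matF \<Rightarrow> complex fls) set" where
  "LG = {\<phi>. \<exists>f. morrow_extension \<phi> f}"

definition morrow_integral ::
    "(('k::{field,finite}, 'n::finite) matF \<Rightarrow> complex fls) \<Rightarrow> complex fls" where
  "morrow_integral \<phi> =
     (THE I. \<exists>f. morrow_extension \<phi> f \<and> has_fubini_integral has_F_integral f I)"

definition d_const :: "nat \<Rightarrow> nat \<Rightarrow> real" where
  "d_const n q = (\<Prod>r=1..n. 1 - real q powi (- int r))"

definition c_const :: "nat \<Rightarrow> nat \<Rightarrow> real" where
  "c_const n q = inverse (d_const n q)"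

definition real_const :: "real \<Rightarrow> complex fls" where
  "real_const r = fls_const (complex_of_real r)"

definition mu :: "(('k::{field,finite}, 'n::finite) matF \<Rightarrow> complex fls) \<Rightarrow> complex fls" where
  "mu \<phi> = real_const (c_const CARD('n) CARD('k)) * morrow_integral \<phi>"

definition matrices_over :: "'a set \<Rightarrow> ('a ^ 'n::finite ^ 'n) set" where
  "matrices_over S = {x. \<forall>r s. vec_nth (vec_nth x r) s \<in> S}"

definition K0 :: "('k::{field,finite}, 'n::finite) matF set" where
  "K0 = {g \<in> matrices_over ring_O2. \<exists>h \<in> matrices_over ring_O2. g ** h = mat 1 \<and> h ** g = mat 1}"

definition borel_G :: "('k::{field,finite}, 'n::{finite,linorder}) matF set" where
  "borel_G = {g \<in> GLn. \<forall>r s. s < r \<longrightarrow> vec_nth (vec_nth g r) s = 0}"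

definition QG :: "('k::{field,finite}, 'n::{finite,linorder}) matF set" where
  "QG = borel_G \<inter> K0"

definition Jideal :: "nat \<Rightarrow> nat \<Rightarrow> 'k::{field,finite} F set" where
  "Jideal i j = {par_u ^ i * par_t ^ j * x | x. x \<in> ring_O2}"

definition Kij :: "nat \<Rightarrow> nat \<Rightarrow> ('k::{field,finite}, 'n::finite) matF set" where
  "Kij i j = {mat 1 + x | x. x \<in> matrices_over (Jideal i j)}"

definition Pij :: "nat \<Rightarrow> nat \<Rightarrow> ('k::{field,finite}, 'n::{finite,linorder}) matF set" where
  "Pij i j = {b ** x | b x. b \<in> QG \<and> x \<in> Kij i j}"

definition positive_cone :: "real fls set" where
  "positive_cone = {r. r \<noteq> 0 \<and> fls_nth r (fls_subdegree r) > 0}"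

text \<open>The inclusion \<open>R((X)) \<subseteq> C((X))\<close>.\<close>

definition complexify :: "real fls \<Rightarrow> complex fls" where
  "complexify r = Abs_fls (\<lambda>m. complex_of_real (fls_nth r m))"

end

theory Submission
  imports Defs "HOL-Probability.Infinite_Product_Measure"
begin

text \<open>
The functional \<open>\<mu>\<^sub>n\<close> rests on three uniqueness statements: the integral in one variable over \<open>F\<close> is well defined,
repeated integrals of functions in Morrow's class do not depend on the order of the variables, and a function
on \<open>GL\<^sub>n(F)\<close> has at most one extension to that class. Each has a short reason.

\<^item> One variable. The Haar measure on \<open>E\<close> is determined by its values on balls, and it is realized as counting measure on
polar parts times the product of uniform measures on the digits. For a function \<open>g\<close> in the span of the lifts, consider
a single power of \<open>X\<close> in \<open>g(b + e t\<^sup>m)\<close> as a function of \<open>e \<in> E\<close>. Lifts of level below \<open>m\<close> contribute a constant, lifts of level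
above \<open>m\<close> contribute only at single points, and lifts of level \<open>m\<close> contribute an integrable function. As \<open>E\<close> has infinite measure,
the constant and the integral of the integrable part can be read off from \<open>g\<close>; they give the integral of \<open>g\<close> layer by layer
(\<open>has_F_integral_layers\<close>, \<open>has_F_integral_unique\<close>).

\<^item> Several variables. Let \<open>\<tau> \<in> GL\<^sub>N(F)\<close> and let an order of integration be given. Gaussian elimination with pivots of minimal
valuation writes \<open>\<tau> = A T\<close>, where \<open>A\<close> is a product of shears over \<open>E[[t]]\<close> and \<open>T\<close> is triangular for that order
(\<open>shears_triangular_decomposition\<close>). Modulo \<open>t\<close> the shears become shears over \<open>E\<close>, which preserve the integral of a GL-Fubini function:
integrate last the variable that is being added to the others. The triangular matrix is removed one variable at a time and produces
the product of the \<open>\<bar>T\<^sub>j\<^sub>j\<bar>\<^sup>-\<^sup>1\<close>, which is \<open>\<bar>det \<tau>\<bar>\<^sup>-\<^sup>1\<close> because \<open>det A = 1\<close>. So the value is the same for all orders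
(\<open>has_fubini_integral_lift0_affine\<close>), and the change of variables formula holds on Morrow's class
(\<open>morrow_class_change_of_variables\<close>). Left or right multiplication by \<open>g\<close> on \<open>M\<^sub>n(F)\<close> has determinant \<open>(det g)\<^sup>n\<close>, which cancels
against the factor \<open>\<bar>det \<tau>\<bar>\<^sup>-\<^sup>n\<close> in the definition of the integral on the group; this is translation invariance.

\<^item> Extensions. A function in Morrow's class is constant on the cosets of \<open>t\<^sup>M M\<^sub>n(E[[t]])\<close> for some \<open>M\<close>, and every such coset
contains an invertible matrix. Hence a function in the class is determined by its restriction to \<open>GL\<^sub>n(F)\<close> (\<open>morrow_class_eq_on_GLn\<close>).

The values follow because the characteristic functions of \<open>K\<^sub>0\<close>, \<open>K\<^sub>i\<^sub>j\<close> and \<open>P\<^sub>i\<^sub>j\<close> are lifts of characteristic functions of compact open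
subsets of \<open>E\<^sup>N\<close>, and \<open>\<bar>det\<bar> = 1\<close> on \<open>K\<^sub>0\<close>, which contains the others. Compactly supported locally constant functions on \<open>E\<^sup>N\<close> are GL-Fubini: the class is stable
under \<open>GL\<^sub>N(E)\<close>, and their repeated integrals are finite sums. For \<open>K\<^sub>0\<close> the sum counts the invertible matrices over the residue
field; for \<open>K\<^sub>i\<^sub>j\<close> and \<open>P\<^sub>i\<^sub>j\<close> the compact open set is a box, by the entrywise description \<open>Pij_iff\<close> in the second case.
\<close>

(* The symbol is left to the components of vectors. *)
no_notation fps_nth (infixl \<open>$\<close> 75)

section \<open>Balls in fields of Laurent series\<close>

text \<open>
The ball of radius \<open>q\<^sup>-\<^sup>m\<close> around \<open>c\<close>, written through coefficients. The same definition serves the \<open>u\<close>-adic topology on \<open>E\<close> and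
the \<open>t\<close>-adic topology on \<open>F\<close>.
\<close>

definition cyl :: "'a::zero fls \<Rightarrow> int \<Rightarrow> 'a fls set" where
  "cyl c m = {x. \<forall>n<m. fls_nth x n = fls_nth c n}"

definition trunc :: "int \<Rightarrow> 'a::zero fls \<Rightarrow> 'a fls" where
  "trunc m c = Abs_fls (\<lambda>n. if n < m then fls_nth c n else 0)"

lemma trunc_nth [simp]: "fls_nth (trunc m c) n = (if n < m then fls_nth c n else 0)"
proof -
  obtain N where "\<forall>n<N. fls_nth c n = 0" using fls_nth_vanishes_belowE by blast
  then show ?thesis unfolding trunc_def by (subst nth_Abs_fls_lower_bound[of N]) auto
qed

lemma cyl_trunc: "cyl (trunc m c) m = cyl c m"
  by (auto simp: cyl_def)

lemma trunc_eq_iff: "trunc m c = trunc m d \<longleftrightarrow> c \<in> cyl d m"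
  by (auto simp: fls_eq_iff cyl_def)

lemma cyl_nested: "cyl c m \<inter> cyl d l = {} \<or> cyl c m \<subseteq> cyl d l \<or> cyl d l \<subseteq> cyl c m"
proof (cases "m \<le> l")
  case True
  then show ?thesis unfolding cyl_def by (smt (verit) disjoint_iff mem_Collect_eq subsetI)
next
  case False
  then show ?thesis unfolding cyl_def by (smt (verit) disjoint_iff mem_Collect_eq subsetI)
qed

text \<open>
The zero series is split off because \<open>fls_subdegree 0 = 0\<close> by convention.
\<close>

lemma subdegree_ge_iff: "(\<forall>n<m. fls_nth x n = 0) \<longleftrightarrow> x = 0 \<or> m \<le> fls_subdegree x"
  by (metis fls_eq0_below_subdegree fls_subdegree_geI fls_zero_nth order_less_le_trans)

lemma open_cyl: "open (cyl c m :: 'a::group_add fls set)"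
proof -
  have "z \<in> cyl c m" if y: "y \<in> cyl c m" and d: "dist z y < inverse (2 ^ nat m)" for y z :: "'a fls"
  proof (cases "z = y")
    case False
    have "m \<le> fls_subdegree (z - y)"
    proof (rule ccontr)
      assume "\<not> m \<le> fls_subdegree (z - y)"
      then have s: "fls_subdegree (z - y) < m" by simp
      have "inverse (2 ^ nat m) \<le> dist z y"
      proof (cases "fls_subdegree (z - y) \<ge> 0")
        case True
        then show ?thesis using s False by (simp add: dist_fls_def)
      next
        case F: False
        have "inverse (2 ^ nat m) \<le> (1::real)" by (simp add: inverse_le_1_iff)
        also have "1 \<le> (2::real) ^ nat (- fls_subdegree (z - y))" by simp
        finally show ?thesis using F False by (simp add: dist_fls_def)
      qed
      with d show False by simp
    qed
    then have "\<forall>n<m. fls_nth z n = fls_nth y n"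
      by (metis eq_iff_diff_eq_0 fls_eq0_below_subdegree fls_minus_nth order_less_le_trans)
    with y show ?thesis by (simp add: cyl_def)
  qed (use y in simp)
  then show ?thesis unfolding open_fls_def
    by (metis (no_types, lifting) inverse_positive_iff_positive mem_Collect_eq subsetI zero_less_numeral zero_less_power)
qed

lemma cyl_subset_open:
  fixes U :: "'a::group_add fls set"
  assumes "open U" "x \<in> U"
  shows "\<exists>m::nat. cyl x (int m) \<subseteq> U"
proof -
  obtain r where r: "r > 0" "{y. dist y x < r} \<subseteq> U" using assms by (auto simp: open_fls_def)
  obtain m where m: "inverse (2 ^ m) < r" 
    using real_arch_pow_inv[of r "1/2"] r(1) by (auto simp: power_one_over inverse_eq_divide)
  have "dist y x < r" if "y \<in> cyl x (int m)" for y
  proof (cases "y = x")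
    case False
    have "\<forall>n<int m. fls_nth (y - x) n = 0" using that by (simp add: cyl_def)
    then have s: "int m \<le> fls_subdegree (y - x)" using False subdegree_ge_iff[of "int m" "y - x"] by simp
    then have "dist y x \<le> inverse (2 ^ m)" using False by (simp add: dist_fls_def le_nat_iff)
    with m show ?thesis by simp
  qed (use r in simp)
  with r(2) show ?thesis by blast
qed

text \<open>
Truncations are available as centres of all balls; over a finite field there are only countably many of them, which makes the topology
second countable.
\<close>

definition fin_fls :: "'a::zero fls set" where
  "fin_fls = {x. \<exists>m. \<forall>n\<ge>m. fls_nth x n = 0}"

lemma countable_fin_fls: "countable (fin_fls :: 'a::{finite,zero} fls set)"
proof -
  let ?S = "\<lambda>(N::int,m::int). (\<lambda>g. Abs_fls (\<lambda>n. if N \<le> n \<and> n < m then g n else (0::'a))) ` ({N..<m} \<rightarrow>\<^sub>E UNIV)"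
  have "fin_fls \<subseteq> (\<Union>p. ?S p)"
  proof
    fix x :: "'a fls" assume "x \<in> fin_fls"
    then obtain m where m: "\<forall>n\<ge>m. fls_nth x n = 0" by (auto simp: fin_fls_def)
    obtain N where N: "\<forall>n<N. fls_nth x n = 0" using fls_nth_vanishes_belowE by blast
    have "x = Abs_fls (\<lambda>n. if N \<le> n \<and> n < m then restrict (fls_nth x) {N..<m} n else 0)"
      using N m by (intro fls_eqI, subst nth_Abs_fls_lower_bound[of N]) (auto simp: not_le not_less)
    moreover have "restrict (fls_nth x) {N..<m} \<in> {N..<m} \<rightarrow>\<^sub>E UNIV" by auto
    ultimately have "x \<in> ?S (N, m)" by blast
    then show "x \<in> (\<Union>p. ?S p)" by blast
  qed
  moreover have "finite (?S p)" for p
    by (cases p) (auto intro!: finite_imageI finite_PiE)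
  then have "countable (\<Union>p. ?S p)"
    by (intro countable_UN) (auto intro: countable_finite)
  ultimately show ?thesis using countable_subset by blast
qed

lemma trunc_fin_fls: "trunc m c \<in> fin_fls"
  unfolding fin_fls_def by (auto intro!: exI[of _ m])

text \<open>
The balls of radius at most \<open>1\<close>. The empty set is included to make the family stable under intersections.
\<close>

definition small_cyls :: "'a::zero fls set set" where
  "small_cyls = insert {} {cyl c (int m) | c m. True}"

lemma countable_small_cyls: "countable (small_cyls :: 'a::{finite,zero} fls set set)"
proof -
  have "(small_cyls :: 'a fls set set) \<subseteq> insert {} ((\<lambda>(c,m). cyl c (int m)) ` (fin_fls \<times> (UNIV :: nat set)))"
  proof
    fix A :: "'a fls set" assume "A \<in> small_cyls"
    then consider "A = {}" | c m where "A = cyl c (int m)" by (auto simp: small_cyls_def)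
    then show "A \<in> insert {} ((\<lambda>(c,m). cyl c (int m)) ` (fin_fls \<times> (UNIV :: nat set)))"
    proof cases
      case 2
      then have "A = (\<lambda>(c,m). cyl c (int m)) (trunc (int m) c, m)" by (simp add: cyl_trunc)
      then show ?thesis using trunc_fin_fls by blast
    qed simp
  qed
  then show ?thesis
    by (rule countable_subset) (intro countable_insert countable_image countable_SIGMA countable_fin_fls; simp)
qed

lemma Int_stable_small_cyls: "Int_stable small_cyls"
proof (rule Int_stableI)
  fix A B :: "'a fls set" assume A: "A \<in> small_cyls" and B: "B \<in> small_cyls"
  show "A \<inter> B \<in> small_cyls"
  proof (cases "A = {} \<or> B = {}")
    case True
    then show ?thesis by (auto simp: small_cyls_def)
  next
    case False
    then obtain c m d l where "A = cyl c (int m)" "B = cyl d (int l)" using A B by (auto simp: small_cyls_def)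
    then have "A \<inter> B \<in> {{}, A, B}" using cyl_nested[of c "int m" d "int l"] by blast
    then show ?thesis using A B by (auto simp: small_cyls_def)
  qed
qed

text \<open>
An open set is the union of the balls of radius at most \<open>1\<close> that it contains, and there are only countably many such balls.
\<close>

lemma sets_borel_small_cyls:
  "sets (borel :: 'a::{finite,group_add} fls measure) = sigma_sets UNIV small_cyls"
proof
  show "sets (borel :: 'a fls measure) \<subseteq> sigma_sets UNIV small_cyls"
    unfolding sets_borel
  proof (rule sigma_sets_mono)
    show "{S. open S} \<subseteq> sigma_sets UNIV (small_cyls :: 'a fls set set)"
    proof
      fix S :: "'a fls set" assume "S \<in> {S. open S}"
      then have S: "open S" by simp
      have "S = \<Union>{A \<in> small_cyls. A \<subseteq> S}"
      proof
        show "S \<subseteq> \<Union>{A \<in> small_cyls. A \<subseteq> S}"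
        proof
          fix x assume "x \<in> S"
          then obtain m where "cyl x (int m) \<subseteq> S" using cyl_subset_open S by blast
          moreover have "x \<in> cyl x (int m)" by (simp add: cyl_def)
          ultimately show "x \<in> \<Union>{A \<in> small_cyls. A \<subseteq> S}" unfolding small_cyls_def by blast
        qed
      qed blast
      moreover have "\<Union>{A \<in> small_cyls. A \<subseteq> S} \<in> sigma_sets UNIV small_cyls"
        by (rule sigma_sets_UNION)
          (auto intro: countable_subset[OF _ countable_small_cyls] sigma_sets.Basic)
      ultimately show "S \<in> sigma_sets UNIV small_cyls" by simp
    qed
  qed
  show "sigma_sets UNIV small_cyls \<subseteq> sets (borel :: 'a fls measure)"
    unfolding sets_borel
    by (rule sigma_sets_mono) (auto simp: small_cyls_def open_cyl intro: sigma_sets.Basic sigma_sets.Empty)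
qed

lemma cyl_borel [measurable]: "cyl (c :: 'a::{finite,group_add} fls) m \<in> sets borel"
  by (simp add: open_cyl borel_open)

lemma measurable_fls_iff_cyl:
  fixes f :: "'b \<Rightarrow> 'a::{finite,group_add} fls"
  assumes "\<And>c m. f -` cyl c (int m) \<inter> space M \<in> sets M"
  shows "f \<in> borel_measurable M"
  by (rule measurable_sigma_sets[OF sets_borel_small_cyls]) (auto simp: small_cyls_def assms)

text \<open>
Any two balls are nested or disjoint, so the balls of radius at most \<open>1\<close> form an intersection-stable generator of the Borel sets; a
measure that is finite on them is determined by its values there.
\<close>

lemma measure_eqI_cyl:
  fixes M N :: "'a::{finite,group_add} fls measure"
  assumes "sets M = sets borel" "sets N = sets borel"
    and "\<And>c m. emeasure M (cyl c (int m)) = emeasure N (cyl c (int m))"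
    and "\<And>c. emeasure M (cyl c 0) \<noteq> \<infinity>"
  shows "M = N"
proof (rule measure_eqI_generator_eq_countable[OF Int_stable_small_cyls])
  show "range (\<lambda>c. cyl c 0) \<subseteq> (small_cyls :: 'a fls set set)"
    by (force simp: small_cyls_def intro: exI[of _ "0::nat"])
  then show "countable (range (\<lambda>c::'a fls. cyl c 0))" using countable_small_cyls countable_subset by blast
  show "\<Union>(range (\<lambda>c::'a fls. cyl c 0)) = UNIV" by (auto simp: cyl_def)
qed (use assms in \<open>auto simp: small_cyls_def sets_borel_small_cyls\<close>)

section \<open>Haar measure on \<open>E\<close>\<close>

text \<open>
A series is its polar part together with the sequence of its coefficients in nonnegative degree. The Haar measure is the counting
measure on polar parts times the product of the uniform measures on the coefficients.
\<close>

definition digit_space :: "(nat \<Rightarrow> 'k::{field,finite}) measure" where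
  "digit_space = PiM UNIV (\<lambda>_. uniform_count_measure UNIV)"

definition polar_parts :: "'k::{field,finite} fls set" where
  "polar_parts = {r. \<forall>n\<ge>0. fls_nth r n = 0}"

definition haar_model :: "'k::{field,finite} fls measure" where
  "haar_model = distr (count_space polar_parts \<Otimes>\<^sub>M digit_space) borel
     (\<lambda>(r, w). r + fps_to_fls (Abs_fps w))"

interpretation digits: product_prob_space "\<lambda>_. uniform_count_measure (UNIV :: 'k::{field,finite} set)" "UNIV :: nat set"
  by unfold_locales (auto intro!: prob_space.emeasure_space_1 prob_space_uniform_count_measure finite_measure.finite_emeasure_space
    simp: space_uniform_count_measure emeasure_uniform_count_measure)

lemma prob_space_digit_space: "prob_space (digit_space :: (nat \<Rightarrow> 'k::{field,finite}) measure)"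
  unfolding digit_space_def by (rule digits.prob_space_axioms)

lemma space_digit_space: "space (digit_space :: (nat \<Rightarrow> 'k::{field,finite}) measure) = UNIV"
  by (auto simp: digit_space_def space_PiM space_uniform_count_measure)

lemma sets_digit_cylinder:
  "{w. \<forall>i<m. w i = a i} \<in> sets (digit_space :: (nat \<Rightarrow> 'k::{field,finite}) measure)"
proof -
  have "{w \<in> space digit_space. \<forall>i\<in>{..<m}. w i \<in> {a i}} \<in> sets (digit_space :: (nat \<Rightarrow> 'k) measure)"
    unfolding digit_space_def
    by (intro sets.sets_Collect_finite_All measurable_sets_Collect[OF measurable_component_singleton])
      (auto simp: sets_uniform_count_measure space_uniform_count_measure)
  then show ?thesis by (simp add: space_digit_space Ball_def)
qed

lemma emeasure_digit_cylinder:
  "emeasure digit_space {w. \<forall>i<m. w i = (a i :: 'k::{field,finite})} = ennreal ((1 / CARD('k)) ^ m)"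
proof -
  have "emeasure digit_space {w \<in> space (digit_space). \<forall>i\<in>{..<m}. w i \<in> {a i}} =
      (\<Prod>i\<in>{..<m}. emeasure (uniform_count_measure (UNIV :: 'k set)) {a i})"
    unfolding digit_space_def
    by (rule digits.emeasure_PiM_Collect) (auto simp: sets_uniform_count_measure)
  also have "\<dots> = ennreal ((1 / CARD('k)) ^ m)"
    by (simp add: emeasure_uniform_count_measure ennreal_power)
  finally show ?thesis by (simp add: space_digit_space Ball_def)
qed

lemma polar_cylinder:
  assumes "r \<in> polar_parts"
  shows "{w. r + fps_to_fls (Abs_fps w) \<in> cyl c (int m)} =
    (if r = trunc 0 c then {w. \<forall>i<m. w i = fls_nth c (int i)} else {})"
proof -
  have "r = trunc 0 c \<longleftrightarrow> (\<forall>n<0. fls_nth r n = fls_nth c n)"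
    using assms by (auto simp: fls_eq_iff polar_parts_def not_less)
  moreover have "r + fps_to_fls (Abs_fps w) \<in> cyl c (int m) \<longleftrightarrow>
      (\<forall>n<0. fls_nth r n = fls_nth c n) \<and> (\<forall>i<m. w i = fls_nth c (int i))" for w
  proof
    assume L: "r + fps_to_fls (Abs_fps w) \<in> cyl c (int m)"
    have "fls_nth r n = fls_nth c n" if "n < 0" for n
      using L that by (auto simp: cyl_def dest!: spec[of _ n])
    moreover have "w i = fls_nth c (int i)" if "i < m" for i
      using L that assms by (auto simp: cyl_def polar_parts_def dest!: spec[of _ "int i"])
    ultimately show "(\<forall>n<0. fls_nth r n = fls_nth c n) \<and> (\<forall>i<m. w i = fls_nth c (int i))" by blast
  next
    assume R: "(\<forall>n<0. fls_nth r n = fls_nth c n) \<and> (\<forall>i<m. w i = fls_nth c (int i))"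
    have "fls_nth (r + fps_to_fls (Abs_fps w)) n = fls_nth c n" if "n < int m" for n
    proof (cases "n < 0")
      case False
      then obtain i where "n = int i" by (metis nonneg_int_cases not_less)
      then show ?thesis using R that assms by (auto simp: polar_parts_def)
    qed (use R in simp)
    then show "r + fps_to_fls (Abs_fps w) \<in> cyl c (int m)" by (simp add: cyl_def)
  qed
  ultimately show ?thesis by auto
qed

lemma countable_polar_parts: "countable (polar_parts :: 'k::{field,finite} fls set)"
  by (rule countable_subset[OF _ countable_fin_fls]) (auto simp: polar_parts_def fin_fls_def)

lemma measurable_polar_digits:
  "(\<lambda>(r, w). r + fps_to_fls (Abs_fps w)) \<in>
     borel_measurable (count_space polar_parts \<Otimes>\<^sub>M (digit_space :: (nat \<Rightarrow> 'k::{field,finite}) measure))"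
proof (rule measurable_pair_measure_countable1[OF countable_polar_parts])
  fix r :: "'k fls" assume r: "r \<in> polar_parts"
  show "(\<lambda>y. case (r, y) of (r, w) \<Rightarrow> r + fps_to_fls (Abs_fps w)) \<in> borel_measurable digit_space"
    by (rule measurable_fls_iff_cyl)
      (simp add: vimage_def space_digit_space polar_cylinder[OF r] sets_digit_cylinder)
qed

text \<open>
Only one polar part meets the ball, and the ball then prescribes \<open>m\<close> independent uniform digits.
\<close>

lemma emeasure_haar_model_cyl:
  "emeasure haar_model (cyl (c :: 'k::{field,finite} fls) (int m)) = ennreal ((1 / CARD('k)) ^ m)"
proof -
  interpret P: prob_space "digit_space :: (nat \<Rightarrow> 'k) measure" by (rule prob_space_digit_space)
  let ?f = "\<lambda>(r, w). r + fps_to_fls (Abs_fps w) :: 'k fls"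
  let ?M = "count_space polar_parts \<Otimes>\<^sub>M (digit_space :: (nat \<Rightarrow> 'k) measure)"
  have "emeasure haar_model (cyl c (int m)) = emeasure ?M (?f -` cyl c (int m) \<inter> space ?M)"
    unfolding haar_model_def by (rule emeasure_distr[OF measurable_polar_digits]) simp
  also have "\<dots> = (\<integral>\<^sup>+ r. emeasure digit_space (Pair r -` (?f -` cyl c (int m) \<inter> space ?M)) \<partial>count_space polar_parts)"
    by (rule P.emeasure_pair_measure_alt)
       (rule measurable_sets[OF measurable_polar_digits], simp)
  also have "\<dots> = (\<integral>\<^sup>+ r. ennreal ((1 / CARD('k)) ^ m) * indicator {trunc 0 c} r \<partial>count_space polar_parts)"
  proof (rule nn_integral_cong)
    fix r :: "'k fls" assume "r \<in> space (count_space polar_parts)"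
    then have r: "r \<in> polar_parts" by simp
    have "Pair r -` (?f -` cyl c (int m) \<inter> space ?M) = {w. r + fps_to_fls (Abs_fps w) \<in> cyl c (int m)}"
      using r by (auto simp: space_pair_measure space_digit_space)
    then show "emeasure digit_space (Pair r -` (?f -` cyl c (int m) \<inter> space ?M)) =
        ennreal ((1 / CARD('k)) ^ m) * indicator {trunc 0 c} r"
      by (simp add: polar_cylinder[OF r] emeasure_digit_cylinder)
  qed
  also have "\<dots> = ennreal ((1 / CARD('k)) ^ m) * emeasure (count_space polar_parts) {trunc 0 c}"
    by (rule nn_integral_cmult_indicator) (auto simp: polar_parts_def)
  also have "emeasure (count_space polar_parts) {trunc 0 c} = 1"
    by (subst emeasure_count_space_finite) (auto simp: polar_parts_def)
  finally show ?thesis by simp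
qed

lemma sets_haar_model [simp]: "sets haar_model = sets borel"
  by (simp add: haar_model_def)

lemma ring_E_cyl: "ring_E = (cyl 0 0 :: 'k::{field,finite} fls set)"
proof -
  have "x \<in> range fps_to_fls" if "\<forall>n<0. fls_nth x n = 0" for x :: "'k fls"
  proof -
    have "x = fps_to_fls (fls_regpart x)" using that by (intro fls_eqI) auto
    then show ?thesis by blast
  qed
  then show ?thesis by (auto simp: ring_E_def cyl_def)
qed

lemma cyl_translate: "(\<lambda>x. a + x) ` cyl c m = cyl (a + c) m" for a :: "'a::ab_group_add fls"
proof -
  have "x = a + (x - a)" "x - a \<in> cyl c m" if "x \<in> cyl (a + c) m" for x
    using that by (auto simp: cyl_def algebra_simps)
  then have "cyl (a + c) m \<subseteq> (\<lambda>x. a + x) ` cyl c m" by blast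
  moreover have "(\<lambda>x. a + x) ` cyl c m \<subseteq> cyl (a + c) m"
    by (rule image_subsetI) (simp add: cyl_def)
  ultimately show ?thesis by (rule equalityI[rotated])
qed

lemma vimage_translate_cyl: "(\<lambda>x. x + a) -` cyl c m = cyl (c - a) m" for a :: "'a::ab_group_add fls"
  by (auto simp: cyl_def algebra_simps)

text \<open>
A ball is the disjoint union of \<open>q\<close> balls of the next smaller radius.
\<close>

lemma emeasure_cyl_step:
  fixes M :: "'k::{field,finite} fls measure"
  assumes M: "sets M = sets borel" and inv: "\<And>c d. emeasure M (cyl c (m+1)) = emeasure M (cyl d (m+1))"
  shows "emeasure M (cyl c m) = of_nat CARD('k) * emeasure M (cyl d (m+1))"
proof -
  define p where "p = (\<lambda>a::'k. trunc m c + fls_shift (- m) (fls_const a))"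
  have pn: "fls_nth (p a) n = (if n < m then fls_nth c n else if n = m then a else 0)" for a n
    by (auto simp: p_def)
  have "cyl c m = (\<Union>a. cyl (p a) (m+1))"
  proof (intro equalityI subsetI)
    fix x assume "x \<in> cyl c m"
    then have "x \<in> cyl (p (fls_nth x m)) (m+1)" by (auto simp: cyl_def pn)
    then show "x \<in> (\<Union>a. cyl (p a) (m+1))" by blast
  qed (auto simp: cyl_def pn)
  moreover have "disjoint_family (\<lambda>a. cyl (p a) (m+1))"
  proof (clarsimp simp: disjoint_family_on_def)
    fix a b :: 'k assume "a \<noteq> b"
    moreover have "x \<in> cyl (p a) (m+1) \<Longrightarrow> fls_nth x m = a" for x a
      by (auto simp: cyl_def pn)
    ultimately show "cyl (p a) (m+1) \<inter> cyl (p b) (m+1) = {}" by blast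
  qed
  ultimately have "emeasure M (cyl c m) = (\<Sum>a\<in>UNIV. emeasure M (cyl (p a) (m+1)))"
    using sum_emeasure[of "\<lambda>a. cyl (p a) (m+1)" UNIV M] M cyl_borel by (metis finite image_subsetI)
  also have "\<dots> = of_nat CARD('k) * emeasure M (cyl d (m+1))"
  proof -
    have "(\<Sum>a\<in>UNIV. emeasure M (cyl (p a) (m+1))) = (\<Sum>a\<in>(UNIV :: 'k set). emeasure M (cyl d (m+1)))"
      by (rule sum.cong[OF refl inv])
    then show ?thesis by simp
  qed
  finally show ?thesis .
qed

text \<open>
Invariance gives all balls of one radius the same measure, so that each subdivision into \<open>q\<close> balls divides the measure by \<open>q\<close>.
\<close>

lemma emeasure_invariant_cyl_nat:
  fixes M :: "'k::{field,finite} fls measure"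
  assumes M: "sets M = sets borel"
    and inv: "\<And>a A. A \<in> sets borel \<Longrightarrow> emeasure M ((\<lambda>x. a + x) ` A) = emeasure M A"
    and O: "emeasure M ring_E = 1"
  shows "emeasure M (cyl c (int m)) = ennreal ((1 / CARD('k)) ^ m)"
proof -
  have tr: "emeasure M (cyl c m) = emeasure M (cyl d m)" for c d m
    using inv[of "cyl d m" "c - d"] by (simp add: cyl_translate)
  show ?thesis
  proof (induction m arbitrary: c)
    case 0
    then show ?case using tr[of c 0 0] O by (simp add: ring_E_cyl)
  next
    case (Suc m)
    have "ennreal ((1 / CARD('k)) ^ m) = of_nat CARD('k) * emeasure M (cyl c (int m + 1))"
      using emeasure_cyl_step[OF M tr, of c "int m" c] Suc by simp
    also have "\<dots> = ennreal (CARD('k)) * emeasure M (cyl c (int (Suc m)))"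
      by (simp add: ennreal_of_nat_eq_real_of_nat add.commute)
    finally have eq: "ennreal ((1 / CARD('k)) ^ m) = ennreal (CARD('k)) * emeasure M (cyl c (int (Suc m)))" .
    have "ennreal (1 / CARD('k)) * ennreal (CARD('k)) = 1"
      using ennreal_mult'[of "1 / real CARD('k)" "real CARD('k)"] by simp
    then have "emeasure M (cyl c (int (Suc m))) = ennreal (1 / CARD('k)) * ennreal ((1 / CARD('k)) ^ m)"
      unfolding eq mult.assoc[symmetric] by simp
    also have "\<dots> = ennreal ((1 / CARD('k)) ^ Suc m)"
      using ennreal_mult'[of "1 / real CARD('k)" "(1 / real CARD('k)) ^ m"] by simp
    finally show ?case .
  qed
qed

text \<open>
A translate of a ball is a ball of the same radius, so the translated measure agrees with the original one on balls.
\<close>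

lemma haar_model_invariant:
  assumes "A \<in> sets borel"
  shows "emeasure haar_model ((\<lambda>x. a + x) ` A) = emeasure haar_model (A :: 'k::{field,finite} fls set)"
proof -
  have meas: "(\<lambda>x. x + b) \<in> borel_measurable (borel :: 'k fls measure)" for b
    by (rule measurable_fls_iff_cyl) (simp add: vimage_translate_cyl)
  have "haar_model = distr haar_model borel (\<lambda>x::'k fls. x + (- a))"
  proof (rule measure_eqI_cyl)
    fix c :: "'k fls" and m
    show "emeasure haar_model (cyl c (int m)) = emeasure (distr haar_model borel (\<lambda>x. x + (- a))) (cyl c (int m))"
      using meas[of "- a"]
      by (subst emeasure_distr) (simp_all add: measurable_def vimage_translate_cyl emeasure_haar_model_cyl
        sets_eq_imp_space_eq[OF sets_haar_model] del: add_uminus_conv_diff)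
    show "emeasure haar_model (cyl c 0) \<noteq> \<infinity>"
      using emeasure_haar_model_cyl[of c 0] by simp
  qed simp_all
  then have "emeasure haar_model A = emeasure (distr haar_model borel (\<lambda>x::'k fls. x + (- a))) A" by simp
  also have "\<dots> = emeasure haar_model ((\<lambda>x::'k fls. x + (- a)) -` A)"
    using meas[of "- a"] assms
    by (subst emeasure_distr) (simp_all add: measurable_def sets_eq_imp_space_eq[OF sets_haar_model])
  also have "(\<lambda>x::'k fls. x + (- a)) -` A = (\<lambda>x. a + x) ` A"
  proof -
    have "x \<in> (\<lambda>x. a + x) ` A" if "x + - a \<in> A" for x
      using that by (intro image_eqI[of _ _ "x + - a"]) simp_all
    moreover have "(\<lambda>x. a + x) ` A \<subseteq> (\<lambda>x. x + - a) -` A" by (simp add: image_subset_iff)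
    ultimately show ?thesis unfolding vimage_def by blast
  qed
  finally show ?thesis by simp
qed

lemma haar_E_eq: "haar_E = haar_model"
  unfolding haar_E_def
proof (rule the_equality, intro conjI allI ballI)
  show "emeasure haar_model ring_E = 1"
    using emeasure_haar_model_cyl[of 0 0] by (simp add: ring_E_cyl)
next
  fix M :: "'a fls measure"
  assume "sets M = sets borel \<and> (\<forall>a. \<forall>A\<in>sets borel. emeasure M ((+) a ` A) = emeasure M A) \<and> emeasure M ring_E = 1"
  then have M: "sets M = sets borel" and e: "\<And>c m. emeasure M (cyl c (int m)) = ennreal ((1 / CARD('a)) ^ m)"
    using emeasure_invariant_cyl_nat[of M] by auto
  show "M = haar_model"
    using e[of _ 0] by (intro measure_eqI_cyl) (simp_all add: M e emeasure_haar_model_cyl)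
qed (simp_all add: haar_model_invariant)

lemma sets_haar_E [simp, measurable_cong]: "sets haar_E = sets borel"
  by (simp add: haar_E_eq)

lemma space_haar_E [simp]: "space haar_E = UNIV"
  using sets_eq_imp_space_eq[OF sets_haar_E] by simp

lemma emeasure_haar_E_cyl:
  "emeasure haar_E (cyl (c :: 'k::{field,finite} fls) m) = ennreal (real CARD('k) powi (- m))"
proof -
  have nonneg: "emeasure haar_E (cyl (c :: 'k fls) (int m)) = ennreal (real CARD('k) powi (- int m))" for c m
    by (simp add: haar_E_eq emeasure_haar_model_cyl power_int_minus power_int_of_nat power_one_over inverse_eq_divide)
  have neg: "emeasure haar_E (cyl (c :: 'k fls) (- int m)) = ennreal (real CARD('k) powi (int m))" for c m
  proof (induction m arbitrary: c)
    case 0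
    then show ?case using nonneg[of c 0] by simp
  next
    case (Suc m)
    have "emeasure haar_E (cyl c (- int (Suc m))) = of_nat CARD('k) * emeasure haar_E (cyl c (- int (Suc m) + 1))"
      by (rule emeasure_cyl_step) (simp_all add: Suc)
    then show ?case using Suc[of c] by (simp add: power_int_add ennreal_of_nat_eq_real_of_nat ennreal_mult')
  qed
  show ?thesis using nonneg[of c "nat m"] neg[of c "nat (- m)"] by (cases "m \<ge> 0") auto
qed

section \<open>Affine substitutions in integrals over \<open>E\<close>\<close>

lemma fls_nth_mult_leading:
  fixes e x :: "'a::field fls"
  assumes "e \<noteq> 0"
  shows "(\<forall>n<m + fls_subdegree e. fls_nth (e * x) n = 0) \<longleftrightarrow> (\<forall>n<m. fls_nth x n = 0)"
  unfolding subdegree_ge_iff using assms by (cases "x = 0") (simp_all add: fls_subdegree_mult)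

lemma vimage_mult_cyl:
  fixes e c :: "'a::field fls"
  assumes e: "e \<noteq> 0"
  shows "(\<lambda>x. e * x) -` cyl c m = cyl (c / e) (m - fls_subdegree e)"
proof -
  have "e * x \<in> cyl c m \<longleftrightarrow> x \<in> cyl (c / e) (m - fls_subdegree e)" for x
  proof -
    have "e * x \<in> cyl c m \<longleftrightarrow> (\<forall>n<m. fls_nth (e * (x - c / e)) n = 0)"
      using e by (simp add: cyl_def right_diff_distrib)
    also have "\<dots> \<longleftrightarrow> (\<forall>n<m - fls_subdegree e. fls_nth (x - c / e) n = 0)"
      using fls_nth_mult_leading[OF e, of "m - fls_subdegree e" "x - c / e"] by simp
    finally show ?thesis by (simp add: cyl_def)
  qed
  then show ?thesis by blast
qed

lemma measurable_mult_E: "(\<lambda>x. e * x) \<in> borel_measurable (borel :: 'k::{field,finite} fls measure)"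
proof (cases "e = 0")
  case False
  then show ?thesis by (intro measurable_fls_iff_cyl) (simp add: vimage_mult_cyl)
qed simp

lemma measurable_add_E: "(\<lambda>x. x + b) \<in> borel_measurable (borel :: 'k::{field,finite} fls measure)"
  by (rule measurable_fls_iff_cyl) (simp add: vimage_translate_cyl)

lemma measurable_affine_E: "(\<lambda>x. e * x + b) \<in> borel_measurable (borel :: 'k::{field,finite} fls measure)"
  using measurable_compose[OF measurable_mult_E measurable_add_E] .

lemma vimage_affine_cyl:
  fixes e b :: "'a::field fls"
  assumes e: "e \<noteq> 0"
  shows "(\<lambda>x. e * x + b) -` cyl c m = cyl ((c - b) / e) (m - fls_subdegree e)"
proof -
  have "(\<lambda>x. e * x + b) -` cyl c m = (\<lambda>x. e * x) -` ((\<lambda>x. x + b) -` cyl c m)" by auto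
  then show ?thesis by (simp add: vimage_translate_cyl vimage_mult_cyl[OF e])
qed

lemma card_field_gt_1: "1 < real CARD('k::{field,finite})"
proof -
  have "card {0, 1 :: 'k} \<le> CARD('k)" by (rule card_mono) auto
  then show ?thesis by simp
qed

text \<open>
Both sides agree on balls: the preimage of a ball of radius \<open>q\<^sup>-\<^sup>m\<close> under \<open>x \<mapsto> e x + b\<close> is a ball of radius \<open>q\<^sup>v\<^sup>-\<^sup>m\<close> with \<open>v\<close> the
valuation of \<open>e\<close>.
\<close>

lemma distr_haar_affine:
  fixes e :: "'k::{field,finite} fls"
  assumes e: "e \<noteq> 0"
  shows "distr haar_E borel (\<lambda>x. e * x + b) = scale_measure (ennreal (real CARD('k) powi fls_subdegree e)) haar_E"
proof (rule measure_eqI_cyl)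
  fix c :: "'k fls" and m
  have "emeasure (distr haar_E borel (\<lambda>x. e * x + b)) (cyl c (int m)) =
      emeasure haar_E ((\<lambda>x. e * x + b) -` cyl c (int m))"
    using measurable_affine_E by (subst emeasure_distr) (simp_all add: measurable_def)
  also have "\<dots> = ennreal (real CARD('k) powi (- (int m - fls_subdegree e)))"
    by (simp add: vimage_affine_cyl[OF e] emeasure_haar_E_cyl)
  finally have *: "emeasure (distr haar_E borel (\<lambda>x. e * x + b)) (cyl c (int m)) = 
    ennreal (real CARD('k) powi (- (int m - fls_subdegree e)))" .
  show "emeasure (distr haar_E borel (\<lambda>x. e * x + b)) (cyl c (int m)) =
      emeasure (scale_measure (ennreal (real CARD('k) powi fls_subdegree e)) haar_E) (cyl c (int m))"
    unfolding * by (simp add: emeasure_haar_E_cyl power_int_diff power_int_minus field_simps flip: ennreal_mult')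
  show "emeasure (distr haar_E borel (\<lambda>x. e * x + b)) (cyl c 0) \<noteq> \<infinity>"
    using measurable_affine_E[of e b] by (subst emeasure_distr) (simp_all add: measurable_def vimage_affine_cyl[OF e] emeasure_haar_E_cyl)
qed simp_all

lemma scale_measure_eq_density: "c \<ge> 0 \<Longrightarrow> scale_measure (ennreal c) M = density M (\<lambda>_. ennreal c)"
  by (rule measure_eqI) (simp_all add: emeasure_density nn_integral_cmult_indicator)

abbreviation has_E_integral :: "('k::{field,finite} E \<Rightarrow> complex) \<Rightarrow> complex \<Rightarrow> bool" where
  "has_E_integral \<equiv> has_bochner_integral haar_E"

lemma has_E_integral_affine:
  fixes f :: "'k::{field,finite} fls \<Rightarrow> complex"
  assumes f: "has_E_integral f c" and e: "e \<noteq> 0"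
  shows "has_E_integral (\<lambda>x. f (e * x + b)) (of_real (real CARD('k) powi fls_subdegree e) * c)"
proof -
  let ?w = "real CARD('k) powi fls_subdegree e"
  have fm: "f \<in> borel_measurable borel"
    using f borel_measurable_has_bochner_integral measurable_cong_sets[OF sets_haar_E refl] by blast
  have fm': "f \<in> borel_measurable haar_E"
    using f borel_measurable_has_bochner_integral by blast
  have aff: "(\<lambda>x. e * x + b) \<in> measurable haar_E borel"
    using measurable_affine_E measurable_cong_sets[OF sets_haar_E refl] by blast
  have D: "distr haar_E borel (\<lambda>x. e * x + b) = density haar_E (\<lambda>_. ennreal ?w)"
    using distr_haar_affine[OF e] by (simp add: scale_measure_eq_density)
  have "integrable (density haar_E (\<lambda>_. ennreal ?w)) f"
    using f by (subst integrable_density) (auto simp: has_bochner_integral_iff fm')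
  then have i: "integrable haar_E (\<lambda>x. f (e * x + b))"
    unfolding D[symmetric] using integrable_distr_eq[OF aff fm] by simp
  have "integral\<^sup>L haar_E (\<lambda>x. f (e * x + b)) = integral\<^sup>L (distr haar_E borel (\<lambda>x. e * x + b)) f"
    using integral_distr[OF aff fm] by simp
  also have "\<dots> = ?w *\<^sub>R integral\<^sup>L haar_E f"
    unfolding D by (subst integral_density) (auto simp: fm')
  finally show ?thesis using i f by (simp add: has_bochner_integral_iff scaleR_conv_of_real)
qed

text \<open>
A nonzero constant is therefore not integrable on \<open>E\<close>. This is what separates the layers of a function on \<open>F\<close>.
\<close>

lemma emeasure_haar_E_UNIV: "emeasure (haar_E :: 'k::{field,finite} fls measure) UNIV = \<infinity>"
proof (rule ccontr)
  assume "emeasure (haar_E :: 'k fls measure) UNIV \<noteq> \<infinity>"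
  then obtain r where r: "emeasure (haar_E :: 'k fls measure) UNIV = ennreal r" "r \<ge> 0"
    by (cases "emeasure (haar_E :: 'k fls measure) UNIV") auto
  have q: "real CARD('k) > 1" by (rule card_field_gt_1)
  obtain n where n: "r < real CARD('k) ^ n" using real_arch_pow[OF q] by blast
  have "emeasure haar_E (cyl (0::'k fls) (- int n)) \<le> emeasure (haar_E :: 'k fls measure) UNIV"
    by (rule emeasure_mono) auto
  then have "real CARD('k) ^ n \<le> r" using r by (simp add: emeasure_haar_E_cyl)
  with n show False by simp
qed

lemma emeasure_haar_E_singleton: "emeasure haar_E {x :: 'k::{field,finite} fls} = 0"
proof -
  have q: "real CARD('k) > 1" by (rule card_field_gt_1)
  have "emeasure haar_E {x} \<le> ennreal d" if "d > 0" for d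
  proof -
    have "1 / real CARD('k) < 1" using q by simp
    with that have "\<exists>n. (1 / real CARD('k)) ^ n < d" by (rule real_arch_pow_inv)
    then obtain n where n: "(1 / real CARD('k)) ^ n < d" by blast
    have "emeasure haar_E {x} \<le> emeasure haar_E (cyl x (int n))"
      by (rule emeasure_mono) (simp_all add: cyl_borel, simp add: cyl_def)
    also have "\<dots> = ennreal ((1 / real CARD('k)) ^ n)"
      by (simp add: emeasure_haar_E_cyl power_int_minus power_one_over inverse_eq_divide)
    also have "\<dots> \<le> ennreal d" using n by (intro ennreal_leI) simp
    finally show ?thesis .
  qed
  then show ?thesis by (metis ennreal_le_epsilon add_0 le_zero_eq)
qed

lemma AE_haar_E_neq: "AE x in haar_E. x \<noteq> (a :: 'k::{field,finite} fls)"
proof (rule AE_I')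
  show "{a} \<in> null_sets haar_E" by (simp add: null_sets_def emeasure_haar_E_singleton)
qed auto

section \<open>The integral in one variable over \<open>F\<close>\<close>

lemma times_par_t_powi: "x * par_t powi (- g) = fls_shift g (x :: 'k::{field,finite} F)"
  by (simp add: par_t_def fls_X_intpow_times_conv_shift(2)[of x "- g", simplified])

lemma ring_O1_iff: "x \<in> ring_O1 \<longleftrightarrow> (\<forall>n<0. fls_nth (x :: 'k::{field,finite} F) n = 0)"
proof
  assume "\<forall>n<0. fls_nth x n = 0"
  then have "x = fps_to_fls (fls_regpart x)" by (intro fls_eqI) auto
  then show "x \<in> ring_O1" unfolding ring_O1_def by blast
qed (auto simp: ring_O1_def)

lemma shift_mem_O1: "fls_shift g (x - a) \<in> ring_O1 \<longleftrightarrow> x \<in> cyl (a :: 'k::{field,finite} F) g"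
proof -
  have "(\<forall>n<0. fls_nth (x - a) (n + g) = 0) \<longleftrightarrow> (\<forall>n<g. fls_nth (x - a) n = 0)"
    by (metis add.commute add_less_same_cancel2 diff_add_cancel)
  then show ?thesis by (simp add: ring_O1_iff cyl_def)
qed

lemma lift1_eq:
  "lift1 f a g x = (if x \<in> cyl a g then fls_const (f (fls_nth (x - a) g)) else 0)"
  by (simp add: lift1_def times_par_t_powi shift_mem_O1 red_t_def del: fls_shift_minus)

lemma abs_F_eq:
  "abs_F (a :: 'k::{field,finite} F) = fls_const (of_nat CARD('k) powi (- fls_subdegree (fls_nth a (fls_subdegree a))))
     * fls_X powi fls_subdegree a"
  by (simp only: abs_F_def times_par_t_powi red_t_def fls_shift_nth add_0)

lemma abs_F_mult:
  assumes "a \<noteq> 0" "b \<noteq> 0"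
  shows "abs_F (a * b) = abs_F a * abs_F (b :: 'k::{field,finite} F)"
proof -
  have nz: "fls_nth a (fls_subdegree a) \<noteq> 0" "fls_nth b (fls_subdegree b) \<noteq> 0" using assms by auto
  then have "fls_subdegree (fls_nth (a * b) (fls_subdegree (a * b))) =
      fls_subdegree (fls_nth a (fls_subdegree a)) + fls_subdegree (fls_nth b (fls_subdegree b))"
    using assms by simp
  moreover have "- (x + y) = (- x) + (- y)" for x y :: int by simp
  ultimately show ?thesis
    using assms unfolding abs_F_eq
    by (simp only: fls_subdegree_mult power_int_add fls_X_nonzero disjI1 fls_const_mult_const[symmetric]
        of_nat_neq_0 zero_less_card_finite of_nat_eq_0_iff card_eq_0_iff UNIV_not_empty finite simp_thms mult_ac)
qed

lemma abs_F_nonzero [simp]: "abs_F a \<noteq> 0"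
  by (simp add: abs_F_eq)

lemma abs_F_1 [simp]: "abs_F 1 = 1"
  by (simp add: abs_F_eq)

lemma ratfunI: "r \<noteq> 0 \<Longrightarrow> fps_to_fls (fps_of_poly p) / fps_to_fls (fps_of_poly r) \<in> ratfun"
  unfolding ratfun_def by blast

lemma ratfun_mult: "a \<in> ratfun \<Longrightarrow> b \<in> ratfun \<Longrightarrow> a * b \<in> ratfun"
proof -
  assume "a \<in> ratfun" "b \<in> ratfun"
  then obtain p r p' r' where *: "r \<noteq> 0" "r' \<noteq> 0"
    "a = fps_to_fls (fps_of_poly p) / fps_to_fls (fps_of_poly r)"
    "b = fps_to_fls (fps_of_poly p') / fps_to_fls (fps_of_poly r')"
    unfolding ratfun_def by blast
  then have "a * b = fps_to_fls (fps_of_poly (p * p')) / fps_to_fls (fps_of_poly (r * r'))"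
    by (simp add: fps_of_poly_mult fls_times_fps_to_fls)
  then show ?thesis using ratfunI[of "r * r'" "p * p'"] * by simp
qed

lemma ratfun_const: "fls_const z \<in> ratfun"
  using ratfunI[of 1 "[:z:]"] by (simp add: fps_of_poly_const fps_const_to_fls)

lemma ratfun_1: "1 \<in> ratfun"
  using ratfun_const[of 1] by simp

lemma ratfun_X_powi: "fls_X powi n \<in> ratfun"
proof (cases "n \<ge> 0")
  case True
  then obtain m where "n = int m" by (metis nonneg_int_cases)
  then show ?thesis
    using ratfunI[of 1 "monom 1 m"] by (simp add: fps_of_poly_monom fps_to_fls_power fps_X_to_fls fls_X_power_conv_shift_1)
next
  case False
  then obtain m where "n = - int m" by (metis int_cases2 le_refl of_nat_0_le_iff)
  then show ?thesis
    using ratfunI[of "monom 1 m" 1]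
    by (simp add: fps_of_poly_monom fps_to_fls_power fps_X_to_fls fls_X_power_conv_shift_1 fls_inverse_X_intpow inverse_eq_divide[symmetric]
       monom_eq_0_iff)
qed

lemma ratfun_monomial: "fls_const z * fls_X powi n \<in> ratfun"
  by (intro ratfun_mult ratfun_const ratfun_X_powi)

lemma inverse_monomial:
  "inverse (fls_const z * fls_X powi n) = fls_const (inverse z) * fls_X powi (- n)" for z :: complex
  by (simp add: fls_inverse_const fls_inverse_X_intpow del: fls_const_mult_const)

lemma powi_monomial:
  "(fls_const z * fls_X powi n) powi k = fls_const (z powi k) * fls_X powi (n * k)" for z :: complex
  by (simp only: power_int_mult_distrib fls_const_power_int power_int_mult)

lemma ratfun_abs_F_powi: "abs_F a powi k \<in> ratfun"
  unfolding abs_F_eq powi_monomial by (rule ratfun_monomial)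

lemma inverse_abs_F:
  "inverse (abs_F (a :: 'k::{field,finite} F)) = fls_const (of_nat CARD('k) powi fls_subdegree (fls_nth a (fls_subdegree a)))
     * fls_X powi (- fls_subdegree a)"
  unfolding abs_F_eq inverse_monomial by (simp add: power_int_minus)

lemma ratfun_inverse_abs_F: "inverse (abs_F a) \<in> ratfun"
  unfolding inverse_abs_F by (rule ratfun_monomial)

lemma has_F_integral_lift1:
  assumes "has_E_integral f c"
  shows "has_F_integral (lift1 f a g) (fls_X powi g * fls_const c)"
proof -
  have "has_F_integral (\<lambda>x. 1 * lift1 f a g x + 0) (1 * (fls_X powi g * fls_const (integral\<^sup>L haar_E f)) + 0)"
    by (rule has_F_integral.step) (use assms in \<open>auto simp: has_bochner_integral_iff ratfun_1 has_F_integral.zero\<close>)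
  then show ?thesis using assms by (simp add: has_bochner_integral_iff del: fls_X_power_int)
qed

lemma has_F_integral_add:
  "has_F_integral g I \<Longrightarrow> has_F_integral g' I' \<Longrightarrow> has_F_integral (\<lambda>x. g x + g' x) (I + I')"
proof (induction rule: has_F_integral.induct)
  case (step c f g I a \<gamma>)
  have "has_F_integral (\<lambda>x. c * lift1 f a \<gamma> x + (g x + g' x))
      (c * (fls_X powi \<gamma> * fls_const (integral\<^sup>L haar_E f)) + (I + I'))"
    by (rule has_F_integral.step) (use step in auto)
  then show ?case by (simp only: add.assoc)
qed simp

lemma has_F_integral_scale:
  "has_F_integral g I \<Longrightarrow> r \<in> ratfun \<Longrightarrow> has_F_integral (\<lambda>x. r * g x) (r * I)"
proof (induction rule: has_F_integral.induct)
  case zero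
  then show ?case using has_F_integral.zero by simp
next
  case (step c f g I a \<gamma>)
  have "has_F_integral (\<lambda>x. (r * c) * lift1 f a \<gamma> x + r * g x)
      ((r * c) * (fls_X powi \<gamma> * fls_const (integral\<^sup>L haar_E f)) + r * I)"
    by (rule has_F_integral.step) (use step in \<open>auto intro: ratfun_mult\<close>)
  then show ?case by (simp only: distrib_left mult.assoc)
qed

lemma fls_nth_mult_lowest:
  fixes d x :: "'a::field fls"
  assumes "\<forall>n<m. fls_nth x n = 0"
  shows "fls_nth (d * x) (m + fls_subdegree d) = fls_nth d (fls_subdegree d) * fls_nth x m"
proof (cases "d = 0 \<or> x = 0")
  case False
  then have "m \<le> fls_subdegree x" using assms subdegree_ge_iff by blast
  then consider "m = fls_subdegree x" | "m < fls_subdegree x" by linarith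
  then show ?thesis
  proof cases
    case 1
    then show ?thesis by (simp add: add.commute flip: fls_times_base)
  next
    case 2
    then show ?thesis using False by (simp add: fls_times_nth_eq0)
  qed
qed auto

text \<open>
The factor \<open>d\<close> shifts the level by its valuation and acts on the reduction through its leading coefficient.
\<close>

lemma lift1_affine:
  fixes d b :: "'k::{field,finite} F"
  assumes d: "d \<noteq> 0"
  shows "lift1 f a g (d * x + b) = lift1 (\<lambda>y. f (fls_nth d (fls_subdegree d) * y)) ((a - b) / d) (g - fls_subdegree d) x"
proof -
  have mem: "d * x + b \<in> cyl a g \<longleftrightarrow> x \<in> cyl ((a - b) / d) (g - fls_subdegree d)"
    using vimage_affine_cyl[OF d, of b a g] by blast
  have "d * x + b - a = d * (x - (a - b) / d)" using d by (simp add: field_simps)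
  then have "fls_nth (d * x + b - a) g = fls_nth d (fls_subdegree d) * fls_nth (x - (a - b) / d) (g - fls_subdegree d)"
    if "x \<in> cyl ((a - b) / d) (g - fls_subdegree d)"
    using that fls_nth_mult_lowest[of "g - fls_subdegree d" "x - (a - b) / d" d] by (simp add: cyl_def)
  with mem show ?thesis by (simp add: lift1_eq)
qed

text \<open>
The modulus of \<open>d\<close> has two sources: the shift of level contributes the power of \<open>X\<close>, and scaling by the leading coefficient on \<open>E\<close>
contributes the power of \<open>q\<close>.
\<close>

lemma has_F_integral_affine:
  assumes "has_F_integral g I" and d: "d \<noteq> (0 :: 'k::{field,finite} F)"
  shows "has_F_integral (\<lambda>x. g (d * x + b)) (inverse (abs_F d) * I)"
  using assms(1)
proof (induction rule: has_F_integral.induct)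
  case zero
  then show ?case using has_F_integral.zero by simp
next
  case (step c f g I a \<gamma>)
  let ?d = "fls_nth d (fls_subdegree d)"
  have "has_E_integral (\<lambda>y. f (?d * y + 0)) (of_real (real CARD('k) powi fls_subdegree ?d) * integral\<^sup>L haar_E f)"
    by (rule has_E_integral_affine) (use step d in \<open>auto simp: has_bochner_integral_iff\<close>)
  then have 1: "integrable haar_E (\<lambda>y. f (?d * y))"
    and 2: "integral\<^sup>L haar_E (\<lambda>y. f (?d * y)) = of_real (real CARD('k) powi fls_subdegree ?d) * integral\<^sup>L haar_E f"
    by (simp_all add: has_bochner_integral_iff)
  have "has_F_integral (\<lambda>x. c * lift1 (\<lambda>y. f (?d * y)) ((a - b) / d) (\<gamma> - fls_subdegree d) x + g (d * x + b))
     (c * (fls_X powi (\<gamma> - fls_subdegree d) * fls_const (integral\<^sup>L haar_E (\<lambda>y. f (?d * y)))) + inverse (abs_F d) * I)"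
    by (rule has_F_integral.step) (use step 1 in auto)
  moreover have "fls_X powi (\<gamma> - fls_subdegree d) * fls_const (integral\<^sup>L haar_E (\<lambda>y. f (?d * y))) =
     inverse (abs_F d) * (fls_X powi \<gamma> * fls_const (integral\<^sup>L haar_E f))"
  proof -
    have "fls_X powi (\<gamma> - fls_subdegree d) = fls_X powi (- fls_subdegree d) * (fls_X powi \<gamma> :: complex fls)"
      using power_int_add[of "fls_X :: complex fls" "- fls_subdegree d" \<gamma>] by simp
    moreover have "fls_const (integral\<^sup>L haar_E (\<lambda>y. f (?d * y))) =
       fls_const (of_nat CARD('k) powi fls_subdegree ?d) * fls_const (integral\<^sup>L haar_E f)"
      unfolding 2 by simp
    ultimately show ?thesis unfolding inverse_abs_F by (simp only: mult_ac)
  qed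
  ultimately show ?case by (simp only: lift1_affine[OF d] distrib_left mult.left_commute)
qed

text \<open>
The contribution \<open>J (m, b)\<close> of the ball \<open>b + t\<^sup>m O\<^sub>1\<close> to the integral is visible in \<open>g\<close> itself. Fix a power \<open>X\<^sup>s\<close> and look at its
coefficient in \<open>g (b + e t\<^sup>m)\<close> as a function of \<open>e\<close>: up to a null set it is a constant plus an integrable function whose integral
is the coefficient of \<open>J (m, b)\<close>. The centres are normalized by truncation, so that each ball occurs once.
\<close>

lemma has_F_integral_layers:
  assumes "has_F_integral (g :: 'k::{field,finite} F \<Rightarrow> _) I"
  shows "\<exists>J S. finite S \<and> (\<forall>p. p \<notin> S \<longrightarrow> J p = 0) \<and> (\<forall>(m, b)\<in>S. trunc m b = b)
    \<and> I = (\<Sum>p\<in>S. fls_X powi fst p * J p)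
    \<and> (\<forall>m b s. \<exists>\<kappa> h. has_E_integral h (fls_nth (J (m, trunc m b)) s)
        \<and> (AE e in haar_E. fls_nth (g (b + fls_shift (- m) (fls_const e))) s = \<kappa> + h e))"
  using assms
proof (induction rule: has_F_integral.induct)
  case zero
  show ?case
    by (rule exI[of _ "\<lambda>_. 0"], rule exI[of _ "{}"])
      (auto intro!: exI[of _ 0] exI[of _ "\<lambda>_. 0"])
next
  case (step c f g I a \<gamma>)
  then obtain J S where S: "finite S" "\<And>p. p \<notin> S \<Longrightarrow> J p = 0" "\<forall>(m, b)\<in>S. trunc m b = b"
    and I: "I = (\<Sum>p\<in>S. fls_X powi fst p * J p)"
    and J: "\<And>m b s. \<exists>\<kappa> h. has_E_integral h (fls_nth (J (m, trunc m b)) s)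
        \<and> (AE e in haar_E. fls_nth (g (b + fls_shift (- m) (fls_const e))) s = \<kappa> + h e)"
    by blast
  let ?k = "(\<gamma>, trunc \<gamma> a)"
  let ?i = "integral\<^sup>L haar_E f"
  define \<delta> where "\<delta> p = (if p = ?k then c * fls_const ?i else 0)" for p
  define J' where "J' p = J p + \<delta> p" for p
  define S' where "S' = insert ?k S"
  have nc: "fls_nth (c * fls_const z) s = fls_nth c s * z" for z s
    by (simp add: fls_mult_const_nth)
  have new: "\<exists>\<kappa> h. has_E_integral h (fls_nth (\<delta> (m, trunc m b)) s)
        \<and> (AE e in haar_E. fls_nth (c * lift1 f a \<gamma> (b + fls_shift (- m) (fls_const e))) s = \<kappa> + h e)" for m b s
  proof -
    let ?p = "\<lambda>e. b + fls_shift (- m) (fls_const e)"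
    have pn: "fls_nth (?p e) n = fls_nth b n + (if n = m then e else 0)" for e n by simp
    \<comment> \<open>A lift of smaller level is constant along the line, a lift of larger level is nonzero at most at one point,
      and a lift of level \<open>m\<close> is visible exactly if its ball is the given one.\<close>
    consider "\<gamma> < m" | "m < \<gamma>" | "m = \<gamma>" "b \<in> cyl a \<gamma>" | "m = \<gamma>" "b \<notin> cyl a \<gamma>" by linarith
    then show ?thesis
    proof cases
      case 1
      then have "lift1 f a \<gamma> (?p e) = lift1 f a \<gamma> b" for e
        by (auto simp: lift1_eq cyl_def)
      then show ?thesis using 1
        by (intro exI[of _ "fls_nth (c * lift1 f a \<gamma> b) s"] exI[of _ "\<lambda>_. 0"]) (auto simp: \<delta>_def)
    next
      case 2
      have "?p e \<notin> cyl a \<gamma>" if "e \<noteq> fls_nth a m - fls_nth b m" for e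
        using that 2 unfolding cyl_def by (auto simp: pn algebra_simps intro!: exI[of _ m])
      then have "fls_nth (c * lift1 f a \<gamma> (?p e)) s = 0" if "e \<noteq> fls_nth a m - fls_nth b m" for e
        using that by (simp add: lift1_eq)
      then have "AE e in haar_E. fls_nth (c * lift1 f a \<gamma> (?p e)) s = 0"
        by (rule eventually_mono[OF AE_haar_E_neq])
      then show ?thesis using 2
        by (intro exI[of _ 0] exI[of _ "\<lambda>_. 0"]) (auto simp: \<delta>_def)
    next
      case 3
      then have key: "(m, trunc m b) = ?k" by (simp add: trunc_eq_iff)
      have "?p e \<in> cyl a \<gamma>" for e using 3 by (auto simp: cyl_def)
      then have v: "fls_nth (c * lift1 f a \<gamma> (?p e)) s = fls_nth c s * f (1 * e + (fls_nth b m - fls_nth a m))" for e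
        using 3 by (simp add: lift1_eq nc algebra_simps)
      have "has_E_integral (\<lambda>e. f (1 * e + (fls_nth b m - fls_nth a m)))
          (of_real (real CARD('k) powi fls_subdegree (1 :: 'k E)) * ?i)"
        by (rule has_E_integral_affine) (use step in \<open>auto simp: has_bochner_integral_iff\<close>)
      then have "has_E_integral (\<lambda>e. f (1 * e + (fls_nth b m - fls_nth a m))) ?i" by simp
      then have "has_E_integral (\<lambda>e. fls_nth c s * f (1 * e + (fls_nth b m - fls_nth a m))) (fls_nth c s * ?i)"
        by (rule has_bochner_integral_mult_right)
      then show ?thesis unfolding key v
        by (intro exI[of _ 0] exI[of _ "\<lambda>e. fls_nth c s * f (1 * e + (fls_nth b m - fls_nth a m))"])
           (auto simp: \<delta>_def nc)
    next
      case 4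
      then have key: "(m, trunc m b) \<noteq> ?k" by (simp add: trunc_eq_iff)
      have "?p e \<notin> cyl a \<gamma>" for e using 4 by (auto simp: cyl_def)
      then show ?thesis using key
        by (intro exI[of _ 0] exI[of _ "\<lambda>_. 0"]) (auto simp: \<delta>_def lift1_eq)
    qed
  qed
  show ?case
  proof (intro exI[of _ J'] exI[of _ S'] conjI allI)
    show "finite S'" using S by (simp add: S'_def)
    show "\<forall>(m, b)\<in>S'. trunc m b = b"
      using S(3) by (auto simp: S'_def fls_eq_iff)
    show "p \<notin> S' \<longrightarrow> J' p = 0" for p using S by (auto simp: S'_def J'_def \<delta>_def)
    have "(\<Sum>p\<in>S'. fls_X powi fst p * J p) = I"
      unfolding I S'_def using S by (intro sum.mono_neutral_right) auto
    moreover have "(\<Sum>p\<in>S'. fls_X powi fst p * \<delta> p) = fls_X powi \<gamma> * (c * fls_const ?i)"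
    proof -
      have "(\<Sum>p\<in>S'. fls_X powi fst p * \<delta> p) = (\<Sum>p\<in>{?k}. fls_X powi fst p * \<delta> p)"
        using S(1) unfolding S'_def by (intro sum.mono_neutral_right) (auto simp: \<delta>_def)
      then show ?thesis by (simp add: \<delta>_def)
    qed
    ultimately show "c * (fls_X powi \<gamma> * fls_const ?i) + I = (\<Sum>p\<in>S'. fls_X powi fst p * J' p)"
      by (simp add: J'_def distrib_left sum.distrib mult_ac del: fls_X_power_int)
    fix m b s
    \<comment> \<open>The old summand and the new one are decomposed separately; constants and integrable parts add up.\<close>
    obtain \<kappa>1 h1 where 1: "has_E_integral h1 (fls_nth (J (m, trunc m b)) s)"
       "AE e in haar_E. fls_nth (g (b + fls_shift (- m) (fls_const e))) s = \<kappa>1 + h1 e" using J by blast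
    obtain \<kappa>2 h2 where 2: "has_E_integral h2 (fls_nth (\<delta> (m, trunc m b)) s)"
       "AE e in haar_E. fls_nth (c * lift1 f a \<gamma> (b + fls_shift (- m) (fls_const e))) s = \<kappa>2 + h2 e" using new by blast
    show "\<exists>\<kappa> h. has_E_integral h (fls_nth (J' (m, trunc m b)) s)
        \<and> (AE e in haar_E. fls_nth (c * lift1 f a \<gamma> (b + fls_shift (- m) (fls_const e))
             + g (b + fls_shift (- m) (fls_const e))) s = \<kappa> + h e)"
    proof (intro exI[of _ "\<kappa>1 + \<kappa>2"] exI[of _ "\<lambda>e. h1 e + h2 e"] conjI)
      show "has_E_integral (\<lambda>e. h1 e + h2 e) (fls_nth (J' (m, trunc m b)) s)"
        using has_bochner_integral_add[OF 1(1) 2(1)] by (simp add: J'_def)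
      show "AE e in haar_E. fls_nth (c * lift1 f a \<gamma> (b + fls_shift (- m) (fls_const e))
             + g (b + fls_shift (- m) (fls_const e))) s = \<kappa>1 + \<kappa>2 + (h1 e + h2 e)"
        using 1(2) 2(2) by eventually_elim simp
    qed
  qed
qed

text \<open>
Two families of contributions extracted from the same function differ, in each layer, by a constant that is integrable over \<open>E\<close>, hence by zero.
\<close>

lemma has_F_integral_unique:
  assumes "has_F_integral (g :: 'k::{field,finite} F \<Rightarrow> _) I" "has_F_integral g I'"
  shows "I = I'"
proof -
  obtain J S where S: "finite S" "\<And>p. p \<notin> S \<Longrightarrow> J p = 0" "\<forall>(m, b)\<in>S. trunc m b = b"
    and I: "I = (\<Sum>p\<in>S. fls_X powi fst p * J p)"
    and J: "\<And>m b s. \<exists>\<kappa> h. has_E_integral h (fls_nth (J (m, trunc m b)) s)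
        \<and> (AE e in haar_E. fls_nth (g (b + fls_shift (- m) (fls_const e))) s = \<kappa> + h e)"
    using has_F_integral_layers[OF assms(1)] by blast
  obtain J' S' where S': "finite S'" "\<And>p. p \<notin> S' \<Longrightarrow> J' p = 0" "\<forall>(m, b)\<in>S'. trunc m b = b"
    and I': "I' = (\<Sum>p\<in>S'. fls_X powi fst p * J' p)"
    and J': "\<And>m b s. \<exists>\<kappa> h. has_E_integral h (fls_nth (J' (m, trunc m b)) s)
        \<and> (AE e in haar_E. fls_nth (g (b + fls_shift (- m) (fls_const e))) s = \<kappa> + h e)"
    using has_F_integral_layers[OF assms(2)] by blast
  have eq: "J (m, trunc m b) = J' (m, trunc m b)" for m b
  proof (rule fls_eqI)
    fix s
    obtain \<kappa>1 h1 where 1: "has_E_integral h1 (fls_nth (J (m, trunc m b)) s)"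
       "AE e in haar_E. fls_nth (g (b + fls_shift (- m) (fls_const e))) s = \<kappa>1 + h1 e" using J by blast
    obtain \<kappa>2 h2 where 2: "has_E_integral h2 (fls_nth (J' (m, trunc m b)) s)"
       "AE e in haar_E. fls_nth (g (b + fls_shift (- m) (fls_const e))) s = \<kappa>2 + h2 e" using J' by blast
    have AE: "AE e in haar_E. h1 e - h2 e = \<kappa>2 - \<kappa>1"
      using 1(2) 2(2) by eventually_elim (simp add: algebra_simps)
    have d: "has_E_integral (\<lambda>e. h1 e - h2 e) (fls_nth (J (m, trunc m b)) s - fls_nth (J' (m, trunc m b)) s)"
      by (rule has_bochner_integral_diff[OF 1(1) 2(1)])
    then have d': "has_E_integral (\<lambda>e::'k E. \<kappa>2 - \<kappa>1) (fls_nth (J (m, trunc m b)) s - fls_nth (J' (m, trunc m b)) s)"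
      using has_bochner_integralI_AE[OF d _ AE] by simp
    \<comment> \<open>The difference of the two constants agrees almost everywhere with an integrable function, and \<open>E\<close> has infinite measure.\<close>
    have "\<kappa>2 - \<kappa>1 = 0"
    proof (rule ccontr)
      assume "\<kappa>2 - \<kappa>1 \<noteq> 0"
      moreover have "integrable haar_E (\<lambda>e::'k E. \<kappa>2 - \<kappa>1)" using d' by (simp add: has_bochner_integral_iff)
      ultimately show False
        by (simp add: integrable_iff_bounded emeasure_haar_E_UNIV ennreal_mult_top)
    qed
    with d' show "fls_nth (J (m, trunc m b)) s = fls_nth (J' (m, trunc m b)) s"
      by (simp add: has_bochner_integral_iff)
  qed
  have "I = (\<Sum>p\<in>S \<union> S'. fls_X powi fst p * J p)"
    unfolding I using S S' by (intro sum.mono_neutral_left) auto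
  also have "\<dots> = (\<Sum>p\<in>S \<union> S'. fls_X powi fst p * J' p)"
  proof (rule sum.cong[OF refl])
    fix p assume "p \<in> S \<union> S'"
    then have "p = (fst p, trunc (fst p) (snd p))" using S(3) S'(3) by auto
    then show "fls_X powi fst p * J p = fls_X powi fst p * J' p" using eq by metis
  qed
  also have "\<dots> = I'"
    unfolding I' using S S' by (intro sum.mono_neutral_right) auto
  finally show ?thesis .
qed

section \<open>Iterated integrals\<close>

lemma vec_upd_nth [simp]: "(vec_upd x i y) $ j = (if j = i then y else x $ j)"
  by (simp add: vec_upd_def)

text \<open>
A bare \<open>H\<close> may relate a function to several values, so uniqueness in one variable is what has to be propagated.
\<close>

lemma has_iterated_integral_unique:
  assumes uniq: "\<And>g c c'. H g c \<Longrightarrow> H g c' \<Longrightarrow> c = c'"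
  shows "has_iterated_integral H is f c \<Longrightarrow> has_iterated_integral H is f c' \<Longrightarrow> c = c'"
proof (induction "is" arbitrary: f)
  case (Cons i "is")
  then obtain h h' where h: "\<forall>x. H (\<lambda>y. f (vec_upd x i y)) (h x)" "has_iterated_integral H is h c"
    and h': "\<forall>x. H (\<lambda>y. f (vec_upd x i y)) (h' x)" "has_iterated_integral H is h' c'" by auto
  have "h x = h' x" for x by (rule uniq[OF spec[OF h(1)] spec[OF h'(1)]])
  then have "h = h'" by (rule ext)
  with h(2) have "has_iterated_integral H is h' c" by simp
  then show ?case using h'(2) by (rule Cons.IH)
qed simp

lemma has_fubini_integral_unique:
  fixes f :: "'a ^ 'i::finite \<Rightarrow> 'b"
  assumes uniq: "\<And>g c c'. H g c \<Longrightarrow> H g c' \<Longrightarrow> c = c'"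
    and "has_fubini_integral H f c" "has_fubini_integral H f c'"
  shows "c = c'"
proof -
  obtain l :: "'i list" where l: "distinct l \<and> set l = UNIV"
    using finite_distinct_list[OF finite] by blast
  have 1: "has_iterated_integral H l f c" and 2: "has_iterated_integral H l f c'"
    using assms(2,3) l unfolding has_fubini_integral_def by blast+
  show ?thesis by (rule has_iterated_integral_unique[OF _ 1 2]) (rule uniq)
qed

lemma has_iterated_integral_linear:
  fixes r :: "'b::semiring_0"
  assumes lin: "\<And>g g' c c'. H g c \<Longrightarrow> H g' c' \<Longrightarrow> H (\<lambda>y. r * g y + g' y) (r * c + c')"
  shows "has_iterated_integral H is f c \<Longrightarrow> has_iterated_integral H is g d \<Longrightarrow>
    has_iterated_integral H is (\<lambda>x. r * f x + g x) (r * c + d)"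
proof (induction "is" arbitrary: f g)
  case (Cons i "is")
  then obtain h h' where h: "\<forall>x. H (\<lambda>y. f (vec_upd x i y)) (h x)" "has_iterated_integral H is h c"
    and h': "\<forall>x. H (\<lambda>y. g (vec_upd x i y)) (h' x)" "has_iterated_integral H is h' d" by auto
  then show ?case using lin Cons.IH[of h h'] by (auto intro!: exI[of _ "\<lambda>x. r * h x + h' x"])
qed simp

lemma has_fubini_integral_linear:
  fixes r :: "'b::semiring_0"
  assumes lin: "\<And>g g' c c'. H g c \<Longrightarrow> H g' c' \<Longrightarrow> H (\<lambda>y. r * g y + g' y) (r * c + c')"
    and "has_fubini_integral H f c" "has_fubini_integral H g d"
  shows "has_fubini_integral H (\<lambda>x. r * f x + g x) (r * c + d)"
  using assms(2,3) unfolding has_fubini_integral_def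
  by (auto intro: has_iterated_integral_linear[of H r, OF lin])

lemma has_iterated_integral_scale:
  fixes r :: "'b::semiring_0"
  assumes lin: "\<And>g c. H g c \<Longrightarrow> H (\<lambda>y. r * g y) (r * c)"
  shows "has_iterated_integral H is f c \<Longrightarrow> has_iterated_integral H is (\<lambda>x. r * f x) (r * c)"
proof (induction "is" arbitrary: f)
  case (Cons i "is")
  then obtain h where h: "\<forall>x. H (\<lambda>y. f (vec_upd x i y)) (h x)" "has_iterated_integral H is h c" by auto
  then show ?case using lin Cons.IH[of h] by (auto intro!: exI[of _ "\<lambda>x. r * h x"])
qed simp

text \<open>
For variables integrated in the order of the list, the shift \<open>h j\<close> of the variable \<open>j\<close> may depend only on the variables that come after \<open>j\<close>
(and on those outside of the list).
\<close>

fun later_only :: "'i::finite list \<Rightarrow> ('i \<Rightarrow> 'a ^ 'i \<Rightarrow> 'a) \<Rightarrow> bool" where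
  "later_only [] h \<longleftrightarrow> True"
| "later_only (i # is) h \<longleftrightarrow> (\<forall>j\<in>set (i # is). \<forall>x y. h j (vec_upd x i y) = h j x) \<and> later_only is h"

text \<open>
While the variable \<open>i\<close> is integrated out, its own shift is a constant and the shifts of the later variables do not involve it. So the
substitution in \<open>i\<close> is a one-variable affine map, and the remaining substitution is again triangular. Variables outside of the list stay
fixed, which keeps the statement meaningful for the dummy variables left behind by earlier integrations. The set \<open>D\<close> of admissible
factors is \<open>{1}\<close> over \<open>E\<close>, where only translations occur, and the set of nonzero elements over \<open>F\<close>.
\<close>

lemma has_iterated_integral_triangular:
  fixes H :: "('a::field \<Rightarrow> 'b::comm_semiring_1) \<Rightarrow> 'b \<Rightarrow> bool" and w :: "'a \<Rightarrow> 'b"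
  assumes aff: "\<And>g c d b. H g c \<Longrightarrow> d \<in> D \<Longrightarrow> H (\<lambda>y. g (d * y + b)) (w d * c)"
    and sc: "\<And>g c d. H g c \<Longrightarrow> d \<in> D \<Longrightarrow> H (\<lambda>y. w d * g y) (w d * c)"
  shows "has_iterated_integral H is f c \<Longrightarrow> distinct is \<Longrightarrow> \<forall>i\<in>set is. d i \<in> D \<Longrightarrow> later_only is h \<Longrightarrow>
    has_iterated_integral H is (\<lambda>x. f (\<chi> j. if j \<in> set is then d j * x $ j + h j x else x $ j))
      ((\<Prod>j\<in>set is. w (d j)) * c)"
proof (induction "is" arbitrary: f)
  case Nil
  then show ?case by (simp add: vec_lambda_eta)
next
  case (Cons i "is")
  then obtain g where g: "\<forall>x. H (\<lambda>y. f (vec_upd x i y)) (g x)" "has_iterated_integral H is g c" by auto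
  define z where "z x = (\<chi> j. if j \<in> set is then d j * x $ j + h j x else x $ j)" for x
  have IH: "has_iterated_integral H is (\<lambda>x. g (z x)) ((\<Prod>j\<in>set is. w (d j)) * c)"
    unfolding z_def using Cons.prems(2-4) g by (intro Cons.IH) simp_all
  have di: "d i \<in> D" using Cons.prems(3) by simp
  have hup: "h j (vec_upd x i y) = h j x" if "j \<in> set (i # is)" for j x y
    using Cons.prems(4) that by (simp only: later_only.simps)
  have nin: "i \<notin> set is" using Cons.prems(2) by simp
  have "has_iterated_integral H is (\<lambda>x. w (d i) * g (z x)) (w (d i) * ((\<Prod>j\<in>set is. w (d j)) * c))"
    by (rule has_iterated_integral_scale[OF _ IH]) (rule sc[OF _ di])
  moreover have "H (\<lambda>y. f (\<chi> j. if j \<in> set (i # is) then d j * (vec_upd x i y) $ j + h j (vec_upd x i y)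
        else (vec_upd x i y) $ j)) (w (d i) * g (z x))" for x
  proof -
    have "(\<chi> j. if j \<in> set (i # is) then d j * (vec_upd x i y) $ j + h j (vec_upd x i y)
        else (vec_upd x i y) $ j) = vec_upd (z x) i (d i * y + h i x)" for y
      using hup nin by (auto simp: vec_eq_iff z_def)
    then show ?thesis using aff[OF g(1)[rule_format, of "z x"] di, of "h i x"] by (simp only:)
  qed
  moreover have "(\<Prod>j\<in>set (i # is). w (d j)) * c = w (d i) * ((\<Prod>j\<in>set is. w (d j)) * c)"
    using nin by (simp add: mult.assoc)
  ultimately show ?case
    unfolding has_iterated_integral.simps by (intro exI[of _ "\<lambda>x. w (d i) * g (z x)"]) (simp only: simp_thms)
qed

text \<open>
The constant \<open>K\<close> collects the factors that have already been integrated, together with those that depend on the remaining variables.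
\<close>

lemma has_iterated_integral_prod:
  fixes H :: "('a \<Rightarrow> 'b::comm_semiring_1) \<Rightarrow> 'b \<Rightarrow> bool"
  assumes sc: "\<And>g c r. H g c \<Longrightarrow> H (\<lambda>y. r * g y) (r * c)"
    and F: "\<And>i. H (F i) (c i)"
  shows "distinct is \<Longrightarrow>
    has_iterated_integral H is (\<lambda>x. K * (\<Prod>i\<in>set is. F i (x $ i))) (K * (\<Prod>i\<in>set is. c i))"
proof (induction "is" arbitrary: K)
  case (Cons i "is")
  have "H (\<lambda>y. K * (\<Prod>j\<in>set (i # is). F j ((vec_upd x i y) $ j)))
      (K * c i * (\<Prod>j\<in>set is. F j (x $ j)))" for x
  proof -
    have "(\<Prod>j\<in>set is. F j ((vec_upd x i y) $ j)) = (\<Prod>j\<in>set is. F j (x $ j))" for y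
      by (rule prod.cong) (use Cons.prems in auto)
    then have "K * (\<Prod>j\<in>set (i # is). F j ((vec_upd x i y) $ j)) =
        K * (\<Prod>j\<in>set is. F j (x $ j)) * F i y" for y
      using Cons.prems by (simp add: mult_ac)
    moreover have "K * c i * (\<Prod>j\<in>set is. F j (x $ j)) = K * (\<Prod>j\<in>set is. F j (x $ j)) * c i"
      by (simp only: mult_ac)
    ultimately show ?thesis
      using sc[OF F[of i], of "K * (\<Prod>j\<in>set is. F j (x $ j))"] by (simp only:)
  qed
  moreover have "has_iterated_integral H is (\<lambda>x. K * c i * (\<Prod>j\<in>set is. F j (x $ j)))
      (K * c i * (\<Prod>j\<in>set is. c j))"
    using Cons by simp
  moreover have "K * (\<Prod>j\<in>set (i # is). c j) = K * c i * (\<Prod>j\<in>set is. c j)"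
    using Cons.prems by (simp add: mult_ac)
  ultimately show ?case
    unfolding has_iterated_integral.simps
    by (intro exI[of _ "\<lambda>x. K * c i * (\<Prod>j\<in>set is. F j (x $ j))"]) (simp only: simp_thms)
qed simp

lemma has_fubini_integral_prod:
  fixes H :: "('a \<Rightarrow> 'b::comm_semiring_1) \<Rightarrow> 'b \<Rightarrow> bool"
  assumes sc: "\<And>g c r. H g c \<Longrightarrow> H (\<lambda>y. r * g y) (r * c)"
    and F: "\<And>i. H (F i) (c i)"
  shows "has_fubini_integral H (\<lambda>x. \<Prod>i\<in>UNIV. F i (x $ i)) (\<Prod>i\<in>UNIV. c i)"
  unfolding has_fubini_integral_def
proof (intro allI impI)
  fix "is" :: "'c list" assume "distinct is \<and> set is = UNIV"
  then show "has_iterated_integral H is (\<lambda>x. \<Prod>i\<in>UNIV. F i (x $ i)) (\<Prod>i\<in>UNIV. c i)"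
    using has_iterated_integral_prod[of H F c "is" 1, OF sc F] by simp
qed

section \<open>Shears and triangular matrices\<close>

text \<open>
In the Leibniz expansion a permutation with a nonzero term can only raise the rank, and the sum of all ranks is preserved, so
the permutation moves nothing. Ranks may repeat: a single shear has two ranks, and matrices that act fiberwise inherit the rank of one coordinate.
\<close>

lemma det_triangular_rank:
  fixes T :: "'a::comm_ring_1 ^ 'i ^ 'i::finite" and r :: "'i \<Rightarrow> nat"
  assumes tri: "\<And>a b. a \<noteq> b \<Longrightarrow> T $ a $ b \<noteq> 0 \<Longrightarrow> r a < r b"
  shows "det T = (\<Prod>a\<in>UNIV. T $ a $ a)"
proof -
  have zero: "(\<Prod>a\<in>UNIV. T $ a $ p a) = 0" if p: "p permutes UNIV" "p \<noteq> id" for p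
  proof (rule ccontr)
    assume "(\<Prod>a\<in>UNIV. T $ a $ p a) \<noteq> 0"
    then have nz: "T $ a $ p a \<noteq> 0" for a by (metis finite prod_zero UNIV_I)
    have le: "r a \<le> r (p a)" for a using tri[of a "p a"] nz[of a] by (cases "p a = a") auto
    obtain a where "p a \<noteq> a" using p(2) by (auto simp: fun_eq_iff)
    then have lt: "r a < r (p a)" using tri[of a "p a"] nz[of a] by auto
    have "(\<Sum>a\<in>UNIV. r a) < (\<Sum>a\<in>UNIV. r (p a))"
      by (rule sum_strict_mono_ex1) (use le lt in auto)
    moreover have "(\<Sum>a\<in>UNIV. r (p a)) = (\<Sum>a\<in>UNIV. r a)"
      using sum.permute[OF p(1), of r] by (simp add: comp_def)
    ultimately show False by simp
  qed
  have "det T = (\<Sum>p\<in>{id}. of_int (sign p) * (\<Prod>a\<in>UNIV. T $ a $ p a))"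
    unfolding det_def by (rule sum.mono_neutral_right) (auto simp: zero permutes_id)
  then show ?thesis by (simp add: sign_id)
qed

text \<open>
The matrix that adds \<open>c a\<close> times row \<open>i\<close> to every row \<open>a \<noteq> i\<close>. One such matrix clears a whole column.
\<close>

definition colshear :: "'i \<Rightarrow> ('i \<Rightarrow> 'a) \<Rightarrow> 'a::comm_ring_1 ^ 'i ^ 'i::finite" where
  "colshear i c = (\<chi> a b. if a = b then 1 else if b = i then c a else 0)"

lemma colshear_vec: "(colshear i c *v x) $ a = x $ a + (if a = i then 0 else c a * x $ i)"
proof -
  have "(colshear i c *v x) $ a = (\<Sum>b\<in>UNIV. (if a = b then x $ b else 0) + (if b = i then (if a = i then 0 else c a * x $ i) else 0))"
    unfolding matrix_vector_mult_def colshear_def vec_lambda_beta by (rule sum.cong) auto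
  also have "\<dots> = x $ a + (if a = i then 0 else c a * x $ i)"
    by (simp only: sum.distrib sum.delta sum.delta' finite UNIV_I if_True)
  finally show ?thesis .
qed

lemma matrix_mult_nth_col: "(A ** B) $ a $ b = (A *v (\<chi> j. B $ j $ b)) $ a"
  by (simp add: matrix_matrix_mult_def matrix_vector_mult_def)

lemma colshear_mult: "(colshear i c ** T) $ a $ b = T $ a $ b + (if a = i then 0 else c a * T $ i $ b)"
  by (simp add: matrix_mult_nth_col colshear_vec)

lemma colshear_inverse: "colshear i c ** colshear i (\<lambda>a. - c a) = mat 1"
  by (simp add: vec_eq_iff colshear_mult) (simp add: colshear_def mat_def)

lemma colshear_cancel: "colshear i c ** (colshear i (\<lambda>a. - c a) ** T) = T"
  by (simp add: matrix_mul_assoc colshear_inverse)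

lemma det_colshear: "det (colshear i c) = 1"
proof -
  have "det (colshear i c) = (\<Prod>a\<in>UNIV. colshear i c $ a $ a)"
    by (rule det_triangular_rank[of _ "\<lambda>a. if a = i then 1 else 0"]) (auto simp: colshear_def split: if_splits)
  then show ?thesis by (simp add: colshear_def)
qed

text \<open>
Products of shears that involve only the rows in \<open>S\<close> and have multipliers in \<open>R\<close>. The set \<open>S\<close> is tracked because elimination in later columns
must not disturb the rows that are already finished.
\<close>

inductive_set shears :: "'a set \<Rightarrow> 'i set \<Rightarrow> ('a::comm_ring_1 ^ 'i ^ 'i::finite) set" for R S where
  one: "mat 1 \<in> shears R S"
| step: "i \<in> S \<Longrightarrow> (\<And>a. c a \<in> R) \<Longrightarrow> (\<And>a. a \<notin> S \<Longrightarrow> c a = 0) \<Longrightarrow> A \<in> shears R S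
    \<Longrightarrow> colshear i c ** A \<in> shears R S"

lemma shears_mult: "A \<in> shears R S \<Longrightarrow> B \<in> shears R S \<Longrightarrow> A ** B \<in> shears R S"
  by (induction rule: shears.induct) (auto simp: matrix_mul_assoc[symmetric] intro: shears.step)

lemma shears_mono: "A \<in> shears R S \<Longrightarrow> S \<subseteq> S' \<Longrightarrow> A \<in> shears R S'"
  by (induction rule: shears.induct) (auto intro!: shears.intros)

lemma det_shears: "A \<in> shears R S \<Longrightarrow> det A = 1"
  by (induction rule: shears.induct) (simp_all add: det_mul det_colshear)

text \<open>
Since products of shears are invertible, zeros of a column of \<open>A ** T\<close> in the rows \<open>S\<close> come from zeros of \<open>T\<close>.
\<close>

lemma shears_zero_column:
  "A \<in> shears R S \<Longrightarrow> (\<And>a. a \<in> S \<Longrightarrow> (A ** T) $ a $ b = 0) \<Longrightarrow> a \<in> S \<Longrightarrow> T $ a $ b = 0"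
proof (induction arbitrary: a rule: shears.induct)
  case (step i c A)
  have *: "(A ** T) $ a $ b + (if a = i then 0 else c a * (A ** T) $ i $ b) = 0" if "a \<in> S" for a
    using step.prems(1)[OF that] by (simp add: colshear_mult flip: matrix_mul_assoc)
  have "(A ** T) $ a $ b = 0" if "a \<in> S" for a
    using *[OF that] *[OF step.hyps(1)] by (auto split: if_splits)
  then show ?case using step by blast
qed simp

text \<open>
Triangular with respect to the order of the list, rows and columns being indexed by an unordered type.
\<close>

fun tri :: "'i::finite list \<Rightarrow> 'a::zero ^ 'i ^ 'i \<Rightarrow> bool" where
  "tri [] T \<longleftrightarrow> True"
| "tri (i # is) T \<longleftrightarrow> (\<forall>j\<in>set is. T $ j $ i = 0) \<and> tri is T"

lemma tri_nth: "tri is T \<Longrightarrow> q < p \<Longrightarrow> p < length is \<Longrightarrow> T $ (is ! p) $ (is ! q) = 0"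
proof (induction "is" arbitrary: p q)
  case (Cons i "is")
  then obtain p' where "p = Suc p'" by (cases p) auto
  with Cons show ?case by (cases q) auto
qed simp

lemma tri_rank:
  fixes T :: "'a::comm_ring_1 ^ 'i ^ 'i::finite"
  assumes "tri is T" "set is = UNIV"
  shows "\<exists>r::'i \<Rightarrow> nat. \<forall>a b. a \<noteq> b \<longrightarrow> T $ a $ b \<noteq> 0 \<longrightarrow> r a < r b"
proof -
  have "\<exists>p<length is. is ! p = a" for a using assms(2) by (metis UNIV_I in_set_conv_nth)
  then obtain r where r: "\<And>a. r a < length is" "\<And>a. is ! r a = a" by metis
  have "r a < r b" if "a \<noteq> b" "T $ a $ b \<noteq> 0" for a b
  proof (rule ccontr)
    assume "\<not> r a < r b"
    moreover have "r a \<noteq> r b" using r(2) that by metis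
    ultimately have "T $ (is ! r a) $ (is ! r b) = 0" using assms r by (intro tri_nth) auto
    with that r show False by simp
  qed
  then show ?thesis by blast
qed

lemma det_tri:
  fixes T :: "'a::comm_ring_1 ^ 'i ^ 'i::finite"
  assumes "tri is T" "set is = UNIV"
  shows "det T = (\<Prod>a\<in>UNIV. T $ a $ a)"
proof -
  obtain r :: "'i \<Rightarrow> nat" where "\<forall>a b. a \<noteq> b \<longrightarrow> T $ a $ b \<noteq> 0 \<longrightarrow> r a < r b"
    using tri_rank[OF assms] by (rule exE)
  then show ?thesis by (intro det_triangular_rank[of T r]) simp
qed

abbreviation fls_integers :: "'a::zero fls set" where
  "fls_integers \<equiv> {x. \<forall>n<0. fls_nth x n = 0}"

lemma divide_fls_integers:
  fixes x y :: "'a::field fls"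
  assumes "y \<noteq> 0" "x = 0 \<or> fls_subdegree y \<le> fls_subdegree x"
  shows "x / y \<in> fls_integers"
proof (cases "x = 0")
  case False
  then have "fls_subdegree (x / y) = fls_subdegree x - fls_subdegree y"
    using assms(1) fls_subdegree_mult[of "x / y" y] by simp
  then show ?thesis using assms(2) False by (simp add: subdegree_ge_iff)
qed simp

text \<open>
If the pivot divides the rest of its column, one shear clears the column.
\<close>

lemma clear_column_pivot:
  fixes \<tau> :: "'a::field fls ^ 'i ^ 'i::finite"
  assumes p: "\<tau> $ i $ i \<noteq> 0" "\<And>j. j \<in> S \<Longrightarrow> \<tau> $ j $ i = 0 \<or> fls_subdegree (\<tau> $ i $ i) \<le> fls_subdegree (\<tau> $ j $ i)"
    and i: "i \<notin> S"
  shows "\<exists>A\<in>shears fls_integers (insert i S). \<exists>T. \<tau> = A ** T \<and> (\<forall>j\<in>S. T $ j $ i = 0)"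
proof -
  define c where "c j = (if j \<in> S then \<tau> $ j $ i / \<tau> $ i $ i else 0)" for j
  let ?A = "colshear i c" and ?T = "colshear i (\<lambda>a. - c a) ** \<tau>"
  have "c j \<in> fls_integers" for j
  proof (cases "j \<in> S")
    case True
    then show ?thesis using divide_fls_integers[OF p(1) p(2)[OF True]] by (simp add: c_def)
  qed (simp add: c_def)
  then have "?A ** mat 1 \<in> shears fls_integers (insert i S)"
    by (rule shears.step[OF insertI1 _ _ shears.one]) (simp add: c_def)
  then have A: "?A \<in> shears fls_integers (insert i S)" by simp
  have T: "?T $ j $ i = 0" if "j \<in> S" for j
    using that i p(1) by (auto simp: colshear_mult c_def)
  show ?thesis
    by (rule bexI[OF _ A], rule exI[of _ ?T]) (simp add: colshear_cancel T)
qed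

text \<open>
If the diagonal entry does not have minimal valuation in its column, then adding a row whose entry has minimal valuation produces
a pivot of that valuation, because the valuations differ. This replaces the usual row exchange and keeps all factors of determinant one.
\<close>

lemma clear_column:
  fixes \<tau> :: "'a::field fls ^ 'i ^ 'i::finite"
  assumes i: "i \<notin> S"
  shows "\<exists>A\<in>shears fls_integers (insert i S). \<exists>T. \<tau> = A ** T \<and> (\<forall>j\<in>S. T $ j $ i = 0)"
proof -
  let ?P = "\<lambda>\<tau> :: 'a fls ^ 'i ^ 'i. \<tau> $ i $ i \<noteq> 0 \<and> (\<forall>j\<in>S. \<tau> $ j $ i = 0 \<or> fls_subdegree (\<tau> $ i $ i) \<le> fls_subdegree (\<tau> $ j $ i))"
  let ?N = "{j \<in> S. \<tau> $ j $ i \<noteq> 0}"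
  consider "?N = {}" | "?P \<tau>" | "?N \<noteq> {}" "\<not> ?P \<tau>" by blast
  then show ?thesis
  proof cases
    case 1
    then show ?thesis by (intro bexI[of _ "mat 1"] exI[of _ \<tau>]) (auto intro: shears.one)
  next
    case 2
    then show ?thesis using clear_column_pivot[of \<tau> i S] i by blast
  next
    case 3
    let ?v = "\<lambda>j. fls_subdegree (\<tau> $ j $ i)"
    obtain j0 where j0: "j0 \<in> ?N" "\<And>j. j \<in> ?N \<Longrightarrow> ?v j0 \<le> ?v j"
      using 3(1) arg_min_if_finite(1)[of ?N ?v] arg_min_least[of ?N _ ?v] finite[of ?N] by blast
    have lt: "\<tau> $ i $ i = 0 \<or> ?v j0 < ?v i"
    proof (rule ccontr)
      assume "\<not> ?thesis"
      then have "\<tau> $ i $ i \<noteq> 0" "?v i \<le> ?v j0" by auto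
      then have "?v i \<le> ?v j" if "j \<in> S" "\<tau> $ j $ i \<noteq> 0" for j
        using j0(2)[of j] that by simp
      then have "?P \<tau>" using \<open>\<tau> $ i $ i \<noteq> 0\<close> by blast
      with 3 show False by blast
    qed
    define c where "c a = (if a = i then 1 else 0 :: 'a fls)" for a
    \<comment> \<open>Adding row \<open>j0\<close> to row \<open>i\<close> moves the minimal valuation to the diagonal.\<close>
    let ?T = "colshear j0 c ** \<tau>" and ?A = "colshear j0 (\<lambda>a. - c a)"
    have ne: "j0 \<noteq> i" using j0 i by auto
    have Ti: "?T $ i $ i = \<tau> $ i $ i + \<tau> $ j0 $ i" using ne by (simp add: colshear_mult c_def)
    have Tj: "?T $ j $ i = \<tau> $ j $ i" if "j \<in> S" for j using that i by (auto simp: colshear_mult c_def)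
    have nz: "?T $ i $ i \<noteq> 0" and sd: "fls_subdegree (?T $ i $ i) = ?v j0"
    proof -
      have "fls_nth (\<tau> $ i $ i) n = 0" if "n \<le> ?v j0" for n using lt that by auto
      then have *: "fls_nth (?T $ i $ i) n = fls_nth (\<tau> $ j0 $ i) n" if "n \<le> ?v j0" for n
        using that unfolding Ti by simp
      show "?T $ i $ i \<noteq> 0" using *[of "?v j0"] j0(1) by auto
      show "fls_subdegree (?T $ i $ i) = ?v j0"
        by (rule fls_subdegree_eqI) (use * j0(1) in auto)
    qed
    have "?T $ j $ i = 0 \<or> fls_subdegree (?T $ i $ i) \<le> fls_subdegree (?T $ j $ i)" if "j \<in> S" for j
      using j0(2)[of j] that unfolding Tj[OF that] sd by blast
    then obtain B T where B: "B \<in> shears fls_integers (insert i S)" "?T = B ** T" "\<forall>j\<in>S. T $ j $ i = 0"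
      using clear_column_pivot[of ?T i S, OF nz _ i] by blast
    have "?A ** B \<in> shears fls_integers (insert i S)"
      using j0(1) by (intro shears.step[OF _ _ _ B(1)]) (simp_all add: c_def)
    moreover have "\<tau> = (?A ** B) ** T"
      using colshear_cancel[of j0 "\<lambda>a. - c a" \<tau>] B(2) by (simp add: matrix_mul_assoc)
    ultimately show ?thesis using B(3) by blast
  qed
qed

text \<open>
Gaussian elimination over a valuation ring, column by column in the order of the list.
\<close>

lemma shears_triangular_decomposition:
  fixes \<tau> :: "'a::field fls ^ 'i ^ 'i::finite"
  shows "distinct is \<Longrightarrow> \<exists>A\<in>shears fls_integers (set is). \<exists>T. \<tau> = A ** T \<and> tri is T"
proof (induction "is" arbitrary: \<tau>)
  case Nil
  show ?case by (intro bexI[of _ "mat 1"] exI[of _ \<tau>]) (auto intro: shears.one)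
next
  case (Cons i "is")
  obtain A T where A: "A \<in> shears fls_integers (set (i # is))" "\<tau> = A ** T" "\<forall>j\<in>set is. T $ j $ i = 0"
    using clear_column[of i "set is" \<tau>] Cons.prems by auto
  obtain B U where B: "B \<in> shears fls_integers (set is)" "T = B ** U" "tri is U"
    using Cons.IH[of T] Cons.prems by auto
  have "U $ j $ i = 0" if "j \<in> set is" for j
    using shears_zero_column[OF B(1) _ that, of U i] A(3) B(2) by blast
  then have "tri (i # is) U" using B by simp
  moreover have "A ** B \<in> shears fls_integers (set (i # is))"
    using A B shears_mono[OF B(1), of "set (i # is)"] by (intro shears_mult) auto
  moreover have "\<tau> = (A ** B) ** U" using A B by (simp add: matrix_mul_assoc)
  ultimately show ?case by blast
qed

text \<open>
The matrix of \<open>g\<close> acting in the \<open>\<pi>\<close>-coordinate of the index while the \<open>\<rho>\<close>-coordinate is kept. With the two projections of a product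
this is left multiplication on matrix coordinates, and, after exchanging them and transposing, right multiplication.
\<close>

definition fiberwise :: "('p \<Rightarrow> 'n) \<Rightarrow> ('p \<Rightarrow> 'm) \<Rightarrow> 'a::comm_ring_1 ^ 'n ^ 'n \<Rightarrow> 'a ^ 'p ^ 'p" where
  "fiberwise \<pi> \<rho> g = (\<chi> p q. if \<rho> p = \<rho> q then g $ \<pi> p $ \<pi> q else 0)"

context
  fixes \<pi> :: "'p::finite \<Rightarrow> 'n::finite" and \<rho> :: "'p \<Rightarrow> 'm::finite"
  assumes bij: "bij (\<lambda>p. (\<pi> p, \<rho> p))"
begin

lemma fiber_sum: "(\<Sum>q\<in>{q. \<rho> q = b}. f (\<pi> q)) = (\<Sum>k\<in>UNIV. f k)" for f :: "'n \<Rightarrow> 'a::comm_monoid_add"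
proof (rule sum.reindex_bij_betw)
  show "bij_betw \<pi> {q. \<rho> q = b} UNIV"
    unfolding bij_betw_def
  proof
    show "inj_on \<pi> {q. \<rho> q = b}" using bij unfolding bij_def inj_def inj_on_def by auto
    show "\<pi> ` {q. \<rho> q = b} = UNIV"
    proof (intro equalityI subsetI)
      fix k :: 'n
      obtain q where "(k, b) = (\<pi> q, \<rho> q)" using bij unfolding bij_def surj_def by blast
      then show "k \<in> \<pi> ` {q. \<rho> q = b}" by auto
    qed simp
  qed
qed

lemma fiberwise_mult: "fiberwise \<pi> \<rho> (g ** h) = fiberwise \<pi> \<rho> g ** fiberwise \<pi> \<rho> h"
proof -
  have "(fiberwise \<pi> \<rho> g ** fiberwise \<pi> \<rho> h) $ p $ r = fiberwise \<pi> \<rho> (g ** h) $ p $ r" for p r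
  proof -
    have "(fiberwise \<pi> \<rho> g ** fiberwise \<pi> \<rho> h) $ p $ r =
       (\<Sum>q\<in>UNIV. if \<rho> q = \<rho> p then (if \<rho> p = \<rho> r then g $ \<pi> p $ \<pi> q * h $ \<pi> q $ \<pi> r else 0) else 0)"
      unfolding fiberwise_def matrix_matrix_mult_def by (auto intro!: sum.cong)
    also have "\<dots> = (\<Sum>q\<in>{q. \<rho> q = \<rho> p}. if \<rho> p = \<rho> r then g $ \<pi> p $ \<pi> q * h $ \<pi> q $ \<pi> r else 0)"
      by (rule sum.mono_neutral_cong_right) auto
    also have "\<dots> = (\<Sum>k\<in>UNIV. if \<rho> p = \<rho> r then g $ \<pi> p $ k * h $ k $ \<pi> r else 0)"
      by (rule fiber_sum[where b = "\<rho> p" and f = "\<lambda>k. if \<rho> p = \<rho> r then g $ \<pi> p $ k * h $ k $ \<pi> r else 0"])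
    also have "\<dots> = fiberwise \<pi> \<rho> (g ** h) $ p $ r"
      by (simp add: fiberwise_def matrix_matrix_mult_def)
    finally show ?thesis .
  qed
  then show ?thesis by (simp add: vec_eq_iff)
qed

lemma fiber_eqI: "\<pi> p = \<pi> q \<Longrightarrow> \<rho> p = \<rho> q \<Longrightarrow> p = q"
  using bij unfolding bij_def inj_def by auto

lemma fiberwise_1: "fiberwise \<pi> \<rho> (mat 1) = (mat 1 :: 'a::comm_ring_1 ^ 'p ^ 'p)"
proof -
  have "fiberwise \<pi> \<rho> (mat 1) $ p $ q = (mat 1 :: 'a ^ 'p ^ 'p) $ p $ q" for p q
    using fiber_eqI[of p q] by (cases "p = q") (auto simp: fiberwise_def mat_def)
  then show ?thesis by (simp add: vec_eq_iff)
qed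

lemma det_fiberwise_rank:
  assumes "\<And>a b. a \<noteq> b \<Longrightarrow> T $ a $ b \<noteq> 0 \<Longrightarrow> r a < (r b :: nat)"
  shows "det (fiberwise \<pi> \<rho> T) = det T ^ CARD('m)"
proof -
  have "det (fiberwise \<pi> \<rho> T) = (\<Prod>p\<in>UNIV. fiberwise \<pi> \<rho> T $ p $ p)"
  proof (rule det_triangular_rank[of _ "r \<circ> \<pi>"])
    fix p q assume ne: "p \<noteq> q" and "fiberwise \<pi> \<rho> T $ p $ q \<noteq> 0"
    then have "\<rho> p = \<rho> q" and T: "T $ \<pi> p $ \<pi> q \<noteq> 0"
      by (simp_all add: fiberwise_def split: if_splits)
    with ne have "\<pi> p \<noteq> \<pi> q" using fiber_eqI by blast
    then show "(r \<circ> \<pi>) p < (r \<circ> \<pi>) q" using assms T by simp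
  qed
  also have "\<dots> = (\<Prod>p\<in>UNIV. (\<lambda>(a, b). T $ a $ a) (\<pi> p, \<rho> p))"
    by (simp add: fiberwise_def)
  also have "\<dots> = (\<Prod>(a, b)\<in>(UNIV :: ('n \<times> 'm) set). T $ a $ a)"
    using prod.reindex_bij_betw[OF bij, of "\<lambda>(a, b). T $ a $ a"] .
  also have "\<dots> = (\<Prod>a\<in>UNIV. \<Prod>b\<in>(UNIV :: 'm set). T $ a $ a)"
    unfolding UNIV_Times_UNIV[symmetric] by (rule prod.cartesian_product[symmetric])
  also have "\<dots> = det T ^ CARD('m)"
    using det_triangular_rank[of T r] assms by (simp add: prod_power_distrib)
  finally show ?thesis .
qed

lemma det_fiberwise_shears: "A \<in> shears R S \<Longrightarrow> det (fiberwise \<pi> \<rho> A) = 1"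
proof (induction rule: shears.induct)
  case (step i c A)
  have "det (fiberwise \<pi> \<rho> (colshear i c)) = det (colshear i c) ^ CARD('m)"
    by (rule det_fiberwise_rank[of _ "\<lambda>a. if a = i then 1 else 0"]) (auto simp: colshear_def split: if_splits)
  then show ?case using step by (simp add: fiberwise_mult det_mul det_colshear)
qed (simp add: fiberwise_1)

text \<open>
Both sides are multiplicative in \<open>g\<close>, so the triangular decomposition leaves shears and triangular matrices, where the determinant is the
product over the diagonal.
\<close>

lemma det_fiberwise: "det (fiberwise \<pi> \<rho> g) = det g ^ CARD('m)" for g :: "'a::field fls ^ 'n ^ 'n"
proof -
  obtain l :: "'n list" where l: "distinct l" "set l = UNIV"
    using finite_distinct_list[OF finite] by blast
  obtain A T where A: "A \<in> shears fls_integers (set l)" and g: "g = A ** T" and T: "tri l T"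
    using shears_triangular_decomposition[OF l(1)] by blast
  obtain r :: "'n \<Rightarrow> nat" where "\<forall>a b. a \<noteq> b \<longrightarrow> T $ a $ b \<noteq> 0 \<longrightarrow> r a < r b"
    using tri_rank[OF T l(2)] by blast
  then have "det (fiberwise \<pi> \<rho> T) = det T ^ CARD('m)" using det_fiberwise_rank by blast
  then show ?thesis
    by (simp add: g fiberwise_mult det_mul det_fiberwise_shears[OF A] det_shears[OF A])
qed

end

section \<open>Lifts under affine substitutions\<close>

lemma integral_F: "(fls_integers :: 'k::{field,finite} F set) = ring_O1"
  by (auto simp: ring_O1_iff)

lemma fls_integers_add: "x \<in> fls_integers \<Longrightarrow> y \<in> fls_integers \<Longrightarrow> x + y \<in> fls_integers" for x :: "'a::field fls"
  by simp

text \<open>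
Valuations add under multiplication; the formulation with vanishing coefficients also covers zero.
\<close>

lemma fls_nth_mult_zero_below:
  fixes x y :: "'a::field fls"
  assumes x: "x = 0 \<or> m \<le> fls_subdegree x" and y: "\<forall>n<l. fls_nth y n = 0" and n: "n < m + l"
  shows "fls_nth (x * y) n = 0"
proof (cases "x = 0 \<or> y = 0")
  case False
  then have "m \<le> fls_subdegree x" "l \<le> fls_subdegree y" using x y subdegree_ge_iff by blast+
  then show ?thesis using n False by (intro fls_times_nth_eq0) auto
qed auto

lemma fls_integers_mult: "x \<in> fls_integers \<Longrightarrow> y \<in> fls_integers \<Longrightarrow> x * y \<in> fls_integers" for x :: "'a::field fls"
  using fls_nth_mult_zero_below[where m=0 and l=0 and x=x and y=y] subdegree_ge_iff[of 0 x] by simp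

lemma fls_nth_mult_0:
  fixes x y :: "'a::field fls"
  assumes "x \<in> fls_integers" "y \<in> fls_integers"
  shows "fls_nth (x * y) 0 = fls_nth x 0 * fls_nth y 0"
proof (cases "x = 0")
  case False
  then have sd: "0 \<le> fls_subdegree x" using assms(1) subdegree_ge_iff[of 0 x] by blast
  show ?thesis
  proof (cases "fls_subdegree x = 0")
    case True
    then show ?thesis using fls_nth_mult_lowest[of 0 y x] assms(2) by simp
  next
    case F: False
    have "fls_nth (x * y) 0 = 0"
      by (rule fls_nth_mult_zero_below[where m=1 and l=0]) (use sd F assms(2) in auto)
    then show ?thesis using sd F by simp
  qed
qed simp

lemma shears_integral:
  fixes A :: "'a::field fls ^ 'i ^ 'i::finite"
  shows "A \<in> shears fls_integers S \<Longrightarrow> A $ a $ b \<in> fls_integers"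
proof (induction arbitrary: a b rule: shears.induct)
  case (step i c A)
  then have "c a * A $ i $ b \<in> fls_integers" by (intro fls_integers_mult)
  then show ?case using fls_integers_add[OF step.IH[of a b], of "c a * A $ i $ b"] step.IH[of a b]
    by (auto simp: colshear_mult)
qed (simp add: mat_def)

lemma later_only_last: "i \<notin> set l \<Longrightarrow> later_only (l @ [i]) (\<lambda>j x. if j = i then 0 else s j * x $ i)"
  by (induction l) auto

text \<open>
Integrate \<open>x\<^sub>i\<close> last. In all earlier integrations \<open>x\<^sub>i\<close> is a parameter, so the shear is a translation of the variable that is being integrated.
\<close>

lemma fubini_colshear_E:
  fixes f :: "'k::{field,finite} E ^ 'i::finite \<Rightarrow> complex"
  assumes f: "has_fubini_integral has_E_integral f c"
    and g: "fubini has_E_integral (\<lambda>x. f (colshear i s *v x))"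
  shows "has_fubini_integral has_E_integral (\<lambda>x. f (colshear i s *v x)) c"
proof -
  obtain l where l: "set l = UNIV - {i}" "distinct l" using finite_distinct_list[of "UNIV - {i}"] by auto
  let ?l = "l @ [i]"
  let ?h = "\<lambda>j x. if j = i then 0 else s j * x $ i"
  have L: "distinct ?l" "set ?l = UNIV" using l by auto
  have "has_iterated_integral has_E_integral ?l f c"
    using f L unfolding has_fubini_integral_def by blast
  then have "has_iterated_integral has_E_integral ?l
      (\<lambda>x. f (\<chi> j. if j \<in> set ?l then (\<lambda>_. 1) j * x $ j + ?h j x else x $ j)) ((\<Prod>j\<in>set ?l. (\<lambda>_. 1) ((\<lambda>_. 1 :: 'k E) j)) * c)"
  proof (rule has_iterated_integral_triangular[where D="{1}", rotated 2])
    fix g :: "'k E \<Rightarrow> complex" and c and d b :: "'k E" assume "has_E_integral g (c::complex)" "d \<in> {1}"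
    then show "has_E_integral (\<lambda>y. g (d * y + b)) (1 * c)"
      using has_E_integral_affine[of g c 1 b] by simp
  qed (use l L later_only_last[of i l s] in simp_all)
  moreover have "(\<chi> j. if j \<in> set ?l then (\<lambda>_. 1) j * x $ j + ?h j x else x $ j) = colshear i s *v x" for x
    using L by (simp add: vec_eq_iff colshear_vec)
  ultimately have 1: "has_iterated_integral has_E_integral ?l (\<lambda>x. f (colshear i s *v x)) c" by simp
  obtain c' where c': "has_fubini_integral has_E_integral (\<lambda>x. f (colshear i s *v x)) c'"
    using g unfolding fubini_def by blast
  then have 2: "has_iterated_integral has_E_integral ?l (\<lambda>x. f (colshear i s *v x)) c'"
    using L unfolding has_fubini_integral_def by blast
  have "c = c'"
    by (rule has_iterated_integral_unique[OF _ 1 2]) (rule has_bochner_integral_eq)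
  with c' show ?thesis by simp
qed

text \<open>
The lift of level \<open>0\<close> centred at the origin. All other lifts arise from it by affine substitutions.
\<close>

definition lift0 :: "('k::{field,finite} E ^ 'i::finite \<Rightarrow> complex) \<Rightarrow> 'k F ^ 'i \<Rightarrow> complex fls" where
  "lift0 f x = (if \<forall>i. x $ i \<in> ring_O1 then fls_const (f (\<chi> i. red_t (x $ i))) else 0)"

lemma lift_eq_lift0: "lift f a \<gamma> x = lift0 f (\<chi> i. (x $ i - a $ i) * par_t powi (- \<gamma> $ i))"
  by (simp add: lift_def lift0_def)

text \<open>
A shear over \<open>O\<^sub>1\<close> preserves \<open>O\<^sub>1\<^sup>N\<close> and commutes with reduction.
\<close>

lemma lift0_colshear:
  assumes s: "\<And>a. s a \<in> ring_O1"
  shows "lift0 f (colshear i s *v x) = lift0 (\<lambda>y. f (colshear i (\<lambda>a. red_t (s a)) *v y)) x"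
proof -
  let ?z = "colshear i s *v x"
  have z: "?z $ a = x $ a + (if a = i then 0 else s a * x $ i)" for a
    by (rule colshear_vec)
  have si: "s a \<in> fls_integers" for a using s by (simp only: integral_F)
  have "(\<forall>a. ?z $ a \<in> fls_integers) \<longleftrightarrow> (\<forall>a. x $ a \<in> fls_integers)"
  proof
    assume L: "\<forall>a. ?z $ a \<in> fls_integers"
    have xi: "x $ i \<in> fls_integers" using L[rule_format, of i] by (simp add: z)
    show "\<forall>a. x $ a \<in> fls_integers"
    proof
      fix a
      have "s a * x $ i \<in> fls_integers" using si xi by (rule fls_integers_mult)
      then show "x $ a \<in> fls_integers" using L[rule_format, of a] by (auto simp: z split: if_splits)
    qed
  next
    assume R: "\<forall>a. x $ a \<in> fls_integers"
    show "\<forall>a. ?z $ a \<in> fls_integers"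
    proof
      fix a
      have "s a * x $ i \<in> fls_integers" using si R by (intro fls_integers_mult) auto
      then show "?z $ a \<in> fls_integers" using R[rule_format, of a] by (auto simp: z)
    qed
  qed
  moreover have "(\<chi> a. red_t (?z $ a)) = colshear i (\<lambda>a. red_t (s a)) *v (\<chi> a. red_t (x $ a))"
    if "\<forall>a. x $ a \<in> fls_integers"
    using fls_nth_mult_0[OF si, of "x $ i"] that by (simp add: vec_eq_iff colshear_vec red_t_def)
  ultimately show ?thesis unfolding lift0_def integral_F by simp
qed

lemma invertible_colshear: "invertible (colshear i c :: 'a::field ^ 'i ^ 'i::finite)"
  by (simp add: invertible_det_nz det_colshear)

lemma GL_fubini_compose:
  assumes "GL_fubini f" "invertible (\<sigma> :: 'k::{field,finite} E ^ 'i ^ 'i::finite)"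
  shows "GL_fubini (\<lambda>x. f (\<sigma> *v x))"
  unfolding GL_fubini_def
proof (intro allI impI)
  fix \<rho> :: "'k E ^ 'i ^ 'i" assume "invertible \<rho>"
  then have "invertible (\<sigma> ** \<rho>)" using assms(2) by (rule invertible_mult[rotated])
  then show "fubini has_E_integral (\<lambda>x. f (\<sigma> *v (\<rho> *v x)))"
    using assms(1) unfolding GL_fubini_def by (simp add: matrix_vector_mul_assoc)
qed

text \<open>
Each shear is moved from \<open>F\<close> to \<open>E\<close>, where it changes the function but not its integral. The new function is
again GL-Fubini, so the replacement can be repeated.
\<close>

lemma lift0_shears:
  fixes f :: "'k::{field,finite} E ^ 'i::finite \<Rightarrow> complex"
  shows "A \<in> shears ring_O1 S \<Longrightarrow> GL_fubini f \<Longrightarrow> has_fubini_integral has_E_integral f c \<Longrightarrow>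
    \<exists>f'. has_fubini_integral has_E_integral f' c \<and> (\<forall>x. lift0 f (A *v x) = lift0 f' x)"
proof (induction arbitrary: f rule: shears.induct)
  case one
  then show ?case by (auto intro: exI[of _ f])
next
  case (step i s A)
  let ?C = "colshear i (\<lambda>a. red_t (s a))"
  let ?f = "\<lambda>y. f (?C *v y)"
  have G: "GL_fubini ?f" using GL_fubini_compose step.prems(1) invertible_colshear by blast
  have "fubini has_E_integral ?f"
    using step.prems(1) invertible_colshear unfolding GL_fubini_def by blast
  then have "has_fubini_integral has_E_integral ?f c"
    by (rule fubini_colshear_E[OF step.prems(2)])
  then obtain f' where f': "has_fubini_integral has_E_integral f' c" "\<forall>x. lift0 ?f (A *v x) = lift0 f' x"
    using step.IH[OF G] by blast
  have "lift0 f ((colshear i s ** A) *v x) = lift0 f' x" for x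
    using lift0_colshear[of s f i "A *v x", OF step.hyps(2)] f'(2) by (simp add: matrix_vector_mul_assoc)
  with f'(1) show ?case by blast
qed

text \<open>
The integrality condition is imposed only on the variables of the list, since the others have been integrated out and may take any value.
\<close>

lemma has_iterated_integral_lift0:
  fixes f :: "'k::{field,finite} E ^ 'i::finite \<Rightarrow> complex"
  shows "has_iterated_integral has_E_integral l f c \<Longrightarrow> distinct l \<Longrightarrow>
    has_iterated_integral has_F_integral l
      (\<lambda>x. if \<forall>i\<in>set l. x $ i \<in> ring_O1 then fls_const (f (\<chi> i. red_t (x $ i))) else 0) (fls_const c)"
proof (induction l arbitrary: f)
  case (Cons i l)
  then obtain h where h: "\<forall>x. has_E_integral (\<lambda>y. f (vec_upd x i y)) (h x)"
    "has_iterated_integral has_E_integral l h c" by auto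
  have nin: "i \<notin> set l" "distinct l" using Cons.prems by auto
  let ?h = "\<lambda>x. if \<forall>i\<in>set l. x $ i \<in> ring_O1 then fls_const (h (\<chi> i. red_t (x $ i))) else 0"
  let ?g = "\<lambda>x. if \<forall>i\<in>set (i # l). x $ i \<in> ring_O1 then fls_const (f (\<chi> i. red_t (x $ i))) else 0"
  have "has_F_integral (\<lambda>y. ?g (vec_upd x i y)) (?h x)" for x
  proof (cases "\<forall>i\<in>set l. x $ i \<in> ring_O1")
    case True
    let ?x = "\<chi> i. red_t (x $ i)"
    have eq: "(\<chi> j. red_t (if j = i then y else x $ j)) = vec_upd ?x i (red_t y)" for y
      by (simp add: vec_eq_iff)
    have "?g (vec_upd x i y) = lift1 (\<lambda>y. f (vec_upd ?x i y)) 0 0 y" for y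
    proof -
      have "(\<forall>j\<in>set (i # l). (vec_upd x i y) $ j \<in> ring_O1) \<longleftrightarrow> y \<in> ring_O1"
        using True nin by auto
      then show ?thesis by (simp add: lift1_def eq)
    qed
    moreover have "has_F_integral (lift1 (\<lambda>y. f (vec_upd ?x i y)) 0 0) (fls_X powi 0 * fls_const (h ?x))"
      by (rule has_F_integral_lift1) (use h in blast)
    moreover have "?h x = fls_X powi 0 * fls_const (h ?x)" using True by simp
    ultimately show ?thesis by (simp only:)
  next
    case False
    then have "\<not> (\<forall>j\<in>set (i # l). (vec_upd x i y) $ j \<in> ring_O1)" for y using nin by auto
    then show ?thesis using False has_F_integral.zero by (simp only: if_False)
  qed
  moreover have "has_iterated_integral has_F_integral l ?h (fls_const c)"
    using Cons.IH[OF h(2) nin(2)] .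
  ultimately show ?case unfolding has_iterated_integral.simps by (intro exI[of _ ?h]) (simp only: simp_thms)
qed simp

lemma later_only_tri:
  fixes T :: "'a::comm_ring_1 ^ 'i ^ 'i::finite"
  shows "tri l T \<Longrightarrow> later_only l (\<lambda>j x. (\<Sum>k\<in>UNIV - {j}. T $ j $ k * x $ k) + b $ j)"
proof (induction l)
  case (Cons i l)
  have "(\<Sum>k\<in>UNIV - {j}. T $ j $ k * (vec_upd x i y) $ k) = (\<Sum>k\<in>UNIV - {j}. T $ j $ k * x $ k)"
    if "j \<in> set (i # l)" for j x y
    by (rule sum.cong) (use that Cons.prems in auto)
  then show ?case using Cons by simp
qed simp

lemma abs_F_prod: "finite S \<Longrightarrow> (\<And>j. j \<in> S \<Longrightarrow> d j \<noteq> 0) \<Longrightarrow> abs_F (\<Prod>j\<in>S. d j) = (\<Prod>j\<in>S. abs_F (d j))"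
  by (induction rule: finite_induct) (simp_all add: abs_F_mult)

text \<open>
The factorization \<open>\<tau> = A T\<close> depends on the order of integration, but the resulting value does not: \<open>A\<close> has determinant one and
leaves the integral over \<open>E\<close> unchanged, and the diagonal of \<open>T\<close> contributes the inverse modulus of \<open>det T = det \<tau>\<close>.
\<close>

lemma has_fubini_integral_lift0_affine:
  fixes f :: "'k::{field,finite} E ^ 'i::finite \<Rightarrow> complex"
  assumes G: "GL_fubini f" and f: "has_fubini_integral has_E_integral f c"
    and \<tau>: "invertible (\<tau> :: 'k F ^ 'i ^ 'i)"
  shows "has_fubini_integral has_F_integral (\<lambda>x. lift0 f (\<tau> *v x + a)) (inverse (abs_F (det \<tau>)) * fls_const c)"
  unfolding has_fubini_integral_def
proof (intro allI impI)
  fix l :: "'i list" assume l: "distinct l \<and> set l = UNIV"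
  obtain A T where A: "A \<in> shears fls_integers (set l)" and AT: "\<tau> = A ** T" and T: "tri l T"
    using shears_triangular_decomposition[of l \<tau>] l by blast
  have "invertible A" using det_shears[OF A] by (simp add: invertible_det_nz)
  then obtain B where B: "A ** B = mat 1" unfolding invertible_def by blast
  define b where "b = B *v a"
  have Ab: "A *v b = a" by (simp add: b_def matrix_vector_mul_assoc B)
  obtain f' where f': "has_fubini_integral has_E_integral f' c" "\<And>x. lift0 f (A *v x) = lift0 f' x"
    using lift0_shears[OF A[unfolded integral_F] G f] by blast
  let ?h = "\<lambda>j x. (\<Sum>k\<in>UNIV - {j}. T $ j $ k * x $ k) + b $ j"
  have det: "det \<tau> = (\<Prod>j\<in>UNIV. T $ j $ j)"
    using l by (simp add: AT det_mul det_shears[OF A] det_tri[OF T])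
  have nz: "T $ j $ j \<noteq> 0" for j
    using \<tau> unfolding invertible_det_nz det by (simp add: prod_zero_iff)
  have "has_iterated_integral has_E_integral l f' c"
    using f'(1) l unfolding has_fubini_integral_def by blast
  from has_iterated_integral_lift0[OF this] l
  have "has_iterated_integral has_F_integral l (lift0 f') (fls_const c)"
    unfolding lift0_def by simp
  then have "has_iterated_integral has_F_integral l
      (\<lambda>x. lift0 f' (\<chi> j. if j \<in> set l then T $ j $ j * x $ j + ?h j x else x $ j))
      ((\<Prod>j\<in>set l. inverse (abs_F (T $ j $ j))) * fls_const c)"
  proof (rule has_iterated_integral_triangular[where D="{d. d \<noteq> 0}" and w="\<lambda>d. inverse (abs_F d)", rotated 2])
    show "later_only l ?h" using T by (rule later_only_tri)
  qed (use l nz in \<open>auto intro: has_F_integral_affine has_F_integral_scale ratfun_inverse_abs_F\<close>)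
  moreover have "lift0 f (\<tau> *v x + a) = lift0 f' (\<chi> j. if j \<in> set l then T $ j $ j * x $ j + ?h j x else x $ j)" for x
  proof -
    have "\<tau> *v x + a = A *v (T *v x + b)"
      by (simp add: AT matrix_vector_right_distrib Ab matrix_vector_mul_assoc)
    moreover have "T *v x + b = (\<chi> j. if j \<in> set l then T $ j $ j * x $ j + ?h j x else x $ j)"
    proof -
      have "(T *v x) $ j = T $ j $ j * x $ j + (\<Sum>k\<in>UNIV - {j}. T $ j $ k * x $ k)" for j
        unfolding matrix_vector_mult_def by (simp add: sum.remove[of UNIV j])
      then show ?thesis using l by (simp add: vec_eq_iff add.assoc)
    qed
    ultimately show ?thesis using f'(2) by simp
  qed
  moreover have "(\<Prod>j\<in>set l. inverse (abs_F (T $ j $ j))) = inverse (abs_F (det \<tau>))"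
    using l nz prod_inversef[of "\<lambda>j. abs_F (T $ j $ j)" UNIV] unfolding det by (simp add: abs_F_prod comp_def)
  ultimately show "has_iterated_integral has_F_integral l (\<lambda>x. lift0 f (\<tau> *v x + a)) (inverse (abs_F (det \<tau>)) * fls_const c)"
    by (simp only:)
qed

section \<open>Change of variables and translation invariance\<close>

lemma invertible_mat_1: "invertible (mat 1 :: 'a::semiring_1 ^ 'i ^ 'i::finite)"
  unfolding invertible_def by (rule exI[of _ "mat 1"]) simp

lemma par_t_powi: "par_t powi n = fls_shift (- n) (1 :: 'k::{field,finite} F)"
  by (simp add: par_t_def)

lemma par_t_nonzero [simp]: "par_t \<noteq> 0"
  by (simp add: par_t_def)

lemma abs_F_par_t_powi: "abs_F (par_t powi n :: 'k::{field,finite} F) = fls_X powi n"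
proof -
  have sd: "fls_subdegree (par_t powi n :: 'k F) = n" unfolding par_t_powi by simp
  have "fls_nth (par_t powi n :: 'k F) n = 1" unfolding par_t_powi by simp
  then show ?thesis unfolding abs_F_eq sd by simp
qed

lemma prod_powi: "finite S \<Longrightarrow> x \<noteq> 0 \<Longrightarrow> (\<Prod>i\<in>S. x powi (g i)) = (x :: 'a::field) powi (\<Sum>i\<in>S. g i)"
  by (induction rule: finite_induct) (simp_all add: power_int_add)

text \<open>
The substitution that turns a lift of level \<open>\<gamma>\<close> into a lift of level \<open>0\<close>.
\<close>

definition dilation :: "int ^ 'i \<Rightarrow> 'k::{field,finite} F ^ 'i ^ 'i::finite" where
  "dilation \<gamma> = (\<chi> a b. if a = b then par_t powi (- \<gamma> $ a) else 0)"

lemma dilation_vec: "(dilation \<gamma> *v x) $ a = par_t powi (- \<gamma> $ a) * x $ a"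
proof -
  have "(dilation \<gamma> *v x) $ a = (\<Sum>b\<in>UNIV. if b = a then par_t powi (- \<gamma> $ a) * x $ a else 0)"
    unfolding matrix_vector_mult_def dilation_def vec_lambda_beta by (rule sum.cong) auto
  then show ?thesis by simp
qed

lemma det_dilation: "det (dilation \<gamma> :: 'k::{field,finite} F ^ 'i ^ 'i::finite) = par_t powi (- (\<Sum>i\<in>UNIV. \<gamma> $ i))"
proof -
  have "det (dilation \<gamma> :: 'k F ^ 'i ^ 'i) = (\<Prod>a\<in>UNIV. dilation \<gamma> $ a $ a)"
    by (rule det_triangular_rank[of _ "\<lambda>_. 0"]) (simp add: dilation_def)
  also have "\<dots> = par_t powi (\<Sum>a\<in>UNIV. - \<gamma> $ a)"
    by (simp add: dilation_def prod_powi)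
  finally show ?thesis by (simp add: sum_negf)
qed

lemma lift_linear_lift0:
  "lift f a \<gamma> (\<tau> *v x) = lift0 f ((dilation \<gamma> ** \<tau>) *v x + - (dilation \<gamma> *v a))"
  unfolding lift_eq_lift0
  by (rule arg_cong[where f = "lift0 f"])
    (simp add: vec_eq_iff dilation_vec algebra_simps flip: matrix_vector_mul_assoc)

lemma has_fubini_integral_lift:
  fixes f :: "'k::{field,finite} E ^ 'i::finite \<Rightarrow> complex"
  assumes G: "GL_fubini f" and f: "has_fubini_integral has_E_integral f c"
    and \<tau>: "invertible (\<tau> :: 'k F ^ 'i ^ 'i)"
  shows "has_fubini_integral has_F_integral (\<lambda>x. lift f a \<gamma> (\<tau> *v x))
     (inverse (abs_F (det \<tau>)) * (fls_X powi (\<Sum>i\<in>UNIV. \<gamma> $ i) * fls_const c))"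
proof -
  have d: "det (dilation \<gamma> :: 'k F ^ 'i ^ 'i) \<noteq> 0" by (simp add: det_dilation)
  have t: "det \<tau> \<noteq> 0" using \<tau> by (simp add: invertible_det_nz)
  have inv: "invertible (dilation \<gamma> ** \<tau>)" using d t by (simp add: invertible_det_nz det_mul)
  have "inverse (abs_F (det (dilation \<gamma> ** \<tau>))) = inverse (abs_F (det \<tau>)) * fls_X powi (\<Sum>i\<in>UNIV. \<gamma> $ i)"
    unfolding det_mul abs_F_mult[OF d t] unfolding det_dilation abs_F_par_t_powi
    by (simp add: power_int_minus del: fls_X_power_int)
  then show ?thesis
    using has_fubini_integral_lift0_affine[OF G f inv, of "- (dilation \<gamma> *v a)"]
    unfolding lift_linear_lift0 by (simp only: mult.assoc)
qed

lemma has_F_integral_linear: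
  "r \<in> ratfun \<Longrightarrow> has_F_integral g c \<Longrightarrow> has_F_integral g' c' \<Longrightarrow> has_F_integral (\<lambda>y. r * g y + g' y) (r * c + c')"
  by (intro has_F_integral_add has_F_integral_scale)

lemma has_fubini_integral_linear_F:
  "r \<in> ratfun \<Longrightarrow> has_fubini_integral has_F_integral f c \<Longrightarrow> has_fubini_integral has_F_integral g d \<Longrightarrow>
   has_fubini_integral has_F_integral (\<lambda>x. r * f x + g x) (r * c + d)"
  by (rule has_fubini_integral_linear[where H = has_F_integral]) (auto intro: has_F_integral_linear)

lemma has_fubini_integral_F_unique:
  "has_fubini_integral has_F_integral f c \<Longrightarrow> has_fubini_integral has_F_integral f c' \<Longrightarrow> c = c'"
  by (rule has_fubini_integral_unique[where H = has_F_integral]) (auto intro: has_F_integral_unique)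

lemma has_fubini_integral_F_0: "has_fubini_integral has_F_integral (\<lambda>x. 0) 0"
proof -
  have "has_iterated_integral has_F_integral l (\<lambda>x. 0) 0" for l :: "'i::finite list"
    by (induction l) (auto intro!: exI[of _ "\<lambda>_. 0"] has_F_integral.zero)
  then show ?thesis unfolding has_fubini_integral_def by blast
qed

lemma GL_fubini_imp_fubini: "GL_fubini f \<Longrightarrow> \<exists>c. has_fubini_integral has_E_integral f c"
proof -
  assume "GL_fubini f"
  then have "fubini has_E_integral (\<lambda>x. f (mat 1 *v x))"
    unfolding GL_fubini_def using invertible_mat_1 by blast
  then show ?thesis unfolding fubini_def by simp
qed

text \<open>
The constant \<open>I\<close> is common to all \<open>\<sigma>\<close>; for \<open>\<sigma> = 1\<close> it is the integral of \<open>f\<close>.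
\<close>

lemma morrow_class_change_of_variables:
  fixes f :: "'k::{field,finite} F ^ 'i::finite \<Rightarrow> complex fls"
  shows "f \<in> morrow_class \<Longrightarrow> \<exists>I. \<forall>\<sigma>. invertible \<sigma> \<longrightarrow>
    has_fubini_integral has_F_integral (\<lambda>x. f (\<sigma> *v x)) (inverse (abs_F (det \<sigma>)) * I)"
proof (induction rule: morrow_class.induct)
  case zero
  show ?case by (intro exI[of _ 0]) (simp add: has_fubini_integral_F_0)
next
  case (step c f \<tau> g a \<gamma>)
  obtain I where I: "\<And>\<sigma>. invertible \<sigma> \<Longrightarrow>
    has_fubini_integral has_F_integral (\<lambda>x. g (\<sigma> *v x)) (inverse (abs_F (det \<sigma>)) * I)" using step.IH by blast
  obtain z where z: "has_fubini_integral has_E_integral f z"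
    using GL_fubini_imp_fubini[OF step.hyps(2)] by blast
  let ?V = "fls_X powi (\<Sum>i\<in>UNIV. \<gamma> $ i) * fls_const z"
  let ?I = "c * (inverse (abs_F (det \<tau>)) * ?V) + I"
  show ?case
  proof (intro exI[of _ ?I] allI impI)
    fix \<sigma> :: "'k F ^ 'i ^ 'i" assume \<sigma>: "invertible \<sigma>"
    have inv: "invertible (\<tau> ** \<sigma>)" using step.hyps(3) \<sigma> by (rule invertible_mult)
    have nz: "det \<tau> \<noteq> 0" "det \<sigma> \<noteq> 0" using step.hyps(3) \<sigma> by (simp_all add: invertible_det_nz)
    have "has_fubini_integral has_F_integral (\<lambda>x. c * lift f a \<gamma> ((\<tau> ** \<sigma>) *v x) + g (\<sigma> *v x))
       (c * (inverse (abs_F (det (\<tau> ** \<sigma>))) * ?V) + inverse (abs_F (det \<sigma>)) * I)"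
      by (rule has_fubini_integral_linear_F[OF step.hyps(1) has_fubini_integral_lift[OF step.hyps(2) z inv] I[OF \<sigma>]])
    moreover have "c * (inverse (abs_F (det (\<tau> ** \<sigma>))) * ?V) + inverse (abs_F (det \<sigma>)) * I = inverse (abs_F (det \<sigma>)) * ?I"
      unfolding det_mul abs_F_mult[OF nz] by (simp add: algebra_simps del: fls_X_power_int)
    ultimately show "has_fubini_integral has_F_integral (\<lambda>x. c * lift f a \<gamma> (\<tau> *v (\<sigma> *v x)) + g (\<sigma> *v x))
       (inverse (abs_F (det \<sigma>)) * ?I)"
      by (simp only: matrix_vector_mul_assoc)
  qed
qed

lemma morrow_class_compose:
  fixes f :: "'k::{field,finite} F ^ 'i::finite \<Rightarrow> complex fls"
  assumes \<sigma>: "invertible (\<sigma> :: 'k F ^ 'i ^ 'i)"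
  shows "f \<in> morrow_class \<Longrightarrow> (\<lambda>x. f (\<sigma> *v x)) \<in> morrow_class"
proof (induction rule: morrow_class.induct)
  case (step c f \<tau> g a \<gamma>)
  have "(\<lambda>x. c * lift f a \<gamma> ((\<tau> ** \<sigma>) *v x) + g (\<sigma> *v x)) \<in> morrow_class"
    by (rule morrow_class.step[OF step.hyps(1,2) invertible_mult[OF step.hyps(3) \<sigma>] step.IH])
  then show ?case by (simp only: matrix_vector_mul_assoc)
qed (rule morrow_class.zero)

lemma morrow_class_scale: "f \<in> morrow_class \<Longrightarrow> r \<in> ratfun \<Longrightarrow> (\<lambda>x. r * f x) \<in> morrow_class"
proof (induction rule: morrow_class.induct)
  case (step c f \<tau> g a \<gamma>)
  have "(\<lambda>x. (r * c) * lift f a \<gamma> (\<tau> *v x) + r * g x) \<in> morrow_class"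
    using step by (intro morrow_class.step ratfun_mult)
  then show ?case by (simp only: distrib_left mult.assoc)
qed (simp add: morrow_class.zero)

lemma morrow_class_add: "f \<in> morrow_class \<Longrightarrow> g \<in> morrow_class \<Longrightarrow> (\<lambda>x. f x + g x) \<in> morrow_class"
proof (induction rule: morrow_class.induct)
  case (step c f \<tau> h a \<gamma>)
  have "(\<lambda>x. c * lift f a \<gamma> (\<tau> *v x) + (h x + g x)) \<in> morrow_class"
    using step by (intro morrow_class.step)
  then show ?case by (simp only: add.assoc)
qed simp

lemma morrow_class_lift:
  assumes "GL_fubini f"
  shows "lift f a \<gamma> \<in> morrow_class"
proof -
  have "(\<lambda>x. 1 * lift f a \<gamma> (mat 1 *v x) + 0) \<in> morrow_class"
    using assms by (intro morrow_class.step ratfun_1 morrow_class.zero invertible_mat_1)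
  then show ?thesis by simp
qed

text \<open>
A perturbation by multiples of \<open>t\<close> changes neither integrality nor the reduction.
\<close>

lemma lift0_locally_constant:
  assumes y: "\<And>i. \<forall>n<1. fls_nth (y $ i) n = 0"
  shows "lift0 f (x + y) = lift0 f x"
proof -
  have "(x + y) $ i \<in> ring_O1 \<longleftrightarrow> x $ i \<in> ring_O1" for i
    using y[of i] by (auto simp: ring_O1_iff)
  moreover have "red_t ((x + y) $ i) = red_t (x $ i)" for i
    using y[of i] by (simp add: red_t_def)
  ultimately show ?thesis by (simp add: lift0_def del: vector_add_component)
qed

text \<open>
A linear map lowers valuations by a bounded amount.
\<close>

lemma matrix_vector_mult_cyl:
  fixes B :: "'a::field fls ^ 'j ^ 'i::finite"
  shows "\<exists>L. \<forall>m y. (\<forall>i. y $ i \<in> cyl 0 m) \<longrightarrow> (\<forall>i. (B *v y) $ i \<in> cyl 0 (m - L))"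
proof -
  define L where "L = (\<Sum>p\<in>UNIV. \<bar>fls_subdegree (B $ fst p $ snd p)\<bar>)"
  have L: "- L \<le> fls_subdegree (B $ i $ j)" for i j
  proof -
    have "\<bar>fls_subdegree (B $ fst (i, j) $ snd (i, j))\<bar> \<le> L"
      unfolding L_def by (rule member_le_sum) auto
    then show ?thesis by simp
  qed
  have "fls_nth ((B *v y) $ i) n = 0" if y: "\<forall>i. y $ i \<in> cyl 0 m" and n: "n < m - L" for m y i n
  proof -
    have "fls_nth (B $ i $ j * y $ j) n = 0" for j
      by (rule fls_nth_mult_zero_below[where m = "- L" and l = m]) (use L y n in \<open>auto simp: cyl_def\<close>)
    then show ?thesis unfolding matrix_vector_mult_def by (simp add: fls_nth_sum)
  qed
  then have "\<forall>m y. (\<forall>i. y $ i \<in> cyl 0 m) \<longrightarrow> (\<forall>i. (B *v y) $ i \<in> cyl 0 (m - L))"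
    by (simp add: cyl_def)
  then show ?thesis by (rule exI)
qed

lemma morrow_class_locally_constant:
  fixes f :: "'k::{field,finite} F ^ 'i::finite \<Rightarrow> complex fls"
  shows "f \<in> morrow_class \<Longrightarrow> \<exists>M. \<forall>x y. (\<forall>i. \<forall>n<M. fls_nth (y $ i) n = 0) \<longrightarrow> f (x + y) = f x"
proof (induction rule: morrow_class.induct)
  case (step c f \<tau> g a \<gamma>)
  obtain M where M: "\<And>x y. (\<forall>i. \<forall>n<M. fls_nth (y $ i) n = 0) \<Longrightarrow> g (x + y) = g x"
    using step.IH by blast
  let ?B = "dilation \<gamma> ** \<tau>"
  obtain L where L: "\<And>m y. (\<forall>i. y $ i \<in> cyl 0 m) \<Longrightarrow> \<forall>i. (?B *v y) $ i \<in> cyl 0 (m - L)"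
    using matrix_vector_mult_cyl[of ?B] by blast
  show ?case
  \<comment> \<open>A vector divisible by \<open>t\<^sup>1\<^sup>+\<^sup>L\<close> is mapped by \<open>?B\<close> to a vector divisible by \<open>t\<close>.\<close>
  proof (intro exI[of _ "max M (1 + L)"] allI impI)
    fix x y :: "'k F ^ 'i" assume y: "\<forall>i. \<forall>n<max M (1 + L). fls_nth (y $ i) n = 0"
    then have "\<forall>i. (?B *v y) $ i \<in> cyl 0 (1 + L - L)" by (intro L) (simp add: cyl_def)
    then have "\<forall>n<1. fls_nth ((?B *v y) $ i) n = 0" for i by (simp add: cyl_def)
    then have "lift0 f ((?B *v x + - (dilation \<gamma> *v a)) + ?B *v y) = lift0 f (?B *v x + - (dilation \<gamma> *v a))"
      by (intro lift0_locally_constant) blast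
    then have "lift f a \<gamma> (\<tau> *v (x + y)) = lift f a \<gamma> (\<tau> *v x)"
      unfolding lift_linear_lift0 by (simp only: matrix_vector_right_distrib ac_simps)
    moreover have "g (x + y) = g x" using y by (intro M) auto
    ultimately show "c * lift f a \<gamma> (\<tau> *v (x + y)) + g (x + y) = c * lift f a \<gamma> (\<tau> *v x) + g x" by simp
  qed
qed simp

text \<open>
Write \<open>x = A T\<close> and replace the zeros on the diagonal of \<open>T\<close> by \<open>t\<^sup>M\<close>. The factor \<open>A\<close> has integral entries, so the perturbation
\<open>A ** D\<close> is still divisible by \<open>t\<^sup>M\<close>.
\<close>

lemma GLn_dense:
  fixes x :: "'k::{field,finite} F ^ 'n ^ 'n::finite"
  shows "\<exists>y. (\<forall>i j. \<forall>n<M. fls_nth (y $ i $ j) n = 0) \<and> invertible (x + y)"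
proof -
  obtain l :: "'n list" where l: "distinct l" "set l = UNIV"
    using finite_distinct_list[OF finite] by blast
  obtain A T where A: "A \<in> shears fls_integers (set l)" and x: "x = A ** T" and T: "tri l T"
    using shears_triangular_decomposition[OF l(1)] by blast
  define D :: "'k F ^ 'n ^ 'n" where "D = (\<chi> a b. if a = b \<and> T $ a $ a = 0 then par_t powi M else 0)"
  have DT: "tri m (T + D)" if "tri m T" "distinct m" for m
    using that by (induction m) (auto simp: D_def)
  have "det (A ** (T + D)) = (\<Prod>a\<in>UNIV. (T + D) $ a $ a)"
    using det_tri[OF DT[OF T l(1)] l(2)] by (simp add: det_mul det_shears[OF A])
  also have "\<dots> \<noteq> 0"
    by (subst prod_zero_iff) (auto simp: D_def)
  finally have "invertible (x + A ** D)"
    by (simp add: x invertible_det_nz matrix_add_ldistrib)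
  moreover have "fls_nth ((A ** D) $ i $ j) n = 0" if "n < M" for i j n
  proof -
    have "fls_nth (A $ i $ k * D $ k $ j) n = 0" for k
    proof (rule fls_nth_mult_zero_below[where m = 0 and l = M])
      show "A $ i $ k = 0 \<or> 0 \<le> fls_subdegree (A $ i $ k)"
        using shears_integral[OF A, of i k] subdegree_ge_iff[of 0 "A $ i $ k"] by simp
      show "\<forall>n<M. fls_nth (D $ k $ j) n = 0" by (auto simp: D_def par_t_powi)
    qed (use that in simp)
    then show ?thesis by (simp add: matrix_matrix_mult_def fls_nth_sum)
  qed
  ultimately show ?thesis by blast
qed

lemma coords_nth [simp]: "(coords x) $ p = x $ fst p $ snd p"
  by (simp add: coords_def)

lemma coords_surj: "\<exists>x. coords x = v"
  by (rule exI[of _ "\<chi> i j. v $ (i, j)"]) (simp add: vec_eq_iff)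

text \<open>
Both functions are constant on small \<open>t\<close>-adic balls, and every ball contains an invertible matrix.
\<close>

lemma morrow_class_eq_on_GLn:
  fixes f g :: "'k::{field,finite} F ^ ('n::finite \<times> 'n) \<Rightarrow> complex fls"
  assumes f: "f \<in> morrow_class" and g: "g \<in> morrow_class" and eq: "\<And>\<tau>. \<tau> \<in> GLn \<Longrightarrow> f (coords \<tau>) = g (coords \<tau>)"
  shows "f = g"
proof
  fix v
  obtain x :: "'k F ^ 'n ^ 'n" where x: "coords x = v" using coords_surj by blast
  obtain M1 where M1: "\<And>x y. (\<forall>i. \<forall>n<M1. fls_nth (y $ i) n = 0) \<Longrightarrow> f (x + y) = f x"
    using morrow_class_locally_constant[OF f] by blast
  obtain M2 where M2: "\<And>x y. (\<forall>i. \<forall>n<M2. fls_nth (y $ i) n = 0) \<Longrightarrow> g (x + y) = g x"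
    using morrow_class_locally_constant[OF g] by blast
  obtain y where y: "\<And>i j n. n < max M1 M2 \<Longrightarrow> fls_nth (y $ i $ j) n = 0" and inv: "invertible (x + y)"
    using GLn_dense[of "max M1 M2" x] by blast
  have c: "coords (x + y) = v + coords y" by (simp add: vec_eq_iff flip: x)
  have "f v = f (v + coords y)" using y by (intro M1[symmetric]) simp
  also have "\<dots> = g (v + coords y)" using eq[of "x + y"] inv c by (simp add: GLn_def)
  also have "\<dots> = g v" using y by (intro M2) simp
  finally show "f v = g v" .
qed

lemma morrow_extension_unique: "morrow_extension \<phi> f \<Longrightarrow> morrow_extension \<phi> g \<Longrightarrow> f = g"
  unfolding morrow_extension_def by (intro morrow_class_eq_on_GLn) auto

lemma morrow_integral_eqI:
  assumes f: "morrow_extension \<phi> f" and I: "has_fubini_integral has_F_integral f I"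
  shows "morrow_integral \<phi> = I"
  unfolding morrow_integral_def
proof (rule the_equality)
  show "\<exists>f. morrow_extension \<phi> f \<and> has_fubini_integral has_F_integral f I" using f I by blast
next
  fix J assume "\<exists>f. morrow_extension \<phi> f \<and> has_fubini_integral has_F_integral f J"
  then obtain g where g: "morrow_extension \<phi> g" "has_fubini_integral has_F_integral g J" by blast
  then have "g = f" using morrow_extension_unique f by blast
  then show "J = I" using has_fubini_integral_F_unique g(2) I by blast
qed

lemma LG_extension:
  assumes "\<phi> \<in> LG"
  shows "\<exists>f. morrow_extension \<phi> f \<and> (\<forall>\<sigma>. invertible \<sigma> \<longrightarrow>
     has_fubini_integral has_F_integral (\<lambda>x. f (\<sigma> *v x)) (inverse (abs_F (det \<sigma>)) * morrow_integral \<phi>))"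
proof -
  obtain f where f: "morrow_extension \<phi> f" using assms by (auto simp: LG_def)
  then have "f \<in> morrow_class" by (simp add: morrow_extension_def)
  then obtain I where I: "\<And>\<sigma>. invertible \<sigma> \<Longrightarrow>
     has_fubini_integral has_F_integral (\<lambda>x. f (\<sigma> *v x)) (inverse (abs_F (det \<sigma>)) * I)"
    using morrow_class_change_of_variables by blast
  have "has_fubini_integral has_F_integral f I" using I[OF invertible_mat_1] by simp
  then have "morrow_integral \<phi> = I" by (rule morrow_integral_eqI[OF f])
  with I f show ?thesis by blast
qed

lemma LG_linear:
  fixes \<phi> \<psi> :: "('k::{field,finite}, 'n::finite) matF \<Rightarrow> complex fls"
  assumes "\<phi> \<in> LG" "\<psi> \<in> LG" "c \<in> ratfun"
  shows "(\<lambda>x. c * \<phi> x + \<psi> x) \<in> LG \<and> mu (\<lambda>x. c * \<phi> x + \<psi> x) = c * mu \<phi> + mu \<psi>"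
proof -
  obtain f where f: "morrow_extension \<phi> f" and fI: "\<And>\<sigma>. invertible \<sigma> \<Longrightarrow>
     has_fubini_integral has_F_integral (\<lambda>x. f (\<sigma> *v x)) (inverse (abs_F (det \<sigma>)) * morrow_integral \<phi>)"
    using LG_extension[OF assms(1)] by blast
  obtain g where g: "morrow_extension \<psi> g" and gI: "\<And>\<sigma>. invertible \<sigma> \<Longrightarrow>
     has_fubini_integral has_F_integral (\<lambda>x. g (\<sigma> *v x)) (inverse (abs_F (det \<sigma>)) * morrow_integral \<psi>)"
    using LG_extension[OF assms(2)] by blast
  have ext: "morrow_extension (\<lambda>x. c * \<phi> x + \<psi> x) (\<lambda>x. c * f x + g x)"
    using f g assms(3) unfolding morrow_extension_def
    by (simp add: morrow_class_add morrow_class_scale distrib_right mult.assoc)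
  have "has_fubini_integral has_F_integral (\<lambda>x. c * f x + g x) (c * morrow_integral \<phi> + morrow_integral \<psi>)"
    using has_fubini_integral_linear_F[OF assms(3) fI[OF invertible_mat_1] gI[OF invertible_mat_1]] by simp
  from morrow_integral_eqI[OF ext this] show ?thesis
    using ext by (auto simp: LG_def mu_def algebra_simps)
qed

text \<open>
The substitution \<open>M\<close> scales the integral over \<open>M\<^sub>n(F)\<close> by the inverse modulus of \<open>d\<^sup>n\<close>, and the extension of the transformed
function carries the inverse factor because \<open>det (R x) = d det x\<close>.
\<close>

lemma LG_transform:
  fixes \<phi> :: "('k::{field,finite}, 'n::finite) matF \<Rightarrow> complex fls" and M :: "'k F ^ ('n \<times> 'n) ^ ('n \<times> 'n)"
  assumes \<phi>: "\<phi> \<in> LG" and d: "d \<noteq> 0"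
    and R: "\<And>x. coords (R x) = M *v coords x" and detR: "\<And>x. det (R x) = d * det x" and detM: "det M = d ^ CARD('n)"
  shows "(\<lambda>x. \<phi> (R x)) \<in> LG \<and> mu (\<lambda>x. \<phi> (R x)) = mu \<phi>"
proof -
  obtain f where f: "morrow_extension \<phi> f" and fI: "\<And>\<sigma>. invertible \<sigma> \<Longrightarrow>
     has_fubini_integral has_F_integral (\<lambda>x. f (\<sigma> *v x)) (inverse (abs_F (det \<sigma>)) * morrow_integral \<phi>)"
    using LG_extension[OF \<phi>] by blast
  let ?n = "int CARD('n)"
  let ?r = "abs_F d powi ?n"
  have M: "invertible M" using d detM by (simp add: invertible_det_nz)
  have r: "?r \<in> ratfun" by (rule ratfun_abs_F_powi)
  have "abs_F (det M) = ?r"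
    unfolding detM using abs_F_prod[of "UNIV :: 'n set" "\<lambda>_. d"] d by simp
  then have rn: "?r * inverse (abs_F (det M)) = 1" by simp
  have ext: "morrow_extension (\<lambda>x. \<phi> (R x)) (\<lambda>x. ?r * f (M *v x))"
    unfolding morrow_extension_def
  proof (intro conjI ballI)
    show "(\<lambda>x. ?r * f (M *v x)) \<in> morrow_class"
      using f unfolding morrow_extension_def by (intro morrow_class_scale[OF _ r] morrow_class_compose[OF M]) blast
    fix \<tau> :: "('k, 'n) matF" assume \<tau>: "\<tau> \<in> GLn"
    have dt: "det \<tau> \<noteq> 0" using \<tau> by (simp add: GLn_def invertible_det_nz)
    then have "R \<tau> \<in> GLn" using d by (simp add: GLn_def invertible_det_nz detR)
    then have "f (M *v coords \<tau>) = \<phi> (R \<tau>) * abs_F (det (R \<tau>)) powi (- ?n)"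
      using f unfolding morrow_extension_def R[symmetric] by blast
    also have "abs_F (det (R \<tau>)) powi (- ?n) = abs_F d powi (- ?n) * abs_F (det \<tau>) powi (- ?n)"
      unfolding detR abs_F_mult[OF d dt] by (rule power_int_mult_distrib)
    finally show "?r * f (M *v coords \<tau>) = \<phi> (R \<tau>) * abs_F (det \<tau>) powi (- ?n)"
      by (simp add: power_int_minus field_simps)
  qed
  have "has_fubini_integral has_F_integral (\<lambda>x. ?r * f (M *v x) + 0) (?r * (inverse (abs_F (det M)) * morrow_integral \<phi>) + 0)"
    by (rule has_fubini_integral_linear_F[OF r fI[OF M] has_fubini_integral_F_0])
  then have "has_fubini_integral has_F_integral (\<lambda>x. ?r * f (M *v x)) (morrow_integral \<phi>)"
    unfolding mult.assoc[symmetric] rn by simp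
  from morrow_integral_eqI[OF ext this] show ?thesis
    using ext by (auto simp: LG_def mu_def)
qed

lemma coords_mult_left: "coords (g ** x) = fiberwise fst snd g *v coords x"
proof -
  have "(\<Sum>q\<in>UNIV. (if snd p = snd q then g $ fst p $ fst q else 0) * x $ fst q $ snd q)
     = (\<Sum>k\<in>UNIV. g $ fst p $ k * x $ k $ snd p)" for p
  proof -
    have "(\<Sum>q\<in>UNIV. (if snd p = snd q then g $ fst p $ fst q else 0) * x $ fst q $ snd q)
      = (\<Sum>(k, b)\<in>UNIV \<times> UNIV. if b = snd p then g $ fst p $ k * x $ k $ b else 0)"
      unfolding UNIV_Times_UNIV by (rule sum.cong) auto
    also have "\<dots> = (\<Sum>k\<in>UNIV. \<Sum>b\<in>UNIV. if b = snd p then g $ fst p $ k * x $ k $ b else 0)"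
      by (rule sum.cartesian_product[symmetric])
    finally show ?thesis by simp
  qed
  then have "(coords (g ** x)) $ p = (fiberwise fst snd g *v coords x) $ p" for p
    unfolding coords_nth fiberwise_def matrix_vector_mult_def matrix_matrix_mult_def vec_lambda_beta by (simp only:)
  then show ?thesis by (rule vec_eq_iff[THEN iffD2, OF allI])
qed

lemma coords_mult_right: "coords (x ** g) = fiberwise snd fst (transpose g) *v coords x"
proof -
  have "(\<Sum>q\<in>UNIV. (if fst p = fst q then g $ snd q $ snd p else 0) * x $ fst q $ snd q)
     = (\<Sum>k\<in>UNIV. x $ fst p $ k * g $ k $ snd p)" for p
  proof -
    have "(\<Sum>q\<in>UNIV. (if fst p = fst q then g $ snd q $ snd p else 0) * x $ fst q $ snd q)
      = (\<Sum>(b, k)\<in>UNIV \<times> UNIV. if b = fst p then x $ b $ k * g $ k $ snd p else 0)"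
      unfolding UNIV_Times_UNIV by (rule sum.cong) auto
    also have "\<dots> = (\<Sum>k\<in>UNIV. \<Sum>b\<in>UNIV. if b = fst p then x $ b $ k * g $ k $ snd p else 0)"
      by (subst sum.cartesian_product[symmetric]) (rule sum.swap)
    finally show ?thesis by simp
  qed
  then have "(coords (x ** g)) $ p = (fiberwise snd fst (transpose g) *v coords x) $ p" for p
    unfolding coords_nth fiberwise_def matrix_vector_mult_def matrix_matrix_mult_def transpose_def vec_lambda_beta
    by (simp only:)
  then show ?thesis by (rule vec_eq_iff[THEN iffD2, OF allI])
qed

lemma LG_translate:
  fixes \<phi> :: "('k::{field,finite}, 'n::finite) matF \<Rightarrow> complex fls"
  assumes \<phi>: "\<phi> \<in> LG" and g: "g \<in> GLn"
  shows "(\<lambda>x. \<phi> (g ** x)) \<in> LG \<and> mu (\<lambda>x. \<phi> (g ** x)) = mu \<phi>"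
    and "(\<lambda>x. \<phi> (x ** g)) \<in> LG \<and> mu (\<lambda>x. \<phi> (x ** g)) = mu \<phi>"
proof -
  have d: "det g \<noteq> 0" using g by (simp add: GLn_def invertible_det_nz)
  show "(\<lambda>x. \<phi> (g ** x)) \<in> LG \<and> mu (\<lambda>x. \<phi> (g ** x)) = mu \<phi>"
    by (rule LG_transform[OF \<phi> d coords_mult_left])
      (simp_all add: det_mul det_fiberwise bij_def inj_def surj_def)
  show "(\<lambda>x. \<phi> (x ** g)) \<in> LG \<and> mu (\<lambda>x. \<phi> (x ** g)) = mu \<phi>"
    by (rule LG_transform[OF \<phi> d coords_mult_right])
      (simp_all add: det_mul det_fiberwise bij_def inj_def surj_def mult.commute)
qed

section \<open>Counting invertible matrices over a finite field\<close>

text \<open>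
The determinant is a polynomial in the entries, so it commutes with a map that is a ring homomorphism on a subring containing them.
\<close>

lemma det_hom_on:
  fixes h :: "'a::comm_ring_1 \<Rightarrow> 'b::comm_ring_1" and x :: "'a ^ 'n ^ 'n::finite"
  assumes R: "0 \<in> R" "1 \<in> R" "\<And>a b. a \<in> R \<Longrightarrow> b \<in> R \<Longrightarrow> a + b \<in> R"
    "\<And>a b. a \<in> R \<Longrightarrow> b \<in> R \<Longrightarrow> a * b \<in> R" "\<And>a. a \<in> R \<Longrightarrow> - a \<in> R"
    and h: "h 0 = 0" "h 1 = 1" "\<And>a b. a \<in> R \<Longrightarrow> b \<in> R \<Longrightarrow> h (a + b) = h a + h b"
    "\<And>a b. a \<in> R \<Longrightarrow> b \<in> R \<Longrightarrow> h (a * b) = h a * h b" "\<And>a. a \<in> R \<Longrightarrow> h (- a) = - h a"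
    and x: "\<And>i j. x $ i $ j \<in> R"
  shows "det x \<in> R \<and> h (det x) = det (\<chi> i j. h (x $ i $ j))"
proof -
  have pr: "(\<Prod>i\<in>S. g i) \<in> R \<and> h (\<Prod>i\<in>S. g i) = (\<Prod>i\<in>S. h (g i))"
    if "finite S" "\<And>i. g i \<in> R" for S :: "'n set" and g
    using that(1) by induction (use R h that(2) in auto)
  have sm: "(\<Sum>p\<in>S. g p) \<in> R \<and> h (\<Sum>p\<in>S. g p) = (\<Sum>p\<in>S. h (g p))"
    if "finite S" "\<And>i. g i \<in> R" for S :: "('n \<Rightarrow> 'n) set" and g
    using that(1) by induction (use R h that(2) in auto)
  have t: "of_int (sign p) * (\<Prod>i\<in>UNIV. x $ i $ p i) \<in> R \<and>
      h (of_int (sign p) * (\<Prod>i\<in>UNIV. x $ i $ p i)) = of_int (sign p) * (\<Prod>i\<in>UNIV. h (x $ i $ p i))" for p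
    using pr[of UNIV "\<lambda>i. x $ i $ p i"] R h x by (cases "evenperm p") (simp_all add: sign_def)
  show ?thesis
    unfolding det_def using sm[of "{p. p permutes UNIV}" "\<lambda>p. of_int (sign p) * (\<Prod>i\<in>UNIV. x $ i $ p i)"] t
    by simp
qed

text \<open>
Linear independence of a family, stated through coefficients, so that a family with repeated vectors is dependent.
\<close>

definition indep_family :: "'i set \<Rightarrow> ('i \<Rightarrow> 'a::field ^ 'n) \<Rightarrow> bool" where
  "indep_family S v \<longleftrightarrow> (\<forall>c. (\<Sum>i\<in>S. c i *s v i) = 0 \<longrightarrow> (\<forall>i\<in>S. c i = 0))"

lemma indep_familyD: "indep_family S v \<Longrightarrow> (\<Sum>i\<in>S. c i *s v i) = 0 \<Longrightarrow> i \<in> S \<Longrightarrow> c i = 0"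
  unfolding indep_family_def by blast

lemma indep_familyI: "(\<And>c i. (\<Sum>i\<in>S. c i *s v i) = 0 \<Longrightarrow> i \<in> S \<Longrightarrow> c i = 0) \<Longrightarrow> indep_family S v"
  unfolding indep_family_def by blast

definition span_family :: "'i set \<Rightarrow> ('i \<Rightarrow> 'a::field ^ 'n) \<Rightarrow> ('a ^ 'n) set" where
  "span_family S v = (\<lambda>c. \<Sum>i\<in>S. c i *s v i) ` (S \<rightarrow>\<^sub>E UNIV)"

lemma span_familyI: "(\<Sum>i\<in>S. c i *s v i) \<in> span_family S v"
  unfolding span_family_def by (rule image_eqI[of _ _ "restrict c S"]) (auto intro: sum.cong)

lemma card_span_family:
  fixes v :: "'i \<Rightarrow> 'a::{field,finite} ^ 'n"
  assumes "finite S" "indep_family S v"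
  shows "card (span_family S v) = CARD('a) ^ card S"
proof -
  have "inj_on (\<lambda>c. \<Sum>i\<in>S. c i *s v i) (S \<rightarrow>\<^sub>E UNIV)"
  proof (rule inj_onI)
    fix c d assume cd: "c \<in> S \<rightarrow>\<^sub>E UNIV" "d \<in> S \<rightarrow>\<^sub>E UNIV" "(\<Sum>i\<in>S. c i *s v i) = (\<Sum>i\<in>S. d i *s v i)"
    have "(\<Sum>i\<in>S. (c i - d i) *s v i) = 0"
      using cd(3) by (simp add: vec.scale_left_diff_distrib sum_subtractf)
    then have "c i - d i = 0" if "i \<in> S" for i
      using indep_familyD[OF assms(2), of "\<lambda>i. c i - d i"] that by simp
    then show "c = d" by (intro PiE_ext[OF cd(1,2)]) simp
  qed
  then show ?thesis unfolding span_family_def by (simp add: card_image card_PiE assms(1))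
qed

lemma indep_family_insert:
  assumes S: "finite S" "i \<notin> S"
  shows "indep_family (insert i S) v \<longleftrightarrow> indep_family S v \<and> v i \<notin> span_family S v"
proof
  assume L: "indep_family (insert i S) v"
  have "indep_family S v"
  proof (rule indep_familyI)
    fix c j assume c: "(\<Sum>j\<in>S. c j *s v j) = 0" and j: "j \<in> S"
    let ?c = "\<lambda>k. if k = i then 0 else c k"
    have "(\<Sum>k\<in>insert i S. ?c k *s v k) = (\<Sum>k\<in>S. ?c k *s v k)" using S by simp
    also have "\<dots> = (\<Sum>k\<in>S. c k *s v k)" using S by (intro sum.cong) auto
    finally have "(\<Sum>k\<in>insert i S. ?c k *s v k) = 0" using c by simp
    then have "?c j = 0" by (rule indep_familyD[OF L]) (use j in simp)
    then show "c j = 0" using S j by (cases "j = i") auto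
  qed
  moreover have "v i \<notin> span_family S v"
  proof
    assume "v i \<in> span_family S v"
    then obtain c where c: "v i = (\<Sum>j\<in>S. c j *s v j)" by (auto simp: span_family_def)
    let ?c = "\<lambda>k. if k = i then - 1 else c k"
    have "(\<Sum>k\<in>S. ?c k *s v k) = (\<Sum>k\<in>S. c k *s v k)" using S by (intro sum.cong) auto
    then have "(\<Sum>k\<in>insert i S. ?c k *s v k) = 0" using S c by simp
    then have "?c i = 0" by (rule indep_familyD[OF L]) simp
    then show False by simp
  qed
  ultimately show "indep_family S v \<and> v i \<notin> span_family S v" by blast
next
  assume R: "indep_family S v \<and> v i \<notin> span_family S v"
  show "indep_family (insert i S) v"
  proof (rule indep_familyI)
    fix c k assume "(\<Sum>j\<in>insert i S. c j *s v j) = 0" and k: "k \<in> insert i S"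
    then have c: "c i *s v i + (\<Sum>j\<in>S. c j *s v j) = 0" using S by simp
    have ci: "c i = 0"
    proof (rule ccontr)
      assume nz: "c i \<noteq> 0"
      have "(\<Sum>j\<in>S. (- inverse (c i) * c j) *s v j) = - inverse (c i) *s (\<Sum>j\<in>S. c j *s v j)"
        by (simp add: vec.scale_sum_right)
      also have "(\<Sum>j\<in>S. c j *s v j) = - (c i *s v i)" using c by (simp add: eq_neg_iff_add_eq_0 add.commute)
      also have "- inverse (c i) *s - (c i *s v i) = v i" using nz by simp
      finally have "v i \<in> span_family S v" using span_familyI[of "\<lambda>j. - inverse (c i) * c j" v S] by simp
      then show False using R by blast
    qed
    then have "(\<Sum>j\<in>S. c j *s v j) = 0" using c by simp
    then have "c j = 0" if "j \<in> S" for j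
      using R that indep_familyD[of S v c j] by simp
    with ci k show "c k = 0" by auto
  qed
qed

lemma indep_family_cong: "(\<And>i. i \<in> S \<Longrightarrow> v i = w i) \<Longrightarrow> indep_family S v = indep_family S w"
  unfolding indep_family_def by (simp cong: sum.cong)

lemma span_family_cong: "(\<And>i. i \<in> S \<Longrightarrow> v i = w i) \<Longrightarrow> span_family S v = span_family S w"
  unfolding span_family_def by (simp cong: sum.cong)

text \<open>
A new vector has to avoid the span of the \<open>r\<close> previous ones, which has \<open>q\<^sup>r\<close> elements.
\<close>

lemma card_indep_families:
  assumes "finite S"
  shows "card {v \<in> S \<rightarrow>\<^sub>E (UNIV :: ('a::{field,finite} ^ 'n::finite) set). indep_family S v} =
    (\<Prod>r<card S. CARD('a) ^ CARD('n) - CARD('a) ^ r)"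
  using assms
proof induction
  case empty
  show ?case by (simp add: indep_family_def)
next
  case (insert i S)
  let ?V = "UNIV :: ('a ^ 'n) set"
  let ?I = "{v \<in> S \<rightarrow>\<^sub>E ?V. indep_family S v}"
  let ?f = "\<lambda>(g, y). g(i := y)"
  let ?D = "\<lambda>g. - span_family S g"
  have g_eq: "(g(i := y))(i := undefined) = g" if "g \<in> S \<rightarrow>\<^sub>E ?V" for g y
    using that insert.hyps(2) by (auto simp: fun_eq_iff PiE_def extensional_def)
  have eqv: "indep_family (insert i S) (g(i := y)) \<longleftrightarrow> indep_family S g \<and> y \<notin> span_family S g" for g y
  proof -
    have *: "(g(i := y)) j = g j" if "j \<in> S" for j using that insert.hyps by auto
    have "indep_family S (g(i := y)) = indep_family S g" by (rule indep_family_cong) (rule *)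
    moreover have "span_family S (g(i := y)) = span_family S g" by (rule span_family_cong) (rule *)
    ultimately show ?thesis
      using indep_family_insert[OF insert.hyps, of "g(i := y)"] by simp
  qed
  have "{v \<in> insert i S \<rightarrow>\<^sub>E ?V. indep_family (insert i S) v} = ?f ` (SIGMA g:?I. ?D g)"
  proof (intro equalityI subsetI)
    fix v assume v: "v \<in> {v \<in> insert i S \<rightarrow>\<^sub>E ?V. indep_family (insert i S) v}"
    let ?g = "v(i := undefined)"
    have g: "?g \<in> S \<rightarrow>\<^sub>E ?V" using v insert.hyps(2) by (auto simp: PiE_def extensional_def)
    have e: "v = ?g(i := v i)" by simp
    then have "indep_family (insert i S) (?g(i := v i))" using v by simp
    then have "(?g, v i) \<in> (SIGMA g:?I. ?D g)" using g eqv[of ?g "v i"] by simp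
    then show "v \<in> ?f ` (SIGMA g:?I. ?D g)" by (rule image_eqI[rotated]) simp
  next
    fix v assume "v \<in> ?f ` (SIGMA g:?I. ?D g)"
    then obtain y g where v: "v = g(i := y)" "g \<in> ?I" "y \<in> ?D g" by auto
    have "v \<in> insert i S \<rightarrow>\<^sub>E ?V" using v by (auto simp: PiE_def extensional_def)
    then show "v \<in> {v \<in> insert i S \<rightarrow>\<^sub>E ?V. indep_family (insert i S) v}"
      using v eqv[of g y] by simp
  qed
  moreover have "card (?f ` (SIGMA g:?I. ?D g)) = card (SIGMA g:?I. ?D g)"
  proof (rule card_image, rule inj_onI)
    fix a b assume a: "a \<in> (SIGMA g:?I. ?D g)" and b: "b \<in> (SIGMA g:?I. ?D g)" and eq: "?f a = ?f b"
    obtain g y g' y' where ab: "a = (g, y)" "b = (g', y')" by (cases a, cases b)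
    have 1: "g(i := y) = g'(i := y')" using eq ab by simp
    have "y = y'" using fun_cong[OF 1, of i] by simp
    moreover have "g = g'"
      using g_eq[of g y] g_eq[of g' y'] a b ab 1 by simp
    ultimately show "a = b" using ab by simp
  qed
  moreover have "card (SIGMA g:?I. ?D g) = (\<Sum>g\<in>?I. card (?D g))"
  proof (rule card_SigmaI)
    show "finite ?I" using insert.hyps(1) by (intro finite_subset[of ?I "S \<rightarrow>\<^sub>E ?V"] finite_PiE) auto
  qed simp
  moreover have "card (?D g) = CARD('a) ^ CARD('n) - CARD('a) ^ card S" if "g \<in> ?I" for g
    using that insert.hyps by (simp add: Compl_eq_Diff_UNIV card_Diff_subset card_span_family)
  ultimately have "card {v \<in> insert i S \<rightarrow>\<^sub>E ?V. indep_family (insert i S) v} =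
     card ?I * (CARD('a) ^ CARD('n) - CARD('a) ^ card S)" by simp
  then show ?case using insert by simp
qed

lemma det_nonzero_iff_indep_rows: "det A \<noteq> 0 \<longleftrightarrow> indep_family UNIV (vec_nth A)" for A :: "'a::field ^ 'n ^ 'n::finite"
proof -
  have row: "row i A = A $ i" for i by (simp add: row_def vec_lambda_eta)
  have "det A \<noteq> 0 \<longleftrightarrow> (\<exists>B. A ** B = mat 1)"
    by (simp add: invertible_det_nz[symmetric] invertible_right_inverse)
  then show ?thesis
    unfolding matrix_right_invertible_independent_rows row indep_family_def by simp
qed

lemma card_GL:
  "card {A :: 'a::{field,finite} ^ 'n ^ 'n::finite. det A \<noteq> 0} = (\<Prod>r<CARD('n). CARD('a) ^ CARD('n) - CARD('a) ^ r)"
proof -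
  have "bij_betw vec_nth {A :: 'a ^ 'n ^ 'n. det A \<noteq> 0} {v \<in> UNIV \<rightarrow>\<^sub>E UNIV. indep_family UNIV v}"
    by (rule bij_betwI[of _ _ _ vec_lambda]) (auto simp: det_nonzero_iff_indep_rows vec_lambda_inverse vec_nth_inverse)
  then show ?thesis using card_indep_families[of "UNIV :: 'n set", where 'a = 'a and 'n = 'n] by (simp add: bij_betw_same_card)
qed

section \<open>Compactly supported locally constant functions on \<open>E\<^sup>N\<close>\<close>

text \<open>
Representatives of \<open>u\<^sup>A k[[u]]\<close> modulo \<open>u\<^sup>B k[[u]]\<close>.
\<close>

definition digit_window :: "int \<Rightarrow> int \<Rightarrow> 'a::zero fls set" where
  "digit_window A B = {x. \<forall>n. fls_nth x n \<noteq> 0 \<longrightarrow> A \<le> n \<and> n < B}"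

lemma digit_window_nth: "x \<in> digit_window A B \<Longrightarrow> \<not> (A \<le> n \<and> n < B) \<Longrightarrow> fls_nth x n = 0"
  unfolding digit_window_def by blast

lemma finite_digit_window: "finite (digit_window A B :: 'a::{zero,finite} fls set)"
proof -
  have "digit_window A B \<subseteq> (\<lambda>g. Abs_fls (\<lambda>n. if A \<le> n \<and> n < B then g n else (0::'a))) ` ({A..<B} \<rightarrow>\<^sub>E UNIV)"
  proof
    fix x :: "'a fls" assume x: "x \<in> digit_window A B"
    have z: "fls_nth x n = 0" if "\<not> (A \<le> n \<and> n < B)" for n
      using x that by (rule digit_window_nth)
    have "x = Abs_fls (\<lambda>n. if A \<le> n \<and> n < B then restrict (fls_nth x) {A..<B} n else 0)"
      by (intro fls_eqI, subst nth_Abs_fls_lower_bound[of A]) (auto simp: z)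
    moreover have "restrict (fls_nth x) {A..<B} \<in> {A..<B} \<rightarrow>\<^sub>E UNIV" by auto
    ultimately show "x \<in> (\<lambda>g. Abs_fls (\<lambda>n. if A \<le> n \<and> n < B then g n else 0)) ` ({A..<B} \<rightarrow>\<^sub>E UNIV)"
      by (rule image_eqI)
  qed
  then show ?thesis by (rule finite_subset) (auto intro!: finite_imageI finite_PiE)
qed

lemma has_E_integral_step:
  fixes g :: "'k::{field,finite} E \<Rightarrow> complex"
  assumes AB: "A \<le> B" and supp: "\<And>y. y \<notin> cyl 0 A \<Longrightarrow> g y = 0"
    and const: "\<And>y z. z \<in> cyl y B \<Longrightarrow> g z = g y"
  shows "has_E_integral g (of_real (real CARD('k) powi (- B)) * (\<Sum>r\<in>digit_window A B. g r))"
proof -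
  let ?R = "digit_window A B :: 'k E set"
  have "has_E_integral (\<lambda>y. \<Sum>r\<in>?R. indicator (cyl r B) y *\<^sub>R g r)
      (\<Sum>r\<in>?R. measure haar_E (cyl r B) *\<^sub>R g r)"
    by (intro has_bochner_integral_sum has_bochner_integral_indicator)
       (simp_all add: cyl_borel emeasure_haar_E_cyl)
  moreover have "(\<Sum>r\<in>?R. indicator (cyl r B) y *\<^sub>R g r) = g y" for y
  proof (cases "y \<in> cyl 0 A")
    case True
    have r: "trunc B y \<in> ?R" using True unfolding digit_window_def cyl_def by (simp add: not_less[symmetric]) blast
    have iff: "y \<in> cyl r B \<longleftrightarrow> r = trunc B y" if r: "r \<in> ?R" for r
    proof
      assume y: "y \<in> cyl r B"
      have "fls_nth r n = 0" if "\<not> n < B" for n using r that by (intro digit_window_nth) auto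
      with y show "r = trunc B y" by (intro fls_eqI) (simp add: cyl_def)
    next
      assume "r = trunc B y"
      then show "y \<in> cyl r B" by (simp add: cyl_def)
    qed
    have gt: "g (trunc B y) = g y" by (rule const) (simp add: cyl_def)
    have "(\<Sum>r\<in>?R. indicator (cyl r B) y *\<^sub>R g r) = (\<Sum>r\<in>?R. if r = trunc B y then g y else 0)"
      by (rule sum.cong) (simp_all add: iff gt indicator_def)
    then show ?thesis using r by (simp add: sum.delta[OF finite_digit_window])
  next
    case False
    have "y \<notin> cyl r B" if r: "r \<in> ?R" for r
    proof
      assume y: "y \<in> cyl r B"
      have "fls_nth y n = 0" if n: "n < A" for n
      proof -
        have "fls_nth y n = fls_nth r n" using y n AB by (simp add: cyl_def)
        moreover have "fls_nth r n = 0" using r n by (intro digit_window_nth) auto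
        ultimately show ?thesis by simp
      qed
      then show False using False by (simp add: cyl_def)
    qed
    then show ?thesis using supp[OF False] by simp
  qed
  moreover have "measure haar_E (cyl r B) = real CARD('k) powi (- B)" for r :: "'k E"
    by (simp add: measure_def emeasure_haar_E_cyl)
  ultimately show ?thesis by (simp add: scaleR_conv_of_real sum_distrib_left)
qed

text \<open>
Support in \<open>u\<^sup>A k[[u]]\<^sup>N\<close> and invariance under \<open>u\<^sup>B k[[u]]\<^sup>N\<close>. Such bounds exist for every Schwartz--Bruhat function.
\<close>

definition step_bounds :: "int \<Rightarrow> int \<Rightarrow> ('k::{field,finite} E ^ 'i::finite \<Rightarrow> complex) \<Rightarrow> bool" where
  "step_bounds A B f \<longleftrightarrow> A \<le> B \<and> (\<forall>x i. x $ i \<notin> cyl 0 A \<longrightarrow> f x = 0)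
     \<and> (\<forall>x y. (\<forall>i. y $ i \<in> cyl (x $ i) B) \<longrightarrow> f y = f x)"

text \<open>
Each integration replaces a variable by a finite sum over representatives. The result depends on the remaining variables in the same
way, so the final value is a sum over all vectors of representatives, whatever the order. Variables outside of the list are set to zero.
\<close>

lemma has_iterated_integral_step:
  fixes f :: "'k::{field,finite} E ^ 'i::finite \<Rightarrow> complex"
  assumes AB: "A \<le> B"
  defines "c \<equiv> of_real (real CARD('k) powi (- B)) :: complex"
  shows "distinct l \<Longrightarrow> (\<And>x i. i \<in> set l \<Longrightarrow> x $ i \<notin> cyl 0 A \<Longrightarrow> f x = 0) \<Longrightarrow>
    (\<And>x y. (\<forall>i\<in>set l. y $ i \<in> cyl (x $ i) B) \<Longrightarrow> f y = f x) \<Longrightarrow>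
    has_iterated_integral has_E_integral l f
      (c ^ length l * (\<Sum>v\<in>{v. \<forall>i. v $ i \<in> (if i \<in> set l then digit_window A B else {0})}. f v))"
proof (induction l arbitrary: f)
  case Nil
  have zero: "{v :: 'k E ^ 'i. \<forall>i. v $ i = 0} = {0}" by (auto simp: vec_eq_iff)
  have "f x = f 0" for x by (rule Nil.prems(3)) simp
  then show ?case unfolding has_iterated_integral.simps by (simp add: zero)
next
  case (Cons i l)
  let ?R = "digit_window A B :: 'k E set"
  let ?V = "\<lambda>S. {v :: 'k E ^ 'i. \<forall>i. v $ i \<in> (if i \<in> S then ?R else {0})}"
  define h where "h x = c * (\<Sum>r\<in>?R. f (vec_upd x i r))" for x
  have nin: "i \<notin> set l" using Cons.prems by simp
  have inner: "has_E_integral (\<lambda>y. f (vec_upd x i y)) (h x)" for x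
    unfolding h_def c_def
  proof (rule has_E_integral_step[OF AB])
    show "f (vec_upd x i y) = 0" if "y \<notin> cyl 0 A" for y
      using Cons.prems(2)[of i "vec_upd x i y"] that by simp
    show "f (vec_upd x i z) = f (vec_upd x i y)" if "z \<in> cyl y B" for y z
      using that by (intro Cons.prems(3)) (auto simp: cyl_def)
  qed
  have IH: "has_iterated_integral has_E_integral l h (c ^ length l * (\<Sum>v\<in>?V (set l). h v))"
  proof (rule Cons.IH)
    show "distinct l" using Cons.prems by simp
    show "h x = 0" if "j \<in> set l" "x $ j \<notin> cyl 0 A" for x j
    proof -
      have "f (vec_upd x i r) = 0" for r
        using Cons.prems(2)[of j "vec_upd x i r"] that nin by (cases "j = i") auto
      then show ?thesis by (simp add: h_def)
    qed
    show "h y = h x" if "\<forall>j\<in>set l. y $ j \<in> cyl (x $ j) B" for x y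
    proof -
      have "f (vec_upd y i r) = f (vec_upd x i r)" for r
        by (rule Cons.prems(3)) (use that nin in \<open>auto simp: cyl_def\<close>)
      then show ?thesis by (simp add: h_def)
    qed
  qed
  have "(\<Sum>v\<in>?V (set l). h v) = c * (\<Sum>(v, r)\<in>?V (set l) \<times> ?R. f (vec_upd v i r))"
    unfolding h_def by (simp add: sum_distrib_left[symmetric] sum.cartesian_product)
  also have "(\<Sum>(v, r)\<in>?V (set l) \<times> ?R. f (vec_upd v i r)) = (\<Sum>v\<in>?V (set (i # l)). f v)"
  proof (rule sum.reindex_bij_witness[of _ "\<lambda>v. (vec_upd v i 0, v $ i)" "\<lambda>(v, r). vec_upd v i r"])
    fix a assume "a \<in> ?V (set l) \<times> ?R"
    then obtain v r where a: "a = (v, r)" "v \<in> ?V (set l)" "r \<in> ?R" by auto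
    have "v $ i = 0" using a(2) nin by (auto dest: spec[of _ i])
    then show "(\<lambda>v. (vec_upd v i 0, v $ i)) ((\<lambda>(v, r). vec_upd v i r) a) = a"
      using a by (simp add: vec_eq_iff)
    show "(\<lambda>(v, r). vec_upd v i r) a \<in> ?V (set (i # l))" using a by (auto split: if_splits)
    show "f ((\<lambda>(v, r). vec_upd v i r) a) = (case a of (v, r) \<Rightarrow> f (vec_upd v i r))" using a by simp
  next
    fix v assume v: "v \<in> ?V (set (i # l))"
    show "(\<lambda>(v, r). vec_upd v i r) (vec_upd v i 0, v $ i) = v" by (simp add: vec_eq_iff)
    show "(vec_upd v i 0, v $ i) \<in> ?V (set l) \<times> ?R" using v nin by (auto split: if_splits)
  qed
  finally have "c ^ length l * (\<Sum>v\<in>?V (set l). h v) = c ^ length (i # l) * (\<Sum>v\<in>?V (set (i # l)). f v)"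
    by simp
  with IH inner show ?case unfolding has_iterated_integral.simps by (intro exI[of _ h]) simp
qed

lemma has_fubini_integral_step:
  fixes f :: "'k::{field,finite} E ^ 'i::finite \<Rightarrow> complex"
  assumes f: "step_bounds A B f"
  shows "has_fubini_integral has_E_integral f
    (of_real (real CARD('k) powi (- B)) ^ CARD('i) * (\<Sum>v\<in>{v. \<forall>i. v $ i \<in> digit_window A B}. f v))"
  unfolding has_fubini_integral_def
proof (intro allI impI)
  fix l :: "'i list" assume l: "distinct l \<and> set l = UNIV"
  then have "length l = CARD('i)" by (metis distinct_card)
  moreover have "has_iterated_integral has_E_integral l f
      (of_real (real CARD('k) powi (- B)) ^ length l *
        (\<Sum>v\<in>{v. \<forall>i. v $ i \<in> (if i \<in> set l then digit_window A B else {0})}. f v))"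
  proof (rule has_iterated_integral_step)
    show "f y = f x" if "\<forall>i\<in>set l. y $ i \<in> cyl (x $ i) B" for x y
      using f l that unfolding step_bounds_def by auto
    show "f x = 0" if "x $ i \<notin> cyl 0 A" for x i
      using f that unfolding step_bounds_def by blast
  qed (use f l in \<open>simp_all add: step_bounds_def\<close>)
  ultimately show "has_iterated_integral has_E_integral l f
    (of_real (real CARD('k) powi (- B)) ^ CARD('i) * (\<Sum>v\<in>{v. \<forall>i. v $ i \<in> digit_window A B}. f v))"
    using l by simp
qed

lemma cyl_diff: "y \<in> cyl x m \<longleftrightarrow> y - x \<in> cyl 0 m" for x :: "'a::ab_group_add fls"
  by (simp add: cyl_def)

lemma cyl_mono: "m \<le> l \<Longrightarrow> x \<in> cyl c l \<Longrightarrow> x \<in> cyl c m"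
  by (simp add: cyl_def)

text \<open>
An invertible linear map and its inverse change valuations by a bounded amount, so bounds for \<open>f\<close> give bounds for \<open>f \<circ> \<sigma>\<close>.
\<close>

lemma GL_fubini_step:
  fixes f :: "'k::{field,finite} E ^ 'i::finite \<Rightarrow> complex"
  assumes f: "step_bounds A B f"
  shows "GL_fubini f"
  unfolding GL_fubini_def
proof (intro allI impI)
  fix \<sigma> :: "'k E ^ 'i ^ 'i" assume "invertible \<sigma>"
  then obtain \<rho> where \<rho>: "\<rho> ** \<sigma> = mat 1" unfolding invertible_def by blast
  obtain L where L: "\<And>m y. (\<forall>i. y $ i \<in> cyl 0 m) \<Longrightarrow> \<forall>i. (\<sigma> *v y) $ i \<in> cyl 0 (m - L)"
    using matrix_vector_mult_cyl[of \<sigma>] by blast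
  obtain L' where L': "\<And>m y. (\<forall>i. y $ i \<in> cyl 0 m) \<Longrightarrow> \<forall>i. (\<rho> *v y) $ i \<in> cyl 0 (m - L')"
    using matrix_vector_mult_cyl[of \<rho>] by blast
  \<comment> \<open>The maximum keeps the two bounds in order.\<close>
  have "step_bounds (A - L') (max (A - L') (B + L)) (\<lambda>x. f (\<sigma> *v x))"
    unfolding step_bounds_def
  proof (intro conjI allI impI)
    fix x :: "'k E ^ 'i" and i assume x: "x $ i \<notin> cyl 0 (A - L')"
    have "x = \<rho> *v (\<sigma> *v x)" by (simp add: matrix_vector_mul_assoc \<rho>)
    then have "\<not> (\<forall>i. (\<sigma> *v x) $ i \<in> cyl 0 A)" using L'[of "\<sigma> *v x" A] x by metis
    then show "f (\<sigma> *v x) = 0" using f unfolding step_bounds_def by blast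
  next
    fix x y :: "'k E ^ 'i" assume xy: "\<forall>i. y $ i \<in> cyl (x $ i) (max (A - L') (B + L))"
    have "\<forall>i. (\<sigma> *v (y - x)) $ i \<in> cyl 0 (B + L - L)"
    proof (rule L, rule allI)
      fix i
      have "y $ i - x $ i \<in> cyl 0 (max (A - L') (B + L))"
        using xy by (simp add: cyl_diff[symmetric])
      then show "(y - x) $ i \<in> cyl 0 (B + L)" using cyl_mono[OF max.cobounded2] by simp
    qed
    then have "\<forall>i. (\<sigma> *v y) $ i \<in> cyl ((\<sigma> *v x) $ i) B"
      by (simp add: cyl_diff[of "(\<sigma> *v y) $ _"] matrix_vector_mult_diff_distrib)
    then show "f (\<sigma> *v y) = f (\<sigma> *v x)" using f unfolding step_bounds_def by blast
  qed simp
  then show "fubini has_E_integral (\<lambda>x. f (\<sigma> *v x))"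
    unfolding fubini_def using has_fubini_integral_step by blast
qed

section \<open>The ring \<open>O\<^sub>2\<close> and the group \<open>K\<^sub>0\<close>\<close>

lemma lift_eq:
  "lift f a \<gamma> x = (if \<forall>i. x $ i \<in> cyl (a $ i) (\<gamma> $ i)
     then fls_const (f (\<chi> i. fls_nth (x $ i - a $ i) (\<gamma> $ i))) else 0)"
  unfolding lift_def times_par_t_powi shift_mem_O1 red_t_def by simp

text \<open>
The image in the residue field \<open>k\<close> of the two-dimensional valuation ring \<open>O\<^sub>2\<close>; it detects units.
\<close>

definition residue_O2 :: "'k::{field,finite} F \<Rightarrow> 'k" where
  "residue_O2 x = fls_nth (fls_nth x 0) 0"

lemma ring_O2_iff: "x \<in> ring_O2 \<longleftrightarrow> x \<in> fls_integers \<and> fls_nth x 0 \<in> fls_integers" for x :: "'k::{field,finite} F"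
proof
  assume "x \<in> ring_O2"
  then obtain b y where x: "x = fls_const b + par_t * y" "b \<in> ring_E" "y \<in> ring_O1"
    unfolding ring_O2_def by blast
  have b: "fls_nth b n = 0" if "n < 0" for n
    using x(2) that unfolding ring_E_cyl cyl_def by simp
  have y: "fls_nth y n = 0" if "n < 0" for n
    using x(3) that unfolding ring_O1_iff by blast
  have "fls_nth x n = (if n = 0 then b else 0) + fls_nth y (n - 1)" for n
    unfolding x(1) by (simp add: par_t_def fls_X_times_conv_shift)
  then show "x \<in> fls_integers \<and> fls_nth x 0 \<in> fls_integers"
    using b y by simp
next
  assume x: "x \<in> fls_integers \<and> fls_nth x 0 \<in> fls_integers"
  let ?b = "fls_nth x 0"
  let ?y = "fls_shift 1 (x - fls_const ?b)"
  have "?b \<in> ring_E" using x unfolding ring_E_cyl cyl_def by simp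
  moreover have "fls_nth ?y n = 0" if n: "n < 0" for n
  proof (cases "n + 1 = 0")
    case False
    then have "fls_nth x (n + 1) = 0" using x n by simp
    with False show ?thesis by simp
  qed simp
  then have "?y \<in> ring_O1" unfolding ring_O1_iff by blast
  moreover have "x = fls_const ?b + par_t * ?y"
    unfolding par_t_def fls_X_times_conv_shift fls_shift_fls_shift by simp
  ultimately show "x \<in> ring_O2" unfolding ring_O2_def by blast
qed

lemma O2_add: "x \<in> ring_O2 \<Longrightarrow> y \<in> ring_O2 \<Longrightarrow> x + y \<in> ring_O2"
  by (simp add: ring_O2_iff)

lemma O2_minus: "x \<in> ring_O2 \<Longrightarrow> - x \<in> ring_O2"
  by (simp add: ring_O2_iff)

lemma O2_mult:
  assumes "x \<in> ring_O2" "y \<in> ring_O2"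
  shows "x * y \<in> ring_O2"
proof -
  have x: "x \<in> fls_integers" "fls_nth x 0 \<in> fls_integers" and y: "y \<in> fls_integers" "fls_nth y 0 \<in> fls_integers"
    using assms unfolding ring_O2_iff by blast+
  have "fls_nth (x * y) 0 \<in> fls_integers"
    unfolding fls_nth_mult_0[OF x(1) y(1)] by (rule fls_integers_mult[OF x(2) y(2)])
  with fls_integers_mult[OF x(1) y(1)] show ?thesis unfolding ring_O2_iff by blast
qed

lemma O2_0: "0 \<in> ring_O2" by (simp add: ring_O2_iff)

lemma O2_1: "1 \<in> ring_O2" by (simp add: ring_O2_iff)

lemma residue_O2_mult:
  assumes "x \<in> ring_O2" "y \<in> ring_O2"
  shows "residue_O2 (x * y) = residue_O2 x * residue_O2 y"
proof -
  have x: "x \<in> fls_integers" "fls_nth x 0 \<in> fls_integers" and y: "y \<in> fls_integers" "fls_nth y 0 \<in> fls_integers"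
    using assms unfolding ring_O2_iff by blast+
  show ?thesis unfolding residue_O2_def fls_nth_mult_0[OF x(1) y(1)] by (rule fls_nth_mult_0[OF x(2) y(2)])
qed

lemma det_O2:
  fixes x :: "('k::{field,finite}, 'n::finite) matF"
  assumes "\<And>i j. x $ i $ j \<in> ring_O2"
  shows "det x \<in> ring_O2" and "residue_O2 (det x) = det (\<chi> i j. residue_O2 (x $ i $ j))"
proof -
  have "det x \<in> ring_O2 \<and> residue_O2 (det x) = det (\<chi> i j. residue_O2 (x $ i $ j))"
    by (rule det_hom_on) (rule O2_0, rule O2_1, rule O2_add, assumption, assumption, rule O2_mult, assumption, assumption,
      rule O2_minus, assumption, simp add: residue_O2_def, simp add: residue_O2_def, simp add: residue_O2_def,
      rule residue_O2_mult, assumption, assumption, simp add: residue_O2_def, rule assms)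
  then show "det x \<in> ring_O2" and "residue_O2 (det x) = det (\<chi> i j. residue_O2 (x $ i $ j))" by blast+
qed

lemma det_fls_integers:
  fixes x :: "'a::field fls ^ 'n ^ 'n::finite"
  assumes "\<And>i j. x $ i $ j \<in> fls_integers"
  shows "fls_nth (det x) 0 = det (\<chi> i j. fls_nth (x $ i $ j) 0)"
proof -
  have "det x \<in> fls_integers \<and> fls_nth (det x) 0 = det (\<chi> i j. fls_nth (x $ i $ j) 0)"
    by (rule det_hom_on) (simp, simp, simp, rule fls_integers_mult, assumption, assumption, simp, simp, simp, simp,
      rule fls_nth_mult_0, assumption, assumption, simp, rule assms)
  then show ?thesis by (rule conjunct2)
qed

lemma O2_inverse:
  assumes d: "d \<in> ring_O2" "residue_O2 d \<noteq> 0"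
  shows "fls_subdegree d = 0" "fls_subdegree (fls_nth d 0) = 0" "inverse d \<in> ring_O2"
proof -
  have d0: "fls_nth d 0 \<noteq> 0" "d \<noteq> 0" using d(2) by (auto simp: residue_O2_def)
  show 1: "fls_subdegree d = 0"
    using d d0 by (intro fls_subdegree_eqI) (auto simp: ring_O2_iff)
  show 2: "fls_subdegree (fls_nth d 0) = 0"
    using d by (intro fls_subdegree_eqI) (auto simp: ring_O2_iff residue_O2_def)
  have "fls_subdegree (inverse d) = 0" using 1 d0 by simp
  then have i: "inverse d \<in> fls_integers" by (simp add: subdegree_ge_iff)
  have "d * inverse d = 1" using d0 by simp
  then have "fls_nth d 0 * fls_nth (inverse d) 0 = 1"
    using fls_nth_mult_0[OF _ i, of d] d(1) by (simp add: ring_O2_iff)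
  then have "fls_nth (inverse d) 0 = inverse (fls_nth d 0)"
    using d0(1) by (simp add: field_simps)
  moreover have "fls_subdegree (inverse (fls_nth d 0)) = 0" using 2 by simp
  ultimately show "inverse d \<in> ring_O2" using i by (simp add: ring_O2_iff subdegree_ge_iff)
qed

lemma abs_F_unit: "d \<in> ring_O2 \<Longrightarrow> residue_O2 d \<noteq> 0 \<Longrightarrow> abs_F d = 1"
  using O2_inverse[of d] by (simp add: abs_F_eq)

lemma matrix_mult_O2:
  assumes "\<And>r s. x $ r $ s \<in> ring_O2" "\<And>r s. y $ r $ s \<in> ring_O2"
  shows "(x ** y) $ r $ s \<in> ring_O2"
proof -
  have "(\<Sum>k\<in>S. x $ r $ k * y $ k $ s) \<in> ring_O2" if "finite S" for S
    using that by induction (simp_all add: O2_0 O2_add O2_mult assms)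
  then show ?thesis by (simp add: matrix_matrix_mult_def)
qed

text \<open>
Cramer's rule expresses the inverse through determinants with entries in \<open>O\<^sub>2\<close> and the inverse of the determinant, which lies in \<open>O\<^sub>2\<close>
as soon as the residue of the determinant is nonzero.
\<close>

lemma K0_iff: "x \<in> K0 \<longleftrightarrow> (\<forall>r s. x $ r $ s \<in> ring_O2) \<and> residue_O2 (det x) \<noteq> 0"
  for x :: "('k::{field,finite}, 'n::finite) matF"
proof
  assume "x \<in> K0"
  then obtain h where x: "\<And>r s. x $ r $ s \<in> ring_O2" and h: "\<And>r s. h $ r $ s \<in> ring_O2" and "x ** h = mat 1"
    unfolding K0_def matrices_over_def by blast
  then have "det x * det h = 1" using det_mul[of x h] by simp
  then have "residue_O2 (det x) * residue_O2 (det h) = 1"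
    using residue_O2_mult[OF det_O2(1)[OF x] det_O2(1)[OF h]] by (simp add: residue_O2_def)
  with x show "(\<forall>r s. x $ r $ s \<in> ring_O2) \<and> residue_O2 (det x) \<noteq> 0" by auto
next
  assume R: "(\<forall>r s. x $ r $ s \<in> ring_O2) \<and> residue_O2 (det x) \<noteq> 0"
  have x: "x $ r $ s \<in> ring_O2" for r s using R by blast
  have nz: "det x \<noteq> 0" using R by (auto simp: residue_O2_def)
  have inv: "inverse (det x) \<in> ring_O2" using O2_inverse(3)[OF det_O2(1)[OF x]] R by blast
  \<comment> \<open>Column \<open>l\<close> of the inverse is the solution of the linear system with the \<open>l\<close>-th unit vector on the right-hand side.\<close>
  define h :: "('k, 'n) matF" where
    "h = (\<chi> k l. det (\<chi> i j. if j = k then (mat 1 :: ('k, 'n) matF) $ i $ l else x $ i $ j) / det x)"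
  have h: "h $ k $ l \<in> ring_O2" for k l
  proof -
    have "det (\<chi> i j. if j = k then (mat 1 :: ('k, 'n) matF) $ i $ l else x $ i $ j) \<in> ring_O2"
      by (rule det_O2(1)) (simp add: x mat_def O2_0 O2_1)
    then show ?thesis unfolding h_def vec_lambda_beta divide_inverse using inv by (rule O2_mult)
  qed
  have xh: "x ** h = mat 1"
  proof -
    have "(x ** h) $ i $ l = (mat 1 :: ('k, 'n) matF) $ i $ l" for i l
    proof -
      let ?b = "\<chi> i. (mat 1 :: ('k, 'n) matF) $ i $ l"
      have "(\<chi> k. h $ k $ l) = (\<chi> k. det (\<chi> i j. if j = k then ?b $ i else x $ i $ j) / det x)"
        unfolding h_def vec_lambda_beta ..
      then have "x *v (\<chi> k. h $ k $ l) = ?b" using cramer[OF nz] by blast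
      then show ?thesis unfolding matrix_mult_nth_col by (simp only: vec_lambda_beta)
    qed
    then show ?thesis by (simp add: vec_eq_iff)
  qed
  have "h ** x = mat 1" using xh matrix_left_right_inverse by blast
  with xh show "x \<in> K0" unfolding K0_def matrices_over_def using x h by auto
qed

lemma K0_abs_det: "x \<in> K0 \<Longrightarrow> abs_F (det x) = 1"
  unfolding K0_iff by (intro abs_F_unit det_O2(1)) blast+

text \<open>
On \<open>K\<^sub>0\<close> the modulus of the determinant is \<open>1\<close>, so the characteristic function of a subset, extended by zero,
is its own extension.
\<close>

lemma LG_indicator:
  fixes A :: "('k::{field,finite}, 'n::finite) matF set"
  assumes A: "A \<subseteq> K0" and G: "GL_fubini f"
    and f: "has_fubini_integral has_E_integral f c"
    and l: "\<And>\<tau>. lift f a \<gamma> (coords \<tau>) = indicator A \<tau>"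
  shows "indicator A \<in> LG"
    and "morrow_integral (indicator A) = fls_X powi (\<Sum>p\<in>UNIV. \<gamma> $ p) * fls_const c"
proof -
  have ext: "morrow_extension (indicator A) (lift f a \<gamma>)"
    unfolding morrow_extension_def
  proof (intro conjI ballI)
    show "lift f a \<gamma> \<in> morrow_class" by (rule morrow_class_lift[OF G])
    fix \<tau> :: "('k, 'n) matF"
    show "lift f a \<gamma> (coords \<tau>) = indicator A \<tau> * abs_F (det \<tau>) powi - int CARD('n)"
    proof (cases "\<tau> \<in> A")
      case True
      then have "abs_F (det \<tau>) = 1" using A K0_abs_det by blast
      then show ?thesis by (simp add: l)
    qed (simp add: l)
  qed
  then show "indicator A \<in> LG" unfolding LG_def by blast
  have "has_fubini_integral has_F_integral (\<lambda>x. lift f a \<gamma> (mat 1 *v x))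
     (inverse (abs_F (det (mat 1 :: 'k F ^ ('n \<times> 'n) ^ ('n \<times> 'n)))) * (fls_X powi (\<Sum>p\<in>UNIV. \<gamma> $ p) * fls_const c))"
    by (rule has_fubini_integral_lift[OF G f invertible_mat_1])
  then have "has_fubini_integral has_F_integral (lift f a \<gamma>) (fls_X powi (\<Sum>p\<in>UNIV. \<gamma> $ p) * fls_const c)"
    by (simp del: fls_X_power_int)
  then show "morrow_integral (indicator A) = fls_X powi (\<Sum>p\<in>UNIV. \<gamma> $ p) * fls_const c"
    by (rule morrow_integral_eqI[OF ext])
qed

definition box_indicator :: "('i \<Rightarrow> 'k::{field,finite} E set) \<Rightarrow> 'k E ^ 'i::finite \<Rightarrow> complex" where
  "box_indicator C y = (\<Prod>p\<in>UNIV. indicator (C p) (y $ p))"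

lemma box_indicator_eq: "box_indicator C y = (if \<forall>p. y $ p \<in> C p then 1 else 0)"
proof (cases "\<forall>p. y $ p \<in> C p")
  case False
  then obtain p where "y $ p \<notin> C p" by blast
  then have "indicator (C p) (y $ p) = (0::complex)" by simp
  then show ?thesis using False unfolding box_indicator_def by (auto intro!: prod_zero)
qed (simp add: box_indicator_def)

lemma has_fubini_integral_box:
  assumes "\<And>p. has_E_integral (indicator (C p)) (c p)"
  shows "has_fubini_integral has_E_integral (box_indicator C) (\<Prod>p\<in>UNIV. c p)"
  unfolding box_indicator_def
  by (rule has_fubini_integral_prod[where F = "\<lambda>p. indicator (C p)"])
    (use assms in \<open>auto intro: has_bochner_integral_mult_right\<close>)

lemma GL_fubini_box:
  assumes "0 \<le> B" "\<And>p. C p \<subseteq> cyl 0 0" "\<And>p y z. z \<in> cyl y B \<Longrightarrow> z \<in> C p \<longleftrightarrow> y \<in> C p"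
  shows "GL_fubini (box_indicator C)"
proof (rule GL_fubini_step[of 0 B])
  show "step_bounds 0 B (box_indicator C)"
    unfolding step_bounds_def
  proof (intro conjI allI impI)
    show "0 \<le> B" by fact
    show "box_indicator C x = 0" if "x $ i \<notin> cyl 0 0" for x i
    proof -
      have "x $ i \<notin> C i" using that assms(2) by blast
      then show ?thesis unfolding box_indicator_eq by auto
    qed
    show "box_indicator C y = box_indicator C x" if "\<forall>i. y $ i \<in> cyl (x $ i) B" for x y
    proof -
      have "y $ p \<in> C p \<longleftrightarrow> x $ p \<in> C p" for p using that assms(3) by blast
      then show ?thesis unfolding box_indicator_eq by simp
    qed
  qed
qed

lemma lift_box:
  "lift (box_indicator C) a \<gamma> x = (if \<forall>p. x $ p \<in> cyl (a $ p) (\<gamma> $ p) \<and>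
      fls_nth (x $ p - a $ p) (\<gamma> $ p) \<in> C p then 1 else 0)"
  unfolding lift_eq box_indicator_eq by auto

lemma has_E_integral_cyl:
  "has_E_integral (indicator (cyl c m) :: 'k::{field,finite} E \<Rightarrow> complex) (of_real (real CARD('k) powi (- m)))"
proof -
  have "has_E_integral (\<lambda>x. indicator (cyl c m) x *\<^sub>R (1::complex)) (measure haar_E (cyl (c :: 'k E) m) *\<^sub>R 1)"
    by (rule has_bochner_integral_indicator) (simp_all add: cyl_borel emeasure_haar_E_cyl)
  moreover have "measure haar_E (cyl (c :: 'k E) m) = real CARD('k) powi (- m)"
    by (simp add: measure_def emeasure_haar_E_cyl)
  moreover have "(\<lambda>x. indicator (cyl c m) x *\<^sub>R (1::complex)) = indicator (cyl c m)"
    by (auto simp: indicator_def)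
  ultimately show ?thesis by (simp add: scaleR_conv_of_real)
qed

definition units_E :: "'k::{field,finite} E set" where
  "units_E = cyl 0 0 - cyl 0 1"

lemma has_E_integral_units:
  "has_E_integral (indicator units_E :: 'k::{field,finite} E \<Rightarrow> complex) (of_real (1 - real CARD('k) powi (- 1)))"
proof -
  have "(\<lambda>x. indicator (cyl 0 0) x - indicator (cyl 0 1) x :: complex) = (indicator (units_E :: 'k E set))"
    by (auto simp: units_E_def indicator_def cyl_def)
  then show ?thesis
    using has_bochner_integral_diff[OF has_E_integral_cyl[of 0 0] has_E_integral_cyl[of "0 :: 'k E" 1]] by simp
qed

text \<open>
Multiplication by \<open>u\<^sup>i t\<^sup>j\<close> only shifts both sets of coefficients.
\<close>

lemma Jideal_iff: "x \<in> Jideal i j \<longleftrightarrow> x \<in> cyl 0 (int j) \<and> fls_nth x (int j) \<in> cyl 0 (int i)"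
  for x :: "'k::{field,finite} F"
proof -
  have nth: "fls_nth (par_u ^ i * par_t ^ j * y) n = fls_X ^ i * fls_nth y (n - int j)" for y :: "'k F" and n
  proof -
    have "par_u ^ i * par_t ^ j * y = fls_const (fls_X ^ i) * fls_shift (- int j) y"
      by (simp add: par_u_def par_t_def fls_const_power mult.assoc fls_X_power_times_conv_shift fls_shifted_times_simps)
    then show ?thesis by simp
  qed
  have X: "fls_nth (fls_X ^ i * z) n = fls_nth z (n - int i)" for z :: "'k E" and n
    by (simp add: fls_X_power_times_conv_shift)
  show ?thesis
  proof
    assume "x \<in> Jideal i j"
    then obtain y where x: "x = par_u ^ i * par_t ^ j * y" "y \<in> ring_O2" unfolding Jideal_def by blast
    then show "x \<in> cyl 0 (int j) \<and> fls_nth x (int j) \<in> cyl 0 (int i)"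
      by (auto simp: nth X ring_O2_iff cyl_def)
  next
    assume R: "x \<in> cyl 0 (int j) \<and> fls_nth x (int j) \<in> cyl 0 (int i)"
    have nz: "par_u ^ i * par_t ^ j \<noteq> (0 :: 'k F)" by (simp add: par_u_def par_t_def)
    define y where "y = x / (par_u ^ i * par_t ^ j)"
    have x: "x = par_u ^ i * par_t ^ j * y" using nz by (simp add: y_def)
    have "fls_nth y n = 0" if "n < 0" for n
    proof -
      have "fls_X ^ i * fls_nth y n = fls_nth x (n + int j)" unfolding x nth by simp
      also have "\<dots> = 0" using R that by (simp add: cyl_def)
      finally show ?thesis by simp
    qed
    moreover have "fls_nth (fls_nth y 0) n = 0" if "n < 0" for n
    proof -
      have "fls_nth (fls_nth y 0) n = fls_nth (fls_nth x (int j)) (n + int i)" unfolding x nth X by simp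
      also have "\<dots> = 0" using R that by (simp add: cyl_def)
      finally show ?thesis .
    qed
    ultimately have "y \<in> ring_O2" by (simp add: ring_O2_iff)
    with x show "x \<in> Jideal i j" unfolding Jideal_def by blast
  qed
qed

section \<open>The groups \<open>K\<^sub>i\<^sub>j\<close> and \<open>P\<^sub>i\<^sub>j\<close>\<close>

lemma O2_cyl_iff: "x \<in> ring_O2 \<longleftrightarrow> x \<in> cyl 0 0 \<and> fls_nth x 0 \<in> cyl 0 0" for x :: "'k::{field,finite} F"
  by (simp add: ring_O2_iff cyl_def)

lemma units_E_iff: "z \<in> units_E \<longleftrightarrow> z \<in> cyl 0 0 \<and> fls_nth z 0 \<noteq> 0" for z :: "'k::{field,finite} E"
proof -
  have "z \<in> cyl 0 1 \<longleftrightarrow> z \<in> cyl 0 0 \<and> fls_nth z 0 = 0"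
  proof
    assume "z \<in> cyl 0 0 \<and> fls_nth z 0 = 0"
    then have "fls_nth z n = 0" if "n < 1" for n using that by (cases "n = 0") (auto simp: cyl_def)
    then show "z \<in> cyl 0 1" by (simp add: cyl_def)
  qed (simp add: cyl_def)
  then show ?thesis unfolding units_E_def by blast
qed

lemma Jideal_residue:
  assumes "x \<in> Jideal i j" "1 \<le> j"
  shows "x \<in> ring_O2" "residue_O2 x = 0" "fls_nth x 0 = 0"
proof -
  have *: "fls_nth x n = 0" if "n < int j" for n
    using assms(1) that unfolding Jideal_iff cyl_def by simp
  show "fls_nth x 0 = 0" using *[of 0] assms(2) by simp
  then show "residue_O2 x = 0" by (simp add: residue_O2_def)
  show "x \<in> ring_O2" using * assms(2) by (simp add: ring_O2_iff)
qed

lemma Jideal_mult: "b \<in> ring_O2 \<Longrightarrow> x \<in> Jideal i j \<Longrightarrow> b * x \<in> Jideal i j"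
proof -
  assume b: "b \<in> ring_O2" and "x \<in> Jideal i j"
  then obtain y where y: "x = par_u ^ i * par_t ^ j * y" "y \<in> ring_O2" unfolding Jideal_def by blast
  have "b * x = par_u ^ i * par_t ^ j * (b * y)" unfolding y(1) by (simp only: mult_ac)
  moreover have "b * y \<in> ring_O2" using b y(2) by (rule O2_mult)
  ultimately show "b * x \<in> Jideal i j" unfolding Jideal_def by blast
qed

lemma Jideal_add: "x \<in> Jideal i j \<Longrightarrow> y \<in> Jideal i j \<Longrightarrow> x + y \<in> Jideal i j"
  by (simp add: Jideal_iff cyl_def)

lemma Jideal_0: "0 \<in> Jideal i j"
  by (simp add: Jideal_iff cyl_def)

lemma matrix_mult_Jideal:
  assumes "\<And>r s. b $ r $ s \<in> ring_O2" "\<And>r s. x $ r $ s \<in> Jideal i j"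
  shows "(b ** x) $ r $ s \<in> Jideal i j"
proof -
  have "(\<Sum>k\<in>S. b $ r $ k * x $ k $ s) \<in> Jideal i j" if "finite S" for S
    using that by induction (simp_all add: Jideal_0 Jideal_add Jideal_mult assms)
  then show ?thesis by (simp add: matrix_matrix_mult_def)
qed

lemma Kij_iff: "\<tau> \<in> Kij i j \<longleftrightarrow> (\<forall>r s. \<tau> $ r $ s - mat 1 $ r $ s \<in> Jideal i j)"
  for \<tau> :: "('k::{field,finite}, 'n::finite) matF"
proof
  assume "\<tau> \<in> Kij i j"
  then obtain x where "\<tau> = mat 1 + x" "\<forall>r s. x $ r $ s \<in> Jideal i j" unfolding Kij_def matrices_over_def by blast
  then show "\<forall>r s. \<tau> $ r $ s - mat 1 $ r $ s \<in> Jideal i j" by simp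
next
  assume "\<forall>r s. \<tau> $ r $ s - mat 1 $ r $ s \<in> Jideal i j"
  then have "\<tau> - mat 1 \<in> matrices_over (Jideal i j)" unfolding matrices_over_def by simp
  moreover have "\<tau> = mat 1 + (\<tau> - mat 1)" by simp
  ultimately show "\<tau> \<in> Kij i j" unfolding Kij_def by blast
qed

text \<open>
The matrix is congruent to the identity modulo \<open>t\<close>, so its determinant has residue \<open>1\<close>.
\<close>

lemma Kij_subset_K0:
  assumes "1 \<le> j"
  shows "Kij i j \<subseteq> (K0 :: ('k::{field,finite}, 'n::finite) matF set)"
proof
  fix \<tau> :: "('k, 'n) matF" assume "\<tau> \<in> Kij i j"
  then have J: "\<tau> $ r $ s - mat 1 $ r $ s \<in> Jideal i j" for r s unfolding Kij_iff by blast
  have m: "mat 1 $ r $ s \<in> (ring_O2 :: 'k F set)" for r s :: 'n by (simp add: mat_def O2_0 O2_1)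
  have e: "\<tau> $ r $ s \<in> ring_O2" for r s
    using O2_add[OF Jideal_residue(1)[OF J assms] m, of r s r s] by simp
  have "fls_nth (\<tau> $ r $ s) 0 = fls_nth (mat 1 $ r $ s) 0" for r s
    using Jideal_residue(3)[OF J assms, of r s] by simp
  then have "(\<chi> r s. residue_O2 (\<tau> $ r $ s)) = (mat 1 :: 'k ^ 'n ^ 'n)"
    by (simp add: vec_eq_iff residue_O2_def mat_def)
  then have "residue_O2 (det \<tau>) = 1" using det_O2(2)[of \<tau>] e by simp
  then show "\<tau> \<in> K0" unfolding K0_iff using e by simp
qed

lemma lift_box_Kij:
  "lift (box_indicator (\<lambda>_. cyl 0 (int i))) (coords (mat 1)) (\<chi> p. int j) (coords \<tau>) = indicator (Kij i j) \<tau>"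
  for \<tau> :: "('k::{field,finite}, 'n::finite) matF"
proof -
  have "x \<in> cyl a (int j) \<and> fls_nth (x - a) (int j) \<in> cyl 0 (int i) \<longleftrightarrow> x - a \<in> Jideal i j" for x a :: "'k F"
    unfolding Jideal_iff using cyl_diff[of x a "int j"] by blast
  then show ?thesis unfolding lift_box Kij_iff indicator_def by simp
qed

lemma GL_fubini_box_Kij: "GL_fubini (box_indicator (\<lambda>_. cyl 0 (int i)) :: 'k::{field,finite} E ^ 'i::finite \<Rightarrow> complex)"
  by (rule GL_fubini_box[of "int i"]) (auto simp: cyl_def)

lemma powi_neg_power: "(x powi (- int i)) ^ N = (x::real) powi (- int (N * i))"
proof -
  have "(x powi (- int i)) ^ N = (x powi (- int i)) powi int N" by simp
  also have "\<dots> = x powi (- int i * int N)" by (rule power_int_mult[symmetric])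
  also have "- int i * int N = - int (N * i)" by simp
  finally show ?thesis .
qed

lemma Kij_LG:
  assumes "1 \<le> j"
  shows "indicator (Kij i j :: ('k::{field,finite}, 'n::finite) matF set) \<in> LG"
    and "morrow_integral (indicator (Kij i j :: ('k, 'n) matF set)) =
      real_const (real CARD('k) powi (- int (CARD('n)\<^sup>2 * i))) * fls_X ^ (CARD('n)\<^sup>2 * j)"
proof -
  let ?q = "real CARD('k)"
  have f: "has_fubini_integral has_E_integral
      (box_indicator (\<lambda>_ :: 'n \<times> 'n. cyl 0 (int i)) :: 'k E ^ ('n \<times> 'n) \<Rightarrow> complex)
      (\<Prod>p\<in>(UNIV :: ('n \<times> 'n) set). of_real (?q powi (- int i)))"
    by (rule has_fubini_integral_box) (rule has_E_integral_cyl)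
  note L = LG_indicator[OF Kij_subset_K0[OF assms] GL_fubini_box_Kij f lift_box_Kij]
  show "indicator (Kij i j :: ('k, 'n) matF set) \<in> LG" by (rule L(1))
  have "fls_X powi (\<Sum>p\<in>(UNIV :: ('n \<times> 'n) set). (\<chi> p. int j) $ p) = (fls_X ^ (CARD('n)\<^sup>2 * j) :: complex fls)"
    by (simp add: fls_X_power_conv_shift_1 power2_eq_square)
  moreover have "(\<Prod>p\<in>(UNIV :: ('n \<times> 'n) set). of_real (?q powi (- int i))) = complex_of_real (?q powi (- int (CARD('n)\<^sup>2 * i)))"
    unfolding prod_constant of_real_power[symmetric] powi_neg_power by (simp add: power2_eq_square)
  ultimately show "morrow_integral (indicator (Kij i j :: ('k, 'n) matF set)) =
      real_const (?q powi (- int (CARD('n)\<^sup>2 * i))) * fls_X ^ (CARD('n)\<^sup>2 * j)"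
    unfolding L(2) real_const_def by (simp only: mult.commute)
qed

text \<open>
The number of smaller indices serves as the rank.
\<close>

lemma det_upper_triangular:
  fixes T :: "(('a::comm_ring_1, 'n::{finite,linorder}) vec, 'n) vec"
  assumes "\<And>r s. s < r \<Longrightarrow> T $ r $ s = 0"
  shows "det T = (\<Prod>a\<in>UNIV. T $ a $ a)"
proof (rule det_triangular_rank[of _ "\<lambda>r. card {s. s < r}"])
  fix a b assume ab: "a \<noteq> b" "T $ a $ b \<noteq> 0"
  then have "a < b" using assms[of b a] by (metis not_less_iff_gr_or_eq)
  then have "{s. s < a} \<subset> {s. s < b}" by auto
  then show "card {s. s < a} < card {s. s < b}" by (intro psubset_card_mono) auto
qed

lemma residue_O2_prod:
  "finite S \<Longrightarrow> (\<And>a. a \<in> S \<Longrightarrow> g a \<in> ring_O2) \<Longrightarrow>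
    (\<Prod>a\<in>S. g a) \<in> ring_O2 \<and> residue_O2 (\<Prod>a\<in>S. g a) = (\<Prod>a\<in>S. residue_O2 (g a))"
  by (induction rule: finite_induct) (simp_all add: O2_1 O2_mult residue_O2_mult, simp add: residue_O2_def)

lemma residue_O2_add: "residue_O2 (x + y) = residue_O2 x + residue_O2 y"
  by (simp add: residue_O2_def)

lemma upper_triangular_K0_iff:
  fixes b :: "('k::{field,finite}, 'n::{finite,linorder}) matF"
  assumes up: "\<And>r s. s < r \<Longrightarrow> b $ r $ s = 0" and O2: "\<And>r s. b $ r $ s \<in> ring_O2"
  shows "b \<in> K0 \<longleftrightarrow> (\<forall>r. residue_O2 (b $ r $ r) \<noteq> 0)"
proof -
  have "residue_O2 (det b) = (\<Prod>r\<in>UNIV. residue_O2 (b $ r $ r))"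
  proof -
    have "det b = (\<Prod>r\<in>UNIV. b $ r $ r)" by (rule det_upper_triangular) (rule up)
    then show ?thesis using residue_O2_prod[of UNIV "\<lambda>r. b $ r $ r", OF finite O2] by simp
  qed
  then show ?thesis unfolding K0_iff using O2 by (simp add: prod_zero_iff)
qed

text \<open>
A product \<open>b (1 + x)\<close> equals \<open>b + b x\<close>, where \<open>b x\<close> has all entries in \<open>J\<close>; this perturbs the entries of \<open>b\<close> without changing their residues.
Conversely, split a matrix of the described shape into its upper triangular part \<open>b\<close> and its lower part \<open>y\<close>; then \<open>b\<close> lies in \<open>K\<^sub>0\<close> and
the matrix equals \<open>b (1 + b\<^sup>-\<^sup>1 y)\<close>.
\<close>

lemma Pij_iff:
  fixes \<tau> :: "('k::{field,finite}, 'n::{finite,linorder}) matF"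
  assumes j: "1 \<le> j"
  shows "\<tau> \<in> Pij i j \<longleftrightarrow> (\<forall>r s. (s < r \<longrightarrow> \<tau> $ r $ s \<in> Jideal i j) \<and> (\<not> s < r \<longrightarrow> \<tau> $ r $ s \<in> ring_O2)
    \<and> (r = s \<longrightarrow> residue_O2 (\<tau> $ r $ s) \<noteq> 0))"
proof
  assume "\<tau> \<in> Pij i j"
  then obtain b k where \<tau>: "\<tau> = b ** k" and b: "b \<in> QG" and k: "k \<in> Kij i j" unfolding Pij_def by blast
  then obtain x where x: "k = mat 1 + x" "\<And>r s. x $ r $ s \<in> Jideal i j" unfolding Kij_def matrices_over_def by blast
  have up: "\<And>r s. s < r \<Longrightarrow> b $ r $ s = 0" and bK: "b \<in> K0" using b unfolding QG_def borel_G_def by auto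
  have bO: "\<And>r s. b $ r $ s \<in> ring_O2" using bK unfolding K0_iff by blast
  have diag: "residue_O2 (b $ r $ r) \<noteq> 0" for r using upper_triangular_K0_iff[OF up bO] bK by blast
  have e: "\<tau> $ r $ s = b $ r $ s + (b ** x) $ r $ s" for r s by (simp add: \<tau> x(1) matrix_add_ldistrib)
  have J: "(b ** x) $ r $ s \<in> Jideal i j" for r s by (rule matrix_mult_Jideal[OF bO x(2)])
  show "\<forall>r s. (s < r \<longrightarrow> \<tau> $ r $ s \<in> Jideal i j) \<and> (\<not> s < r \<longrightarrow> \<tau> $ r $ s \<in> ring_O2)
    \<and> (r = s \<longrightarrow> residue_O2 (\<tau> $ r $ s) \<noteq> 0)"
  proof (intro allI conjI impI)
    fix r s :: 'n
    show "\<tau> $ r $ s \<in> Jideal i j" if "s < r" using J[of r s] up[OF that] by (simp add: e)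
    show "\<tau> $ r $ s \<in> ring_O2" unfolding e by (rule O2_add[OF bO Jideal_residue(1)[OF J j]])
    show "residue_O2 (\<tau> $ r $ s) \<noteq> 0" if "r = s"
      using diag[of s] Jideal_residue(2)[OF J j, of s s] that by (simp add: e residue_O2_add)
  qed
next
  assume R: "\<forall>r s. (s < r \<longrightarrow> \<tau> $ r $ s \<in> Jideal i j) \<and> (\<not> s < r \<longrightarrow> \<tau> $ r $ s \<in> ring_O2)
    \<and> (r = s \<longrightarrow> residue_O2 (\<tau> $ r $ s) \<noteq> 0)"
  define b :: "('k, 'n) matF" where "b = (\<chi> r s. if s < r then 0 else \<tau> $ r $ s)"
  define y :: "('k, 'n) matF" where "y = (\<chi> r s. if s < r then \<tau> $ r $ s else 0)"
  have sum: "\<tau> = b + y" by (simp add: vec_eq_iff b_def y_def)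
  have up: "\<And>r s. s < r \<Longrightarrow> b $ r $ s = 0" by (simp add: b_def)
  have bO: "b $ r $ s \<in> ring_O2" for r s using R by (simp add: b_def O2_0)
  have yJ: "y $ r $ s \<in> Jideal i j" for r s using R by (simp add: y_def Jideal_0)
  have "\<forall>r. residue_O2 (b $ r $ r) \<noteq> 0" using R by (simp add: b_def)
  then have bK: "b \<in> K0" using upper_triangular_K0_iff[OF up bO] by blast
  then obtain h where h: "h \<in> matrices_over ring_O2" "b ** h = mat 1" "h ** b = mat 1" unfolding K0_def by blast
  have hO: "\<And>r s. h $ r $ s \<in> ring_O2" using h(1) unfolding matrices_over_def by blast
  have "b \<in> GLn" unfolding GLn_def invertible_def using h(2,3) by blast
  then have "b \<in> QG" unfolding QG_def borel_G_def using bK up by simp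
  moreover have "mat 1 + h ** y \<in> Kij i j"
    unfolding Kij_iff using matrix_mult_Jideal[OF hO yJ] by simp
  moreover have "\<tau> = b ** (mat 1 + h ** y)"
    unfolding matrix_add_ldistrib matrix_mul_assoc h(2) by (simp add: sum[symmetric])
  ultimately show "\<tau> \<in> Pij i j" unfolding Pij_def by blast
qed

lemma Pij_subset_K0:
  assumes j: "1 \<le> j"
  shows "Pij i j \<subseteq> (K0 :: ('k::{field,finite}, 'n::{finite,linorder}) matF set)"
proof
  fix \<tau> :: "('k, 'n) matF" assume "\<tau> \<in> Pij i j"
  then obtain b k where \<tau>: "\<tau> = b ** k" and "b \<in> QG" and "k \<in> Kij i j" unfolding Pij_def by blast
  then have b: "b \<in> K0" and k: "k \<in> K0" using Kij_subset_K0[OF j] unfolding QG_def by auto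
  have bO: "\<And>r s. b $ r $ s \<in> ring_O2" and kO: "\<And>r s. k $ r $ s \<in> ring_O2" using b k unfolding K0_iff by blast+
  have "residue_O2 (det \<tau>) \<noteq> 0"
    using b k residue_O2_mult[OF det_O2(1)[OF bO] det_O2(1)[OF kO]] unfolding K0_iff by (simp add: \<tau> det_mul)
  then show "\<tau> \<in> K0" unfolding K0_iff using matrix_mult_O2[OF bO kO] by (simp add: \<tau>)
qed

text \<open>
The conditions on the entries of \<open>P\<^sub>i\<^sub>j\<close> after division by \<open>t\<^sup>j\<close> below the diagonal and reduction modulo \<open>t\<close>.
\<close>

definition iwahori_box :: "nat \<Rightarrow> 'n::{finite,linorder} \<times> 'n \<Rightarrow> 'k::{field,finite} E set" where
  "iwahori_box i p = (if snd p < fst p then cyl 0 (int i) else if fst p = snd p then units_E else cyl 0 0)"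

lemma lift_box_Pij:
  fixes \<tau> :: "('k::{field,finite}, 'n::{finite,linorder}) matF"
  assumes j: "1 \<le> j"
  shows "lift (box_indicator (iwahori_box i)) 0 (\<chi> p. if snd p < fst p then int j else 0) (coords \<tau>) = indicator (Pij i j) \<tau>"
proof -
  have "(\<tau> $ r $ s \<in> cyl 0 (if s < r then int j else 0) \<and>
        fls_nth (\<tau> $ r $ s) (if s < r then int j else 0) \<in> iwahori_box i (r, s)) \<longleftrightarrow>
      ((s < r \<longrightarrow> \<tau> $ r $ s \<in> Jideal i j) \<and> (\<not> s < r \<longrightarrow> \<tau> $ r $ s \<in> ring_O2)
    \<and> (r = s \<longrightarrow> residue_O2 (\<tau> $ r $ s) \<noteq> 0))" for r s
  proof (cases "s < r")
    case True
    then show ?thesis by (auto simp: iwahori_box_def Jideal_iff)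
  next
    case False
    then show ?thesis by (auto simp: iwahori_box_def O2_cyl_iff units_E_iff residue_O2_def)
  qed
  then show ?thesis unfolding lift_box Pij_iff[OF j] indicator_def by simp
qed

lemma GL_fubini_box_Pij: "GL_fubini (box_indicator (iwahori_box i) :: ('k::{field,finite} E, 'n::{finite,linorder} \<times> 'n) vec \<Rightarrow> complex)"
\<comment> \<open>Invariance under \<open>u\<^sup>i k[[u]]\<close> suffices below the diagonal and invariance under \<open>u k[[u]]\<close> on it.\<close>
proof (rule GL_fubini_box[of "int i + 1"])
  fix p :: "'n \<times> 'n" and y z :: "'k E"
  show "iwahori_box i p \<subseteq> (cyl 0 0 :: 'k E set)"
    by (auto simp: iwahori_box_def units_E_def cyl_def)
  assume z: "z \<in> cyl y (int i + 1)"
  have "z \<in> cyl 0 m \<longleftrightarrow> y \<in> cyl 0 m" if "m \<le> int i + 1" for m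
    using z that by (auto simp: cyl_def)
  then show "z \<in> iwahori_box i p \<longleftrightarrow> y \<in> iwahori_box i p"
    by (auto simp: iwahori_box_def units_E_def)
qed simp

lemma card_diagonal: "card {p :: 'n::finite \<times> 'n. fst p = snd p} = CARD('n)"
proof -
  have "{p :: 'n \<times> 'n. fst p = snd p} = (\<lambda>a. (a, a)) ` UNIV" by auto
  then show ?thesis by (simp add: card_image inj_on_def)
qed

lemma card_below_diagonal: "card {p :: 'n::{finite,linorder} \<times> 'n. snd p < fst p} = CARD('n) * (CARD('n) - 1) div 2"
proof -
  let ?L = "{p :: 'n \<times> 'n. snd p < fst p}" and ?U = "{p :: 'n \<times> 'n. fst p < snd p}" and ?D = "{p :: 'n \<times> 'n. fst p = snd p}"
  have "?U = prod.swap ` ?L" by (auto simp: image_iff)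
  then have U: "card ?U = card ?L" by (simp add: card_image)
  have "card (UNIV :: ('n \<times> 'n) set) = card (?L \<union> (?U \<union> ?D))"
    by (rule arg_cong[where f = card]) auto
  also have "\<dots> = card ?L + (card ?U + card ?D)"
    by (subst card_Un_disjoint, simp, simp, force, subst card_Un_disjoint) auto
  finally have "CARD('n) * CARD('n) = 2 * card ?L + CARD('n)" by (simp add: U card_diagonal)
  then have "2 * card ?L = CARD('n) * (CARD('n) - 1)" by (simp add: diff_mult_distrib2)
  then show ?thesis by simp
qed

lemma Pij_LG:
  assumes "1 \<le> j" and m: "m = CARD('n) * (CARD('n) - 1) div 2"
  shows "indicator (Pij i j :: ('k::{field,finite}, 'n::{finite,linorder}) matF set) \<in> LG"
    and "morrow_integral (indicator (Pij i j :: ('k, 'n) matF set)) =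
      real_const ((1 - real CARD('k) powi (- 1)) ^ CARD('n) * real CARD('k) powi (- int (m * i))) * fls_X ^ (m * j)"
proof -
  let ?q = "real CARD('k)"
  define c where "c p = (if snd p < fst p then of_real (?q powi (- int i)) else
     if fst p = snd p then of_real (1 - ?q powi (- 1)) else (1 :: complex))" for p :: "'n \<times> 'n"
  have f: "has_fubini_integral has_E_integral
      (box_indicator (iwahori_box i) :: 'k E ^ ('n \<times> 'n) \<Rightarrow> complex) (\<Prod>p\<in>UNIV. c p)"
  proof (rule has_fubini_integral_box)
    fix p :: "'n \<times> 'n"
    show "has_E_integral (indicator (iwahori_box i p) :: 'k E \<Rightarrow> complex) (c p)"
      using has_E_integral_cyl[of "0 :: 'k E" "int i"] has_E_integral_units[where 'k = 'k]
        has_E_integral_cyl[of "0 :: 'k E" 0] unfolding iwahori_box_def c_def by simp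
  qed
  note L = LG_indicator[OF Pij_subset_K0[OF assms(1)] GL_fubini_box_Pij f lift_box_Pij[OF assms(1)]]
  show "indicator (Pij i j :: ('k, 'n) matF set) \<in> LG" by (rule L(1))
  have "(\<Sum>p\<in>(UNIV :: ('n \<times> 'n) set). if snd p < fst p then int j else 0) = int (m * j)"
    unfolding m card_below_diagonal[symmetric] by (simp add: sum.If_cases)
  then have 1: "fls_X powi (\<Sum>p\<in>(UNIV :: ('n \<times> 'n) set). (\<chi> p. if snd p < fst p then int j else 0) $ p) = (fls_X ^ (m * j) :: complex fls)"
    by (simp add: fls_X_power_conv_shift_1)
  have "(\<Prod>p\<in>UNIV. c p) = (\<Prod>p\<in>(UNIV :: ('n \<times> 'n) set). (if snd p < fst p then of_real (?q powi (- int i)) else 1) *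
      (if fst p = snd p then of_real (1 - ?q powi (- 1)) else 1))"
    unfolding c_def by (rule prod.cong) auto
  also have "\<dots> = of_real (?q powi (- int i)) ^ m * of_real (1 - ?q powi (- 1)) ^ CARD('n)"
    unfolding prod.distrib by (simp add: prod.If_cases card_diagonal card_below_diagonal m)
  also have "\<dots> = complex_of_real ((1 - ?q powi (- 1)) ^ CARD('n) * ?q powi (- int (m * i)))"
    unfolding of_real_power[symmetric] powi_neg_power of_real_mult[symmetric] by (simp only: mult.commute)
  finally show "morrow_integral (indicator (Pij i j :: ('k, 'n) matF set)) =
      real_const ((1 - ?q powi (- 1)) ^ CARD('n) * ?q powi (- int (m * i))) * fls_X ^ (m * j)"
    unfolding L(2) 1 real_const_def by (simp only: mult.commute)
qed

section \<open>Normalization\<close>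

text \<open>
The characteristic function of \<open>GL\<^sub>n(k[[u]])\<close> in matrix coordinates.
\<close>

definition GL_indicator :: "'k::{field,finite} E ^ ('n::finite \<times> 'n) \<Rightarrow> complex" where
  "GL_indicator y = (if (\<forall>p. y $ p \<in> cyl 0 0) \<and> fls_nth (det (\<chi> r s. y $ (r, s))) 0 \<noteq> 0 then 1 else 0)"

lemma GL_indicator_eq:
  assumes "\<forall>p. y $ p \<in> cyl 0 0"
  shows "GL_indicator y = (if det (\<chi> r s. fls_nth (y $ (r, s)) 0) \<noteq> 0 then 1 else 0)"
proof -
  have "fls_nth (det (\<chi> r s. y $ (r, s))) 0 = det (\<chi> r s. fls_nth (y $ (r, s)) 0)"
    using det_fls_integers[of "\<chi> r s. y $ (r, s)"] assms by (simp add: cyl_def)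
  then show ?thesis using assms by (simp add: GL_indicator_def)
qed

lemma step_bounds_GL_indicator: "step_bounds 0 1 GL_indicator"
  unfolding step_bounds_def
proof (intro conjI allI impI)
  show "GL_indicator x = 0" if "x $ i \<notin> cyl 0 0" for x :: "'k::{field,finite} E ^ ('n::finite \<times> 'n)" and i
  proof -
    have "\<not> (\<forall>p. x $ p \<in> cyl 0 0)" using that by blast
    then show ?thesis unfolding GL_indicator_def by (simp only: simp_thms if_False)
  qed
  show "GL_indicator y = GL_indicator x" if xy: "\<forall>i. y $ i \<in> cyl (x $ i) 1"
    for x y :: "'k::{field,finite} E ^ ('n::finite \<times> 'n)"
  proof -
    have e: "fls_nth (y $ p) n = fls_nth (x $ p) n" if "n < 1" for p n
      using spec[OF xy, of p] that by (simp add: cyl_def)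
    have iff: "y $ p \<in> cyl 0 0 \<longleftrightarrow> x $ p \<in> cyl 0 0" for p
      using e[of _ p] by (simp add: cyl_def)
    show ?thesis
    proof (cases "\<forall>p. x $ p \<in> cyl 0 0")
      case True
      then show ?thesis using GL_indicator_eq[of x] GL_indicator_eq[of y] iff e by simp
    next
      case False
      then have "\<not> (\<forall>p. y $ p \<in> cyl 0 0)" using iff by simp
      with False show ?thesis unfolding GL_indicator_def by (simp only: simp_thms if_False)
    qed
  qed
qed simp

text \<open>
The proportion of invertible matrices over \<open>k\<close>: each of the \<open>n\<close> factors \<open>q\<^sup>n - q\<^sup>r\<close> of their number is divided by \<open>q\<^sup>n\<close>.
\<close>

lemma d_const_card_GL:
  "(1 / real CARD('k)) ^ (CARD('n) * CARD('n)) * real (card {A :: 'k::{field,finite} ^ 'n ^ 'n::finite. det A \<noteq> 0})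
    = d_const CARD('n) CARD('k)"
proof -
  let ?q = "real CARD('k)" and ?n = "CARD('n)"
  have q: "?q > 1" by (rule card_field_gt_1)
  have "real (card {A :: 'k ^ 'n ^ 'n. det A \<noteq> 0}) = (\<Prod>r<?n. ?q ^ ?n - ?q ^ r)"
    unfolding card_GL of_nat_prod
    by (rule prod.cong) (use q in \<open>auto simp: of_nat_diff power_increasing\<close>)
  then have "(1 / ?q) ^ (?n * ?n) * real (card {A :: 'k ^ 'n ^ 'n. det A \<noteq> 0}) =
      (\<Prod>r<?n. (1 / ?q) ^ ?n) * (\<Prod>r<?n. ?q ^ ?n - ?q ^ r)"
    by (simp add: power_mult)
  also have "\<dots> = (\<Prod>r<?n. (1 / ?q) ^ ?n * (?q ^ ?n - ?q ^ r))" by (rule prod.distrib[symmetric])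
  also have "\<dots> = (\<Prod>r<?n. 1 - ?q powi (- int (?n - r)))"
  proof (rule prod.cong[OF refl])
    fix r assume "r \<in> {..<?n}"
    then have n: "?q ^ ?n = ?q ^ r * ?q ^ (?n - r)" by (simp flip: power_add)
    show "(1 / ?q) ^ ?n * (?q ^ ?n - ?q ^ r) = 1 - ?q powi (- int (?n - r))"
      using q by (simp add: power_one_over n power_int_minus field_simps)
  qed
  also have "\<dots> = (\<Prod>s=1..?n. 1 - ?q powi (- int s))"
    by (rule prod.reindex_bij_witness[of _ "\<lambda>s. ?n - s" "\<lambda>r. ?n - r"]) auto
  finally show ?thesis by (simp add: d_const_def)
qed

text \<open>
For integral matrices the condition depends only on the entries modulo \<open>u\<close>, so the integral is the proportion of invertible matrices over \<open>k\<close>.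
\<close>

lemma has_fubini_integral_GL_indicator:
  "has_fubini_integral has_E_integral (GL_indicator :: 'k::{field,finite} E ^ ('n::finite \<times> 'n) \<Rightarrow> complex)
     (of_real (d_const CARD('n) CARD('k)))"
proof -
  let ?V = "{v :: 'k E ^ ('n \<times> 'n). \<forall>p. v $ p \<in> digit_window 0 1}"
  let ?g = "\<lambda>A :: 'k ^ 'n ^ 'n. (\<chi> p. fls_const (A $ fst p $ snd p)) :: 'k E ^ ('n \<times> 'n)"
  have GL: "GL_indicator (?g A) = (if det A \<noteq> 0 then 1 else 0)" for A
    by (subst GL_indicator_eq) (simp_all add: cyl_def vec_lambda_eta)
  have "(\<Sum>v\<in>?V. GL_indicator v) = (\<Sum>A\<in>UNIV. GL_indicator (?g A))"
  proof (rule sum.reindex_bij_witness[of _ ?g "\<lambda>v. \<chi> r s. fls_nth (v $ (r, s)) 0"])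
    fix v assume v: "v \<in> ?V"
    have "fls_const (fls_nth (v $ p) 0) = v $ p" for p
    proof (rule fls_eqI)
      fix n
      have "v $ p \<in> digit_window 0 1" using v by blast
      then have "fls_nth (v $ p) n = 0" if "n \<noteq> 0" using that by (intro digit_window_nth) auto
      then show "fls_nth (fls_const (fls_nth (v $ p) 0)) n = fls_nth (v $ p) n" by simp
    qed
    then show "?g (\<chi> r s. fls_nth (v $ (r, s)) 0) = v" by (simp add: vec_eq_iff)
    then show "GL_indicator (?g (\<chi> r s. fls_nth (v $ (r, s)) 0)) = GL_indicator v" by simp
  next
    fix A :: "'k ^ 'n ^ 'n"
    show "(\<chi> r s. fls_nth ((?g A) $ (r, s)) 0) = A" by (simp add: vec_eq_iff)
    show "?g A \<in> ?V" by (auto simp: digit_window_def)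
  qed simp
  also have "\<dots> = of_nat (card {A :: 'k ^ 'n ^ 'n. det A \<noteq> 0})"
    unfolding GL by (simp add: sum.If_cases)
  finally have "of_real (real CARD('k) powi (- 1)) ^ CARD('n \<times> 'n) * (\<Sum>v\<in>?V. GL_indicator v) =
      complex_of_real ((1 / real CARD('k)) ^ (CARD('n) * CARD('n)) * real (card {A :: 'k ^ 'n ^ 'n. det A \<noteq> 0}))"
    by (simp add: power_int_minus inverse_eq_divide)
  then show ?thesis
    using has_fubini_integral_step[of 0 1 "GL_indicator :: 'k E ^ ('n \<times> 'n) \<Rightarrow> complex", OF step_bounds_GL_indicator]
    unfolding d_const_card_GL by (simp only:)
qed

lemma lift_GL_indicator: "lift GL_indicator 0 0 (coords \<tau>) = indicator K0 \<tau>"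
  for \<tau> :: "('k::{field,finite}, 'n::finite) matF"
proof (cases "\<forall>r s. \<tau> $ r $ s \<in> ring_O2")
  case True
  have c: "fls_nth (\<tau> $ r $ s) 0 \<in> cyl 0 0" "\<tau> $ r $ s \<in> cyl 0 0" for r s
    using True O2_cyl_iff by blast+
  have "residue_O2 (det \<tau>) = det (\<chi> r s. residue_O2 (\<tau> $ r $ s))"
    using True by (intro det_O2(2)) blast
  moreover have "GL_indicator (\<chi> p. fls_nth (\<tau> $ fst p $ snd p) 0) = (if det (\<chi> r s. residue_O2 (\<tau> $ r $ s)) \<noteq> 0 then 1 else 0)"
    by (subst GL_indicator_eq) (simp_all add: c residue_O2_def)
  ultimately show ?thesis using True c unfolding lift_eq by (simp add: K0_iff indicator_def)
next
  case False
  then have "\<not> (\<forall>r s. \<tau> $ r $ s \<in> cyl 0 0 \<and> fls_nth (\<tau> $ r $ s) 0 \<in> cyl 0 0)" using O2_cyl_iff by blast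
  then have "lift GL_indicator 0 0 (coords \<tau>) = 0"
    unfolding lift_eq GL_indicator_def by auto
  moreover have "\<tau> \<notin> K0" using False K0_iff by blast
  ultimately show ?thesis by simp
qed

lemma K0_LG:
  "indicator (K0 :: ('k::{field,finite}, 'n::finite) matF set) \<in> LG"
  "morrow_integral (indicator (K0 :: ('k, 'n) matF set)) = real_const (d_const CARD('n) CARD('k))"
proof -
  note L = LG_indicator[OF subset_refl GL_fubini_step[OF step_bounds_GL_indicator] has_fubini_integral_GL_indicator lift_GL_indicator]
  show "indicator (K0 :: ('k, 'n) matF set) \<in> LG" by (rule L(1))
  show "morrow_integral (indicator (K0 :: ('k, 'n) matF set)) = real_const (d_const CARD('n) CARD('k))"
    unfolding L(2) real_const_def by simp
qed

lemma d_const_pos: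
  assumes "1 < q"
  shows "0 < d_const n q"
  unfolding d_const_def
proof (rule prod_pos)
  fix r assume "r \<in> {1..n}"
  then have "(1 / real q) ^ r < 1" using assms by (intro power_less_one_iff[THEN iffD2]) auto
  then show "0 < 1 - real q powi (- int r)" by (simp add: power_int_minus power_one_over inverse_eq_divide)
qed

lemma positive_cone_monomial:
  assumes "0 < a"
  shows "real_const a * fls_X ^ k \<in> complexify ` positive_cone"
proof (rule image_eqI)
  let ?r = "fls_const a * fls_X ^ k"
  have n: "fls_nth ?r m = (if m = int k then a else 0)" for m by simp
  have sd: "fls_subdegree ?r = int k" by (rule fls_subdegree_eqI) (use assms in auto)
  show "?r \<in> positive_cone"
    unfolding positive_cone_def using assms sd by (auto simp: n)
  show "real_const a * fls_X ^ k = complexify ?r"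
  proof (rule fls_eqI)
    fix m
    have "fls_nth (complexify ?r) m = complex_of_real (fls_nth ?r m)"
      unfolding complexify_def by (rule nth_Abs_fls_lower_bound[of "int k"]) (simp add: n)
    then show "fls_nth (real_const a * fls_X ^ k) m = fls_nth (complexify ?r) m"
      by (simp add: real_const_def)
  qed
qed

lemma real_const_mult: "real_const a * real_const b = real_const (a * b)"
  by (simp add: real_const_def)

lemma indicator_translate_left:
  assumes "g ** h = mat 1" "h ** g = mat 1"
  shows "indicator ((\<lambda>x. g ** x) ` A) = (\<lambda>x. indicator A (h ** x))"
proof
  fix x
  have "x \<in> (\<lambda>x. g ** x) ` A \<longleftrightarrow> h ** x \<in> A"
  proof
    assume "h ** x \<in> A"
    moreover have "x = g ** (h ** x)" using assms by (simp add: matrix_mul_assoc)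
    ultimately show "x \<in> (\<lambda>x. g ** x) ` A" by (rule rev_image_eqI)
  qed (use assms in \<open>auto simp: matrix_mul_assoc\<close>)
  then show "indicator ((\<lambda>x. g ** x) ` A) x = indicator A (h ** x)" by (simp add: indicator_def)
qed

lemma indicator_translate_right:
  assumes "g ** h = mat 1" "h ** g = mat 1"
  shows "indicator ((\<lambda>x. x ** g) ` A) = (\<lambda>x. indicator A (x ** h))"
proof
  fix x
  have "x \<in> (\<lambda>x. x ** g) ` A \<longleftrightarrow> x ** h \<in> A"
  proof
    assume "x ** h \<in> A"
    moreover have "x = (x ** h) ** g" using assms by (simp flip: matrix_mul_assoc)
    ultimately show "x \<in> (\<lambda>x. x ** g) ` A" by (rule rev_image_eqI)
  qed (use assms in \<open>auto simp flip: matrix_mul_assoc\<close>)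
  then show "indicator ((\<lambda>x. x ** g) ` A) x = indicator A (x ** h)" by (simp add: indicator_def)
qed

lemma indicator_translates_LG:
  fixes A :: "('k::{field,finite}, 'n::finite) matF set"
  assumes A: "indicator A \<in> LG" and g: "g \<in> GLn"
  shows "indicator ((\<lambda>x. g ** x) ` A) \<in> LG \<and> indicator ((\<lambda>x. x ** g) ` A) \<in> LG"
proof -
  obtain h where h: "g ** h = mat 1" "h ** g = mat 1" using g unfolding GLn_def invertible_def by blast
  then have "h \<in> GLn" unfolding GLn_def invertible_def by blast
  then show ?thesis
    unfolding indicator_translate_left[OF h] indicator_translate_right[OF h] using LG_translate[OF A] by blast
qed

theorem theorem6p1:
  fixes n q m :: nat
  assumes "n = CARD('n::{finite,linorder})"
    and "q = CARD('k::{field,finite})"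
    and "m = n * (n - 1) div 2"
  shows
    "(\<forall>\<phi> \<in> (LG :: (('k, 'n) matF \<Rightarrow> complex fls) set). \<forall>\<psi> \<in> LG. \<forall>c \<in> ratfun.
        (\<lambda>x. c * \<phi> x + \<psi> x) \<in> LG \<and> mu (\<lambda>x. c * \<phi> x + \<psi> x) = c * mu \<phi> + mu \<psi>)
   \<and> (\<forall>\<phi> \<in> (LG :: (('k, 'n) matF \<Rightarrow> complex fls) set). \<forall>g \<in> GLn.
        (\<lambda>x. \<phi> (g ** x)) \<in> LG \<and> mu (\<lambda>x. \<phi> (g ** x)) = mu \<phi>
      \<and> (\<lambda>x. \<phi> (x ** g)) \<in> LG \<and> mu (\<lambda>x. \<phi> (x ** g)) = mu \<phi>)
   \<and> mu (indicator (K0 :: ('k, 'n) matF set)) = 1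
   \<and> (\<forall>A :: ('k, 'n) matF set.
        A = K0 \<or> (\<exists>i\<ge>1. \<exists>j\<ge>1. A = Kij i j \<or> A = Pij i j) \<longrightarrow>
          indicator A \<in> LG
        \<and> (\<forall>g \<in> GLn. indicator ((\<lambda>x. g ** x) ` A) \<in> LG \<and> indicator ((\<lambda>x. x ** g) ` A) \<in> LG))
   \<and> (\<forall>i\<ge>1. \<forall>j\<ge>1.
        mu (indicator (Kij i j :: ('k, 'n) matF set))
          = real_const (c_const n q * real q powi (- int (n\<^sup>2 * i))) * fls_X ^ (n\<^sup>2 * j)
      \<and> mu (indicator (Pij i j :: ('k, 'n) matF set))
          = real_const (c_const n q * (1 - real q powi (- 1)) ^ n * real q powi (- int (m * i)))
              * fls_X ^ (m * j)
      \<and> mu (indicator (Kij i j :: ('k, 'n) matF set)) \<in> complexify ` positive_cone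
      \<and> mu (indicator (Pij i j :: ('k, 'n) matF set)) \<in> complexify ` positive_cone)"
proof -
  have q: "1 < q" using card_field_gt_1[where 'k = 'k] assms(2) by simp
  have d: "0 < d_const n q" by (rule d_const_pos[OF q])
  then have c: "0 < c_const n q" by (simp add: c_const_def)
  have K: "mu (indicator (Kij i j :: ('k, 'n) matF set))
          = real_const (c_const n q * real q powi (- int (n\<^sup>2 * i))) * fls_X ^ (n\<^sup>2 * j)" if "1 \<le> j" for i j
    unfolding mu_def Kij_LG(2)[OF that] mult.assoc[symmetric] real_const_mult assms(1,2) ..
  have P: "mu (indicator (Pij i j :: ('k, 'n) matF set))
          = real_const (c_const n q * (1 - real q powi (- 1)) ^ n * real q powi (- int (m * i)))
              * fls_X ^ (m * j)" if "1 \<le> j" for i j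
    unfolding mu_def Pij_LG(2)[OF that assms(3)[unfolded assms(1)]] mult.assoc[symmetric] real_const_mult assms(1,2) ..
  have q1: "0 < 1 - real q powi (- 1)" using q by (simp add: inverse_eq_divide)
  have Kpos: "mu (indicator (Kij i j :: ('k, 'n) matF set)) \<in> complexify ` positive_cone" if "1 \<le> j" for i j
    unfolding K[OF that] using c q by (intro positive_cone_monomial) simp
  have Ppos: "mu (indicator (Pij i j :: ('k, 'n) matF set)) \<in> complexify ` positive_cone" if "1 \<le> j" for i j
    unfolding P[OF that] using c q q1 by (intro positive_cone_monomial mult_pos_pos zero_less_power) simp_all
  have K0: "mu (indicator (K0 :: ('k, 'n) matF set)) = 1"
    using d unfolding mu_def K0_LG(2) real_const_mult c_const_def assms(1,2) by (simp add: real_const_def)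
  have LG: "indicator A \<in> LG" if "A = K0 \<or> (\<exists>i\<ge>1. \<exists>j\<ge>1. A = Kij i j \<or> A = Pij i j)" for A :: "('k, 'n) matF set"
    using that K0_LG(1) Kij_LG(1) Pij_LG(1) by blast
  show ?thesis
  proof (intro conjI)
    show "\<forall>\<phi> \<in> (LG :: (('k, 'n) matF \<Rightarrow> complex fls) set). \<forall>\<psi> \<in> LG. \<forall>c \<in> ratfun.
        (\<lambda>x. c * \<phi> x + \<psi> x) \<in> LG \<and> mu (\<lambda>x. c * \<phi> x + \<psi> x) = c * mu \<phi> + mu \<psi>"
      by (intro ballI) (rule LG_linear)
    show "\<forall>\<phi> \<in> (LG :: (('k, 'n) matF \<Rightarrow> complex fls) set). \<forall>g \<in> GLn.
        (\<lambda>x. \<phi> (g ** x)) \<in> LG \<and> mu (\<lambda>x. \<phi> (g ** x)) = mu \<phi>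
      \<and> (\<lambda>x. \<phi> (x ** g)) \<in> LG \<and> mu (\<lambda>x. \<phi> (x ** g)) = mu \<phi>"
      by (intro ballI) (simp add: LG_translate)
    show "\<forall>A :: ('k, 'n) matF set.
        A = K0 \<or> (\<exists>i\<ge>1. \<exists>j\<ge>1. A = Kij i j \<or> A = Pij i j) \<longrightarrow>
          indicator A \<in> LG
        \<and> (\<forall>g \<in> GLn. indicator ((\<lambda>x. g ** x) ` A) \<in> LG \<and> indicator ((\<lambda>x. x ** g) ` A) \<in> LG)"
      by (intro allI impI conjI[OF LG] ballI indicator_translates_LG[OF LG])
    show "\<forall>i\<ge>1. \<forall>j\<ge>1.
        mu (indicator (Kij i j :: ('k, 'n) matF set))
          = real_const (c_const n q * real q powi (- int (n\<^sup>2 * i))) * fls_X ^ (n\<^sup>2 * j)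
      \<and> mu (indicator (Pij i j :: ('k, 'n) matF set))
          = real_const (c_const n q * (1 - real q powi (- 1)) ^ n * real q powi (- int (m * i)))
              * fls_X ^ (m * j)
      \<and> mu (indicator (Kij i j :: ('k, 'n) matF set)) \<in> complexify ` positive_cone
      \<and> mu (indicator (Pij i j :: ('k, 'n) matF set)) \<in> complexify ` positive_cone"
      by (intro allI impI conjI K P Kpos Ppos)
  qed (rule K0)
qed

end
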